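(* Let $M$ be a free abelian group of rank $n$ with basis $X_1,\dots,X_n$. For a prime congruence $P$ on $\mathbb{T}[X_1^{\pm},\dots,X_n^{\pm}]$, the following are equivalent: (1) $P$ is finitely generated; (2) $\mathsf{L}(P)$ is a submonoid of $\mathbb{R}\times M$ generated by finitely many elements and $\mathbb{R}_{\ge0}\times\{0\}$; (3) $(\operatorname{ht}P,\operatorname{coht}P)$ is equal to $(n+1,0)$ or $(n,1)$; (4) $P$ is one of the following three: (i) the maximum congruence, (ii) a geometric congruence, or (iii) a congruence which corresponds to an $(\mathbb{R}\times M)$-flag $H_\bullet$ of length $1$ with $H_1=\mathbb{R}\times H$, where $H$ is a rational hyperplane of $M_{\mathbb{R}}$.
   Context: $\mathbb{T}=\mathbb{R}\cup\{-\infty\}$ is the semifield with $\oplus=\max$, $\odot=+$. Elements of $\mathbb{T}[X_1^{\pm},\dots,X_n^{\pm}]$ are finite formal sums of monomials $rX^u$, $r\in\mathbb{R}$, $u\in M\cong\mathbb{Z}^n$ (the empty sum is $-\infty$); $0$ is the multiplicative identity, and $rX^u$ is identified with $(r,u)\in\mathbb{R}\times M$. A congruence on a commutative semiring $S$ is a subsemiring $C\subseteq S\times S$ which is an equivalence relation. It is prime if $(S\times S)\setminus C$ is nonempty and closed under $(a,b)\rtimes(c,d)=(ac+bd,ad+bc)$. It is finitely generated if it is the smallest congruence containing some finite subset of $S\times S$. The height $\operatorname{ht}P$ (resp. coheight $\operatorname{coht}P$) of a prime congruence $P$ is the supremum of the $l\ge0$ such that there is a chain of prime congruences $P_0\subsetneq\dots\subsetneq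 P_l=P$ (resp. $P=P_0\subsetneq\dots\subsetneq P_l$). $\mathsf{L}(P)=\{(r,u)\in\mathbb{R}\times M\mid (rX^u\oplus0,\,rX^u)\in P\}$. The maximum congruence is the largest prime congruence, i.e. the kernel congruence of the homomorphism to $\mathbb{B}=\{-\infty,0\}$ sending every element other than $-\infty$ to $0$. A congruence $P$ on $S=\mathbb{T}[X_1^{\pm},\dots,X_n^{\pm}]$ is geometric if the composition $\mathbb{T}\to S\to S/P$ is an isomorphism. Write $M_{\mathbb{R}}=M\otimes\mathbb{R}$; a hyperplane of $M_{\mathbb{R}}$ is a linear subspace of codimension one, and it is rational if it is spanned by elements of $M$. An orientation of a linear hyperplane $\{\ell=0\}$ of a real vector space is one of $\{\ell>0\}$, $\{\ell<0\}$. An $(\mathbb{R}\times M)$-flag consists of an integer $l\ge0$ (its length); linear subspaces $\mathbb{R}\times M_{\mathbb{R}}=H_0\supsetneq\dots\supsetneq H_l$ with $H_i$ a hyperplane of the linear span $\mathbb{R}(H_{i-1}\cap(\mathbb{R}\times M))$ for $i=1,\dots,l$; and an orientation $H_{i,+}$ of each $H_i$ as such a hyperplane, such that $\mathbb{R}_{\ge0}\times\{0\}\subseteq\bigcup_{i=1}^lH_{i,+}\cup H_l$. A prime congruence $P$ corresponds to $H_\bullet$ if $\mathsf{L}(P)=(\bigcup_{i=1}^lH_{i,+}\cup H_l)\cap(\mathbb{R}\times M)$. *)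

theory Defs
  imports "HOL-Analysis.Analysis" "HOL-Analysis.Finite_Function_Topology" "HOL-Library.Extended_Nat"
begin

section \<open>The tropical semifield and tropical Laurent polynomials\<close>

datatype tropical = MInf | Fin real

instantiation tropical :: comm_semiring_1
begin

definition zero_tropical :: tropical where "0 = MInf"

definition one_tropical :: tropical where "1 = Fin 0"

fun plus_tropical :: "tropical \<Rightarrow> tropical \<Rightarrow> tropical" where
  "MInf + y = y"
| "x + MInf = x"
| "Fin a + Fin b = Fin (max a b)"

fun times_tropical :: "tropical \<Rightarrow> tropical \<Rightarrow> tropical" where
  "MInf * y = MInf"
| "x * MInf = MInf"
| "Fin a * Fin b = Fin (a + b)"

instance
proof
  fix a b c :: tropical
  show "a + b + c = a + (b + c)"
    by (cases a; cases b; cases c) auto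
  show "a + b = b + a"
    by (cases a; cases b) auto
  show "a * b * c = a * (b * c)"
    by (cases a; cases b; cases c) auto
  show "a * b = b * a"
    by (cases a; cases b) auto
  show "(a + b) * c = a * c + b * c"
    by (cases a; cases b; cases c) (auto simp: max_def)
  show "0 + a = a" "0 * a = 0" "a * 0 = 0"
    by (cases a; simp add: zero_tropical_def)+
  show "1 * a = a"
    by (cases a) (auto simp: one_tropical_def)
  show "(0 :: tropical) \<noteq> 1"
    by (simp add: zero_tropical_def one_tropical_def)
qed

end

text \<open>
  For an abelian group \<open>'m\<close> (written additively, as the group of exponents) this is the group
  semiring of finitely supported functions with convolution as product. If \<open>'m\<close> is free of
  rank \<open>n\<close>, it is the semiring of tropical Laurent polynomials in \<open>n\<close> variables. Its \<open>0\<close> is the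
  empty sum and its \<open>1\<close> is the monomial with coefficient \<open>Fin 0\<close> and exponent \<open>0\<close>.
\<close>

type_synonym 'm laurent = "'m \<Rightarrow>\<^sub>0 tropical"

definition monomial :: "real \<Rightarrow> 'm \<Rightarrow> 'm laurent" where
  "monomial r u = Poly_Mapping.single u (Fin r)"

definition const_laurent :: "tropical \<Rightarrow> ('m::zero) laurent" where
  "const_laurent t = Poly_Mapping.single 0 t"


section \<open>Congruences on commutative semirings\<close>

definition subsemiring_prod :: "('a::comm_semiring_1 \<times> 'a) set \<Rightarrow> bool" where
  "subsemiring_prod C \<longleftrightarrow> (0, 0) \<in> C \<and> (1, 1) \<in> C \<and>
     (\<forall>a b c d. (a, b) \<in> C \<longrightarrow> (c, d) \<in> C \<longrightarrow> (a + c, b + d) \<in> C \<and> (a * c, b * d) \<in> C)"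

definition congruence :: "('a::comm_semiring_1 \<times> 'a) set \<Rightarrow> bool" where
  "congruence C \<longleftrightarrow> subsemiring_prod C \<and> equiv UNIV C"

definition twisted_prod :: "'a::comm_semiring_1 \<times> 'a \<Rightarrow> 'a \<times> 'a \<Rightarrow> 'a \<times> 'a" where
  "twisted_prod x y =
     (fst x * fst y + snd x * snd y, fst x * snd y + snd x * fst y)"

definition prime_congruence :: "('a::comm_semiring_1 \<times> 'a) set \<Rightarrow> bool" where
  "prime_congruence C \<longleftrightarrow> congruence C \<and> - C \<noteq> {} \<and>
     (\<forall>x \<in> - C. \<forall>y \<in> - C. twisted_prod x y \<in> - C)"

definition fin_gen_congruence :: "('a::comm_semiring_1 \<times> 'a) set \<Rightarrow> bool" where
  "fin_gen_congruence C \<longleftrightarrow> (\<exists>F. finite F \<and> C = congruence hull F)"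

definition height :: "('a::comm_semiring_1 \<times> 'a) set \<Rightarrow> enat" where
  "height P = Sup {enat l | l. \<exists>Q :: nat \<Rightarrow> ('a \<times> 'a) set.
     (\<forall>i\<le>l. prime_congruence (Q i)) \<and> (\<forall>i<l. Q i \<subset> Q (Suc i)) \<and> Q l = P}"

definition coheight :: "('a::comm_semiring_1 \<times> 'a) set \<Rightarrow> enat" where
  "coheight P = Sup {enat l | l. \<exists>Q :: nat \<Rightarrow> ('a \<times> 'a) set.
     (\<forall>i\<le>l. prime_congruence (Q i)) \<and> (\<forall>i<l. Q i \<subset> Q (Suc i)) \<and> Q 0 = P}"


section \<open>Congruences on the Laurent polynomial semiring\<close>

definition L_set :: "(('m::ab_group_add) laurent \<times> 'm laurent) set \<Rightarrow> (real \<times> 'm) set" where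
  "L_set P = {(r, u). (monomial r u + 1, monomial r u) \<in> P}"

definition submonoid :: "('a::comm_monoid_add) set \<Rightarrow> bool" where
  "submonoid N \<longleftrightarrow> 0 \<in> N \<and> (\<forall>x\<in>N. \<forall>y\<in>N. x + y \<in> N)"

text \<open>The boolean semifield is realized as the subset \<open>{MInf, Fin 0}\<close> of the tropical semifield.\<close>

definition to_boolean :: "('m::ab_group_add) laurent \<Rightarrow> tropical" where
  "to_boolean f = (if f = 0 then MInf else Fin 0)"

definition maximum_congruence :: "(('m::ab_group_add) laurent \<times> 'm laurent) set" where
  "maximum_congruence = {(f, g). to_boolean f = to_boolean g}"

text \<open>
  The map from the tropical semifield to the quotient semiring is always a homomorphism, so it
  is an isomorphism if and only if it is bijective.
\<close>

definition geometric :: "(('m::ab_group_add) laurent \<times> 'm laurent) set \<Rightarrow> bool" where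
  "geometric P \<longleftrightarrow> congruence P \<and> bij_betw (\<lambda>t. P `` {const_laurent t}) UNIV (UNIV // P)"


section \<open>Free abelian groups and extension of scalars to the reals\<close>

definition int_multiple :: "int \<Rightarrow> 'm::ab_group_add \<Rightarrow> 'm" where
  "int_multiple k u = (\<Sum>i<nat k. u) - (\<Sum>i<nat (- k). u)"

definition free_basis :: "nat \<Rightarrow> (nat \<Rightarrow> 'm::ab_group_add) \<Rightarrow> bool" where
  "free_basis n X \<longleftrightarrow> (\<forall>u. \<exists>!c :: nat \<Rightarrow> int.
     (\<forall>i. i \<notin> {1..n} \<longrightarrow> c i = 0) \<and> u = (\<Sum>i=1..n. int_multiple (c i) (X i)))"

text \<open>
  The tensor product of \<open>'m\<close> with the reals over the integers: the real vector space with
  generators \<open>u :: 'm\<close> and relations making \<open>u \<mapsto> [u]\<close> additive.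
\<close>

definition additivity_relations :: "('m::ab_group_add \<Rightarrow>\<^sub>0 real) set" where
  "additivity_relations = {Poly_Mapping.single (u + v) 1 -
     Poly_Mapping.single u 1 - Poly_Mapping.single v 1 | u v. True}"

quotient_type (overloaded) 'm real_ext = "'m::ab_group_add \<Rightarrow>\<^sub>0 real" /
  "\<lambda>x y. x - y \<in> span additivity_relations"
proof (rule equivpI)
  show "reflp (\<lambda>x y :: 'm \<Rightarrow>\<^sub>0 real. x - y \<in> span additivity_relations)"
    by (simp add: reflp_def span_zero)
  show "symp (\<lambda>x y :: 'm \<Rightarrow>\<^sub>0 real. x - y \<in> span additivity_relations)"
    by (metis (no_types, lifting) minus_diff_eq span_neg sympI)
  show "transp (\<lambda>x y :: 'm \<Rightarrow>\<^sub>0 real. x - y \<in> span additivity_relations)"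
  proof (rule transpI)
    fix x y z :: "'m \<Rightarrow>\<^sub>0 real"
    assume "x - y \<in> span additivity_relations" "y - z \<in> span additivity_relations"
    from span_add[OF this] show "x - z \<in> span additivity_relations" by simp
  qed
qed

instantiation real_ext :: (ab_group_add) real_vector
begin

lift_definition zero_real_ext :: "'a real_ext" is 0 .

lift_definition plus_real_ext :: "'a real_ext \<Rightarrow> 'a real_ext \<Rightarrow> 'a real_ext" is "(+)"
  by (metis add_diff_add span_add)

lift_definition uminus_real_ext :: "'a real_ext \<Rightarrow> 'a real_ext" is uminus
  by (metis minus_diff_minus span_neg)

lift_definition minus_real_ext :: "'a real_ext \<Rightarrow> 'a real_ext \<Rightarrow> 'a real_ext" is "(-)"
proof -
  fix a b c d :: "'a \<Rightarrow>\<^sub>0 real"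
  assume "a - b \<in> span additivity_relations" "c - d \<in> span additivity_relations"
  from span_diff[OF this] show "a - c - (b - d) \<in> span additivity_relations"
    by (simp add: algebra_simps)
qed

lift_definition scaleR_real_ext :: "real \<Rightarrow> 'a real_ext \<Rightarrow> 'a real_ext" is scaleR
  by (metis scaleR_right_diff_distrib span_scale)

instance
proof
  fix a b c :: "'a real_ext" and r s :: real
  show "a + b + c = a + (b + c)"
    by transfer (simp add: add.assoc span_zero)
  show "a + b = b + a"
    by transfer (simp add: add.commute span_zero)
  show "0 + a = a"
    by transfer (simp add: span_zero)
  show "- a + a = 0"
    by transfer (simp add: span_zero)
  show "a - b = a + - b"
    by transfer (simp add: span_zero)
  show "r *\<^sub>R (a + b) = r *\<^sub>R a + r *\<^sub>R b"
    by transfer (simp add: scaleR_add_right span_zero)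
  show "(r + s) *\<^sub>R a = r *\<^sub>R a + s *\<^sub>R a"
    by transfer (simp add: scaleR_add_left span_zero)
  show "r *\<^sub>R s *\<^sub>R a = (r * s) *\<^sub>R a"
    by transfer (simp add: span_zero)
  show "1 *\<^sub>R a = a"
    by transfer (simp add: span_zero)
qed

end

lift_definition real_emb :: "'m::ab_group_add \<Rightarrow> 'm real_ext" is
  "\<lambda>u. Poly_Mapping.single u 1" .

text \<open>The image of \<open>real \<times> 'm\<close> in \<open>real \<times> 'm real_ext\<close>.\<close>

definition lattice_points :: "(real \<times> ('m::ab_group_add) real_ext) set" where
  "lattice_points = {(r, real_emb u) | r u. True}"


section \<open>Flags\<close>

text \<open>The spaces involved are finite dimensional when \<open>'m\<close> is finitely generated, so that
  the equation between values of \<open>dim\<close> expresses codimension one.\<close>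

definition linear_hyperplane :: "('v::real_vector) set \<Rightarrow> 'v set \<Rightarrow> bool" where
  "linear_hyperplane V H \<longleftrightarrow> subspace V \<and> subspace H \<and> H \<subseteq> V \<and> dim V = dim H + 1"

text \<open>
  Linear functionals on a subspace \<open>V\<close> are the restrictions of linear functionals on the whole
  space. The opposite orientation is obtained by replacing \<open>l\<close> with its negative.
\<close>

definition orientation :: "('v::real_vector) set \<Rightarrow> 'v set \<Rightarrow> 'v set \<Rightarrow> bool" where
  "orientation V H Hp \<longleftrightarrow> (\<exists>l :: 'v \<Rightarrow> real. linear l \<and>
     H = {x \<in> V. l x = 0} \<and> Hp = {x \<in> V. l x > 0})"

definition rational_hyperplane :: "(('m::ab_group_add) real_ext) set \<Rightarrow> bool" where
  "rational_hyperplane K \<longleftrightarrow>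
     linear_hyperplane UNIV K \<and> (\<exists>A :: 'm set. K = span (real_emb ` A))"

definition flag_set :: "nat \<Rightarrow> (nat \<Rightarrow> 'v set) \<Rightarrow> (nat \<Rightarrow> 'v set) \<Rightarrow> 'v set" where
  "flag_set l H Hp = (\<Union>i\<in>{1..l}. Hp i) \<union> H l"

text \<open>\<open>H i\<close> for \<open>i \<le> l\<close> are the subspaces and \<open>Hp i\<close> for \<open>1 \<le> i \<le> l\<close> their orientations;
  values at other indices are irrelevant.\<close>

definition is_flag :: "nat \<Rightarrow> (nat \<Rightarrow> (real \<times> ('m::ab_group_add) real_ext) set) \<Rightarrow>
    (nat \<Rightarrow> (real \<times> 'm real_ext) set) \<Rightarrow> bool" where
  "is_flag l H Hp \<longleftrightarrow>
     H 0 = UNIV \<and>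
     (\<forall>i\<le>l. subspace (H i)) \<and>
     (\<forall>i\<in>{1..l}. H i \<subset> H (i - 1) \<and>
        linear_hyperplane (span (H (i - 1) \<inter> lattice_points)) (H i) \<and>
        orientation (span (H (i - 1) \<inter> lattice_points)) (H i) (Hp i)) \<and>
     {0..} \<times> {0} \<subseteq> flag_set l H Hp"

definition corresponds :: "(('m::ab_group_add) laurent \<times> 'm laurent) set \<Rightarrow> nat \<Rightarrow>
    (nat \<Rightarrow> (real \<times> 'm real_ext) set) \<Rightarrow> (nat \<Rightarrow> (real \<times> 'm real_ext) set) \<Rightarrow> bool" where
  "corresponds P l H Hp \<longleftrightarrow> L_set P = {(r, u). (r, real_emb u) \<in> flag_set l H Hp}"

end

theory Submission
  imports Defs
begin

text \<open>
  A prime congruence \<open>P\<close> is determined by the order that it induces on monomials, and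
  \<open>L_set P\<close> is the positive cone of that order. For every submonoid \<open>L\<close> of \<open>\<real> \<times> M\<close> containing the
  nonnegative constants, let \<open>down L f\<close> consist of the elements lying below some monomial of \<open>f\<close>.
  This assignment turns sums into unions and products into Minkowski sums, so its kernel
  \<open>cone_congruence L\<close> is a congruence, and \<open>L_set\<close> recovers \<open>L\<close> from it
  (\<open>L_set_cone_congruence\<close>). Conversely a prime congruence orders the monomials totally and
  identifies every nonzero polynomial with its leading monomial, whence
  \<open>P = cone_congruence (L_set P)\<close> (\<open>prime_eq_cone_congruence\<close>). Prime congruences thus form the
  same poset as total cones.

  Finite generation passes through this dictionary (\<open>fin_gen_iff\<close>). A finite set of relations in
  \<open>P\<close> follows from finitely many comparisons of monomials. If these comparisons and the constants
  generate the cone \<open>N\<close>, then \<open>cone_congruence N\<close> is a congruence containing the relations, so no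
  comparison outside \<open>N\<close> can be derived from them.

  It remains to find the finitely generated total cones. Comparing with the smallest generator
  that is infinitely larger than a given positive element shows that such a cone is
  Archimedean (\<open>fin_gen_archimedean\<close>). By Hoelder's theorem (\<open>hoelder_embedding\<close>) a proper
  Archimedean cone has the form \<open>\<phi> \<ge> 0\<close> with \<open>\<phi> (r, u) = c * r + \<psi> u\<close> and \<open>c \<ge> 0\<close>. If \<open>c > 0\<close>, the
  quotient is the evaluation at a point, which is the geometric case (\<open>geometric_iff\<close>). If
  \<open>c = 0\<close>, finitely many generators keep the positive values of \<open>\<psi>\<close> away from \<open>0\<close>, so a multiple
  of \<open>\<psi>\<close> is integer valued and onto: this is the case of a rational hyperplane. The remaining
  cone is everything and belongs to the maximum congruence. Explicit generators show
  conversely that these three kinds of cones are finitely generated (\<open>fin_gen_cone_iff\<close>).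

  A hyperplane that is the kernel of \<open>\<lambda>\<close> and is spanned by lattice vectors gives an integral \<open>\<psi>\<close>
  for the following reason. If two values \<open>\<psi> (X i)\<close>, \<open>\<psi> (X j)\<close> had an irrational quotient,
  a rationally linear map \<open>\<real> \<rightarrow> \<real>\<close> killing one but not the other would yield a nonzero
  linear form that vanishes on the same hyperplane without being proportional to \<open>\<lambda>\<close>
  (\<open>halfspace_if_flag\<close>).

  For the heights, a strictly increasing chain of total cones has strictly increasing groups of
  units, and these are pure subgroups. Their rational rank in \<open>M\<close>, increased by one if all constants
  are units, therefore bounds the height (\<open>height_le_cone_rank\<close>). Truncated lexicographic orders
  attain the bound in the three cases (\<open>lex_cone_chain\<close>). A non-Archimedean cone has an intermediate cone below the
  whole group, so coheight one forces \<open>\<phi> \<ge> 0\<close> again, and height \<open>n\<close> then forces the kernel of \<open>\<psi>\<close>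
  to have rank \<open>n - 1\<close> when \<open>c = 0\<close>, that is, rational proportions between the values of \<open>\<psi>\<close>.
\<close>

section \<open>Congruences defined by cones\<close>

definition cone :: "(real \<times> 'm::ab_group_add) set \<Rightarrow> bool" where
  "cone L \<longleftrightarrow> submonoid L \<and> {0..} \<times> {0} \<subseteq> L"

definition is_total :: "'g::ab_group_add set \<Rightarrow> bool" where
  "is_total L \<longleftrightarrow> (\<forall>x. x \<in> L \<or> - x \<in> L)"

definition monomials :: "'m laurent \<Rightarrow> (real \<times> 'm) set" where
  "monomials f = {(r, v). Poly_Mapping.lookup f v = Fin r}"

definition down :: "(real \<times> 'm::ab_group_add) set \<Rightarrow> 'm laurent \<Rightarrow> (real \<times> 'm) set" where
  "down L f = {x. \<exists>t\<in>monomials f. t - x \<in> L}"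

definition cone_congruence :: "(real \<times> 'm::ab_group_add) set \<Rightarrow> ('m laurent \<times> 'm laurent) set" where
  "cone_congruence L = {(f, g). down L f = down L g}"

lemma submonoidD:
  assumes "submonoid L"
  shows submonoid_zero: "0 \<in> L" and submonoid_add: "\<And>x y. x \<in> L \<Longrightarrow> y \<in> L \<Longrightarrow> x + y \<in> L"
  using assms by (auto simp: submonoid_def)

lemma submonoid_hull: "submonoid (submonoid hull S)"
  by (rule hull_in) (auto simp: submonoid_def)

lemma coneD:
  assumes "cone L"
  shows cone_zero: "0 \<in> L" and cone_add: "\<And>x y. x \<in> L \<Longrightarrow> y \<in> L \<Longrightarrow> x + y \<in> L"
    and cone_const: "\<And>r. r \<ge> 0 \<Longrightarrow> (r, 0) \<in> L"
  using assms by (auto simp: cone_def submonoid_def)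

lemma laurent_induct [case_names zero monomial add]:
  assumes "Q 0" "\<And>r u. Q (monomial r u)" "\<And>f g. Q f \<Longrightarrow> Q g \<Longrightarrow> Q (f + g)"
  shows "Q (f :: 'm laurent)"
proof (induction f rule: Poly_Mapping.update_induct)
  case const
  show ?case by (rule assms(1))
next
  case (update f a b)
  have b: "b = Fin (case b of Fin r \<Rightarrow> r)"
    using update(2) by (cases b) (auto simp: zero_tropical_def)
  have "Poly_Mapping.update a b f = f + monomial (case b of Fin r \<Rightarrow> r) a"
    using update(1) b
    by (intro poly_mapping_eqI)
       (auto simp: lookup_update lookup_add monomial_def lookup_single when_def in_keys_iff)
  then show ?case
    using assms(2,3) update.IH by metis
qed

lemma monomials_0 [simp]: "monomials 0 = {}"
  by (auto simp: monomials_def zero_tropical_def)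

lemma monomials_monomial [simp]: "monomials (monomial r u) = {(r, u)}"
  by (auto simp: monomials_def monomial_def lookup_single when_def zero_tropical_def)

lemma one_laurent: "(1 :: 'm::ab_group_add laurent) = monomial 0 0"
  by (simp add: monomial_def one_tropical_def[symmetric])

lemma monomial_mult: "monomial r u * monomial s v = monomial (r + s) (u + v)"
  by (simp add: monomial_def mult_single)

lemma finite_monomials: "finite (monomials f)"
proof -
  have "monomials f \<subseteq> (\<lambda>v. (case Poly_Mapping.lookup f v of Fin r \<Rightarrow> r, v)) ` Poly_Mapping.keys f"
    by (force simp: monomials_def in_keys_iff zero_tropical_def image_iff)
  then show ?thesis
    by (rule finite_subset) auto
qed

lemma monomials_eq_empty: "monomials f = {} \<longleftrightarrow> f = 0"
proof
  assume "monomials f = {}"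
  then have "Poly_Mapping.lookup f v = 0" for v
    by (cases "Poly_Mapping.lookup f v") (auto simp: monomials_def zero_tropical_def)
  then show "f = 0" by (intro poly_mapping_eqI) simp
qed simp

lemma laurent_add_idem: "f + f = (f :: 'm laurent)"
proof (rule poly_mapping_eqI)
  fix k show "Poly_Mapping.lookup (f + f) k = Poly_Mapping.lookup f k"
    by (cases "Poly_Mapping.lookup f k") (auto simp: lookup_add)
qed

lemma laurent_add_monomial: "(r, u) \<in> monomials f \<Longrightarrow> f + monomial r u = f"
proof (rule poly_mapping_eqI)
  fix k assume "(r, u) \<in> monomials f"
  then show "Poly_Mapping.lookup (f + monomial r u) k = Poly_Mapping.lookup f k"
    by (cases "Poly_Mapping.lookup f k")
       (auto simp: monomials_def monomial_def lookup_add lookup_single when_def zero_tropical_def)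
qed

lemma down_0 [simp]: "down L 0 = {}"
  by (simp add: down_def)

lemma down_monomial: "down L (monomial r u) = {x. (r, u) - x \<in> L}"
  by (simp add: down_def)

lemma down_add:
  assumes "cone L"
  shows "down L (f + g) = down L f \<union> down L g"
proof -
  have *: "x \<in> down L (f + g)" if x: "x \<in> down L f" for x and f g :: "'a laurent"
  proof -
    obtain r v where rv: "Poly_Mapping.lookup f v = Fin r" "(r, v) - x \<in> L"
      using x by (auto simp: down_def monomials_def)
    obtain s where s: "Poly_Mapping.lookup (f + g) v = Fin s" "s \<ge> r"
      by (cases "Poly_Mapping.lookup g v") (auto simp: lookup_add rv)
    have "(s - r, 0) + ((r, v) - x) \<in> L"
      using s rv by (intro cone_add[OF assms] cone_const[OF assms]) auto
    also have "(s - r, 0) + ((r, v) - x) = (s, v) - x"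
      by (cases x) simp
    finally show ?thesis using s by (auto simp: down_def monomials_def)
  qed
  have "monomials (f + g) \<subseteq> monomials f \<union> monomials g"
  proof (clarify)
    fix r v assume "(r, v) \<in> monomials (f + g)" "(r, v) \<notin> monomials g"
    then show "(r, v) \<in> monomials f"
      by (cases "Poly_Mapping.lookup f v"; cases "Poly_Mapping.lookup g v")
         (auto simp: monomials_def lookup_add max_def split: if_splits)
  qed
  then have "down L (f + g) \<subseteq> down L f \<union> down L g"
    by (auto simp: down_def)
  moreover have "down L g \<subseteq> down L (f + g)"
    using *[of _ g f] by (auto simp: add.commute)
  ultimately show ?thesis using * by blast
qed

text \<open>
  The inclusion that is not formal is the one for monomials: below the product \<open>s + t\<close> of two
  monomials lies \<open>x\<close> exactly if \<open>x - t\<close> lies below \<open>s\<close>. Distributivity does the rest.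
\<close>

lemma down_mult:
  assumes "cone L"
  shows "down L (f * g) = {x + y | x y. x \<in> down L f \<and> y \<in> down L g}"
proof (induction f rule: laurent_induct)
  case zero
  show ?case by simp
next
  case (monomial r u)
  show ?case
  proof (induction g rule: laurent_induct)
    case zero
    show ?case by simp
  next
    case (monomial s v)
    show ?case
    proof (intro equalityI subsetI)
      fix x assume "x \<in> down L (monomial r u * monomial s v)"
      then have "(r, u) - (x - (s, v)) \<in> L"
        by (cases x) (auto simp: monomial_mult down_monomial algebra_simps)
      moreover have "(s, v) - (s, v) \<in> L" using cone_zero[OF assms] by simp
      moreover have "x = (x - (s, v)) + (s, v)" by simp
      ultimately show "x \<in> {x + y |x y. x \<in> down L (monomial r u) \<and> y \<in> down L (monomial s v)}"
        unfolding down_monomial by blast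
    next
      fix x assume "x \<in> {x + y |x y. x \<in> down L (monomial r u) \<and> y \<in> down L (monomial s v)}"
      then obtain y z where "x = y + z" "(r, u) - y \<in> L" "(s, v) - z \<in> L"
        by (auto simp: down_monomial)
      moreover have "((r, u) - y) + ((s, v) - z) = (r + s, u + v) - (y + z)"
        by (cases y; cases z) simp
      ultimately have "(r + s, u + v) - x \<in> L" using cone_add[OF assms] by metis
      then show "x \<in> down L (monomial r u * monomial s v)"
        by (simp add: monomial_mult down_monomial)
    qed
  next
    case (add f g)
    show ?case
      unfolding distrib_left down_add[OF assms] add by blast
  qed
next
  case (add f1 f2)
  show ?case
    unfolding distrib_right down_add[OF assms] add by blast
qed

lemma in_down_self: "cone L \<Longrightarrow> t \<in> monomials f \<Longrightarrow> t \<in> down L f"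
  using cone_zero by (force simp: down_def)

lemma congruence_cone_congruence:
  assumes "cone L"
  shows "congruence (cone_congruence L)"
proof -
  have "equiv UNIV (cone_congruence L)"
    by (auto simp: equiv_def refl_on_def sym_def trans_def cone_congruence_def)
  then show ?thesis
    by (auto simp: congruence_def subsemiring_prod_def cone_congruence_def
        down_add[OF assms] down_mult[OF assms])
qed

text \<open>
  The polynomial \<open>1\<close> has the down-set \<open>- L\<close>, and this is contained in the down-set of the
  monomial \<open>(r, u)\<close> exactly if \<open>0\<close> is, because \<open>L\<close> is closed under addition.
\<close>

lemma L_set_cone_congruence:
  assumes "cone L"
  shows "L_set (cone_congruence L) = L"
proof -
  have "(r, u) \<in> L_set (cone_congruence L) \<longleftrightarrow> (r, u) \<in> L" for r u
  proof -
    have "(r, u) \<in> L_set (cone_congruence L) \<longleftrightarrow>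
        {x. (r, u) - x \<in> L} \<union> {x. - x \<in> L} = {x. (r, u) - x \<in> L}"
      by (simp add: L_set_def cone_congruence_def down_add[OF assms] one_laurent down_monomial flip: zero_prod_def)
    also have "\<dots> \<longleftrightarrow> (\<forall>x. - x \<in> L \<longrightarrow> (r, u) - x \<in> L)" by blast
    also have "\<dots> \<longleftrightarrow> (r, u) \<in> L"
    proof
      assume "\<forall>x. - x \<in> L \<longrightarrow> (r, u) - x \<in> L"
      from this[rule_format, of 0] show "(r, u) \<in> L" using cone_zero[OF assms] by simp
    qed (metis add_uminus_conv_diff assms cone_add)
    finally show ?thesis .
  qed
  then show ?thesis by auto
qed

section \<open>Prime congruences and total cones\<close>

lemma congruenceD:
  assumes "congruence C"
  shows congruence_refl: "(a, a) \<in> C"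
    and congruence_sym: "(a, b) \<in> C \<Longrightarrow> (b, a) \<in> C"
    and congruence_trans: "(a, b) \<in> C \<Longrightarrow> (b, c) \<in> C \<Longrightarrow> (a, c) \<in> C"
    and congruence_add: "(a, b) \<in> C \<Longrightarrow> (c, d) \<in> C \<Longrightarrow> (a + c, b + d) \<in> C"
    and congruence_mult: "(a, b) \<in> C \<Longrightarrow> (c, d) \<in> C \<Longrightarrow> (a * c, b * d) \<in> C"
proof -
  have "equiv UNIV C" "subsemiring_prod C" using assms by (auto simp: congruence_def)
  then have "refl C" "sym C" "trans C" by (auto simp: equiv_def)
  note equiv = this
  show "(a, a) \<in> C"
    using equiv(1) by (rule reflD)
  show "(a, b) \<in> C \<Longrightarrow> (b, a) \<in> C"
    using equiv(2) by (rule symD)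
  show "(a, b) \<in> C \<Longrightarrow> (b, c) \<in> C \<Longrightarrow> (a, c) \<in> C"
    using equiv(3) by (rule transD)
  show "(a, b) \<in> C \<Longrightarrow> (c, d) \<in> C \<Longrightarrow> (a + c, b + d) \<in> C"
    "(a, b) \<in> C \<Longrightarrow> (c, d) \<in> C \<Longrightarrow> (a * c, b * d) \<in> C"
    using \<open>subsemiring_prod C\<close> unfolding subsemiring_prod_def by simp_all
qed

lemma congruence_hull: "congruence (congruence hull S)"
proof (rule hull_in)
  fix T :: "('a \<times> 'a) set set"
  assume T: "Ball T congruence"
  then have *: "congruence C" if "C \<in> T" for C using that by blast
  have "equiv UNIV (\<Inter>T)"
  proof (rule equivI, simp)
    show "refl (\<Inter>T)" using congruence_refl[OF *] by (auto simp: refl_on_def)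
    show "sym (\<Inter>T)" using congruence_sym[OF *] by (auto simp: sym_def)
    show "trans (\<Inter>T)" using congruence_trans[OF *] by (fast intro: transI)
  qed
  moreover have "subsemiring_prod (\<Inter>T)"
    using congruence_refl[OF *] congruence_add[OF *] congruence_mult[OF *]
    unfolding subsemiring_prod_def by simp
  ultimately show "congruence (\<Inter>T)" by (simp add: congruence_def)
qed

text \<open>
  Monomials are units, so a comparison between two of them can be translated to a comparison
  with \<open>1\<close>, which is what \<open>L_set\<close> records.
\<close>

lemma monomial_shift:
  assumes C: "congruence C"
  shows "(monomial r u + monomial s v, monomial r u) \<in> C \<longleftrightarrow> (r, u) - (s, v) \<in> L_set C"
proof -
  let ?m = "monomial (r - s) (u - v)"
  have 1: "monomial s v * (?m + 1) = monomial r u + monomial s v" "monomial s v * ?m = monomial r u"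
    by (simp_all add: distrib_left monomial_mult one_laurent)
  have 2: "monomial (- s) (- v) * (monomial r u + monomial s v) = ?m + 1"
      "monomial (- s) (- v) * monomial r u = ?m"
    by (simp_all add: distrib_left monomial_mult one_laurent)
  show ?thesis
    using congruence_mult[OF C congruence_refl[OF C, of "monomial s v"], of "?m + 1" ?m]
      congruence_mult[OF C congruence_refl[OF C, of "monomial (- s) (- v)"], of "monomial r u + monomial s v" "monomial r u"]
    unfolding 1 2 by (auto simp: L_set_def)
qed

lemma cone_L_set:
  assumes C: "congruence C"
  shows "cone (L_set C)"
proof -
  have const: "(r, 0) \<in> L_set C" if "r \<ge> 0" for r
  proof -
    have "monomial r (0::'a) + 1 = monomial r 0"
      using that
      by (intro poly_mapping_eqI)
         (auto simp: one_laurent monomial_def lookup_add lookup_single when_def max_def zero_tropical_def)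
    then show ?thesis using congruence_refl[OF C] by (simp add: L_set_def)
  qed
  have add: "(r + s, u + v) \<in> L_set C" if "(r, u) \<in> L_set C" "(s, v) \<in> L_set C" for r u s v
  proof -
    let ?m = "monomial r u" and ?n = "monomial s v"
    have m: "(?m + 1, ?m) \<in> C" and n: "(?n + 1, ?n) \<in> C"
      using that by (auto simp: L_set_def)
    have a: "(?m * (?n + 1), ?m * ?n) \<in> C"
      by (intro congruence_mult C congruence_refl n)
    then have b: "(?m * ?n, ?m * ?n + ?m) \<in> C"
      using congruence_sym[OF C] by (simp add: distrib_left)
    have c: "((?m * ?n + ?m) + 1, ?m * ?n + ?m) \<in> C"
      unfolding add.assoc by (intro congruence_add C congruence_refl m)
    have d: "((?m * ?n + ?m) + 1, ?m * ?n + 1) \<in> C"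
      using a by (intro congruence_add C congruence_refl) (simp add: distrib_left)
    have "(?m * ?n + 1, ?m * ?n) \<in> C"
      by (rule congruence_trans[OF C congruence_sym[OF C d] congruence_trans[OF C c congruence_sym[OF C b]]])
    then show ?thesis by (simp add: L_set_def monomial_mult)
  qed
  show ?thesis
    unfolding cone_def submonoid_def
    using const[of 0] by (auto simp: zero_prod_def intro: add const)
qed

text \<open>
  If \<open>down L f \<subseteq> down L g\<close>, each monomial of \<open>f\<close> is dominated by one of \<open>g\<close> and can be absorbed into
  \<open>g\<close> modulo \<open>C\<close>. Absorbing in both directions identifies \<open>f\<close> and \<open>g\<close> with \<open>f + g\<close>.
\<close>

lemma cone_congruence_subset:
  assumes C: "congruence C" and L: "cone L" "L \<subseteq> L_set C"
  shows "cone_congruence L \<subseteq> C"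
proof -
  have *: "down L f \<subseteq> down L g \<Longrightarrow> (g + f, g) \<in> C" for f g
  proof (induction f rule: laurent_induct)
    case zero
    show ?case by (simp add: congruence_refl[OF C])
  next
    case (monomial r u)
    then have "(r, u) \<in> down L g"
      using cone_zero[OF L(1)] by (auto simp: down_monomial)
    then obtain s v where g: "(s, v) \<in> monomials g" and "(s, v) - (r, u) \<in> L_set C"
      using L(2) by (auto simp: down_def)
    then have "(monomial s v + monomial r u, monomial s v) \<in> C"
      by (simp add: monomial_shift[OF C])
    then have "(g + (monomial s v + monomial r u), g + monomial s v) \<in> C"
      by (intro congruence_add C congruence_refl)
    then show ?case
      by (simp add: laurent_add_monomial[OF g] flip: add.assoc)
  next
    case (add f1 f2)
    have 1: "(g + f1, g) \<in> C" "(g + f2, g) \<in> C"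
      using add by (auto simp: down_add[OF L(1)])
    have "((g + f1) + f2, g + f2) \<in> C"
      using 1 by (intro congruence_add C congruence_refl)
    then show ?case using 1 congruence_trans[OF C] by (metis add.assoc)
  qed
  show ?thesis
  proof (clarify)
    fix f g assume "(f, g) \<in> cone_congruence L"
    then have "(g + f, g) \<in> C" "(f + g, f) \<in> C"
      by (auto simp: cone_congruence_def intro: *)
    then show "(f, g) \<in> C"
      using congruence_trans[OF C] congruence_sym[OF C] by (metis add.commute)
  qed
qed

text \<open>
  The twisted product of \<open>(m + 1, m)\<close> and \<open>(m + 1, 1)\<close> has two equal components, because addition is
  idempotent, so primality puts one of these two pairs into \<open>P\<close>.
\<close>

lemma prime_total:
  assumes "prime_congruence P"
  shows "is_total (L_set P)"
  unfolding is_total_def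
proof (intro allI)
  fix x :: "real \<times> 'a"
  obtain r u where x: "x = (r, u)" by (cases x)
  have C: "congruence P" using assms by (simp add: prime_congruence_def)
  let ?f = "monomial r u"
  have "twisted_prod (?f + 1, ?f) (?f + 1, 1) = ((?f + 1) * (?f + 1) + ?f * 1, (?f + 1) * 1 + ?f * (?f + 1))"
    by (simp add: twisted_prod_def)
  also have "(?f + 1) * (?f + 1) + ?f * 1 = ?f * ?f + 1 + (?f + ?f + ?f)"
    by (simp add: algebra_simps)
  also have "\<dots> = (?f + 1) * 1 + ?f * (?f + 1)"
    using laurent_add_idem[of ?f] by (simp add: algebra_simps flip: add.assoc)
  finally have "twisted_prod (?f + 1, ?f) (?f + 1, 1) \<in> P"
    using congruence_refl[OF C] by simp
  then have "(?f + 1, ?f) \<in> P \<or> (?f + 1, 1) \<in> P"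
    using assms unfolding prime_congruence_def by blast
  then show "x \<in> L_set P \<or> - x \<in> L_set P"
  proof
    assume "(?f + 1, 1) \<in> P"
    then have "(monomial 0 0 + monomial r u, monomial 0 0) \<in> P"
      by (simp add: one_laurent add.commute)
    then have "(0, 0) - x \<in> L_set P"
      by (simp only: monomial_shift[OF C] x)
    then show ?thesis by (simp flip: zero_prod_def)
  qed (simp add: x L_set_def)
qed

lemma total_minimum:
  assumes "submonoid L" "is_total L" "finite A" "A \<noteq> {}"
  shows "\<exists>t\<in>A. \<forall>s\<in>A. s - t \<in> L"
  using assms(3,4)
proof (induction A rule: finite_ne_induct)
  case (singleton x)
  then show ?case using submonoid_zero[OF assms(1)] by simp
next
  case (insert x A)
  then obtain t where t: "t \<in> A" "\<forall>s\<in>A. s - t \<in> L" by blast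
  show ?case
  proof (cases "x - t \<in> L")
    case True
    then show ?thesis using t by blast
  next
    case False
    then have xt: "t - x \<in> L"
      using assms(2) unfolding is_total_def by (metis minus_diff_eq)
    have "s - x \<in> L" if "s \<in> A" for s
      using submonoid_add[OF assms(1) xt, of "s - t"] t that by simp
    then show ?thesis using submonoid_zero[OF assms(1)] by auto
  qed
qed

lemma total_maximum:
  assumes "submonoid L" "is_total L" "finite A" "A \<noteq> {}"
  shows "\<exists>t\<in>A. \<forall>s\<in>A. t - s \<in> L"
proof -
  have "- (x + y) \<in> L" if "- x \<in> L" "- y \<in> L" for x y
    using submonoid_add[OF assms(1) that] by (simp add: add.commute)
  then have "submonoid {x. - x \<in> L}"
    using submonoid_zero[OF assms(1)] by (simp add: submonoid_def)
  moreover have "is_total {x. - x \<in> L}" using assms(2) unfolding is_total_def by auto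
  ultimately have "\<exists>t\<in>A. \<forall>s\<in>A. s - t \<in> {x. - x \<in> L}"
    using assms(3,4) by (rule total_minimum)
  then show ?thesis by simp
qed

text \<open>
  The finitely many monomials of \<open>f\<close> are totally preordered, and a largest one dominates everything
  that lies below any of them.
\<close>

lemma leading_monomial:
  assumes L: "cone L" "is_total L" and f: "f \<noteq> 0"
  obtains r u where "(r, u) \<in> monomials f" "down L f = down L (monomial r u)"
proof -
  have "submonoid L" using L(1) by (simp add: cone_def)
  then obtain t where t: "t \<in> monomials f" "\<forall>s\<in>monomials f. t - s \<in> L"
    using total_maximum[OF _ L(2) finite_monomials, of f] f by (auto simp: monomials_eq_empty)
  have "down L f = {x. t - x \<in> L}"
  proof (intro equalityI subsetI)
    fix x assume "x \<in> down L f"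
    then obtain s where "s \<in> monomials f" "s - x \<in> L" by (auto simp: down_def)
    then show "x \<in> {x. t - x \<in> L}"
      using cone_add[OF L(1), of "t - s" "s - x"] t by simp
  qed (use t in \<open>auto simp: down_def\<close>)
  then show thesis using t that by (cases t) (auto simp: down_monomial)
qed

lemma proper_zero_not_unit:
  fixes C :: "('m::ab_group_add laurent \<times> 'm laurent) set"
  assumes C: "congruence C" and "C \<noteq> UNIV" 
  shows "(0, monomial r u) \<notin> C"
proof
  assume "(0, monomial r u) \<in> C"
  then have "(0 * monomial (- r) (- u), monomial r u * monomial (- r) (- u)) \<in> C"
    by (intro congruence_mult C congruence_refl)
  then have 1: "(0, 1) \<in> C" by (simp add: monomial_mult one_laurent)
  have "(0, a) \<in> C" for a
    using congruence_mult[OF C 1 congruence_refl[OF C, of a]] by simp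
  then have "(a, b) \<in> C" for a b
    using congruence_trans[OF C] congruence_sym[OF C] by blast
  then show False using assms(2) by auto
qed

text \<open>
  Related polynomials have related leading monomials. For monomials \<open>m\<close>, \<open>m'\<close> a relation
  is the same as two inequalities, since \<open>m\<close> is then equivalent to \<open>m + m'\<close>.
\<close>

lemma prime_eq_cone_congruence:
  assumes P: "prime_congruence P"
  shows "P = cone_congruence (L_set P)"
proof
  have C: "congruence P" and proper: "P \<noteq> UNIV"
    using P by (auto simp: prime_congruence_def)
  note L = cone_L_set[OF C] prime_total[OF P]
  show sub: "cone_congruence (L_set P) \<subseteq> P"
    by (rule cone_congruence_subset[OF C L(1) order_refl])
  have nz: "f \<noteq> 0" if fg: "(f, g) \<in> P" "g \<noteq> 0" for f g
  proof
    assume "f = 0"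
    obtain s v where "down (L_set P) g = down (L_set P) (monomial s v)"
      using leading_monomial[OF L fg(2)] by blast
    then have "(g, monomial s v) \<in> P" using sub by (auto simp: cone_congruence_def)
    then have "(0, monomial s v) \<in> P" using congruence_trans[OF C fg(1)] \<open>f = 0\<close> by simp
    then show False using proper_zero_not_unit[OF C proper] by blast
  qed
  have le: "(r, u) - (s, v) \<in> L_set P" if "(monomial r u, monomial s v) \<in> P" for r u s v
  proof -
    have "(monomial r u + monomial s v, monomial r u + monomial r u) \<in> P"
      by (rule congruence_add[OF C congruence_refl[OF C] congruence_sym[OF C that]])
    then show ?thesis by (simp add: laurent_add_idem monomial_shift[OF C])
  qed
  show "P \<subseteq> cone_congruence (L_set P)"
  proof (clarify)
    fix f g assume fg: "(f, g) \<in> P"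
    show "(f, g) \<in> cone_congruence (L_set P)"
    proof (cases "f = 0 \<or> g = 0")
      case True
      then have "f = 0" "g = 0" using nz fg congruence_sym[OF C] by blast+
      then show ?thesis by (simp add: cone_congruence_def)
    next
      case False
      then obtain r u s v where
        f: "down (L_set P) f = down (L_set P) (monomial r u)" and
        g: "down (L_set P) g = down (L_set P) (monomial s v)"
        using leading_monomial[OF L] by metis
      then have "(f, monomial r u) \<in> P" "(g, monomial s v) \<in> P"
        using sub by (auto simp: cone_congruence_def)
      then have "(monomial r u, monomial s v) \<in> P"
        using fg by (meson congruence_trans[OF C] congruence_sym[OF C])
      then have ab: "(r, u) - (s, v) \<in> L_set P" "(s, v) - (r, u) \<in> L_set P"
        using le congruence_sym[OF C] by blast+
      have "down (L_set P) (monomial r u) = down (L_set P) (monomial s v)"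
        unfolding down_monomial
      proof (intro Collect_cong iffI)
        fix x assume "(r, u) - x \<in> L_set P"
        from cone_add[OF L(1) ab(2) this] show "(s, v) - x \<in> L_set P"
          by (cases x) simp
      next
        fix x assume "(s, v) - x \<in> L_set P"
        from cone_add[OF L(1) ab(1) this] show "(r, u) - x \<in> L_set P"
          by (cases x) simp
      qed
      then show ?thesis using f g by (simp add: cone_congruence_def)
    qed
  qed
qed

lemma diff_swap: "p + q = x + y \<Longrightarrow> y - q = p - (x :: 'g::ab_group_add)"
  by (simp add: algebra_simps)

text \<open>
  Down-sets modulo a total cone are principal and linearly ordered. If the leading monomials
  \<open>m\<close> of \<open>a\<close> and \<open>m'\<close> of \<open>c\<close> strictly dominate \<open>b\<close> and \<open>d\<close>, then \<open>m + m'\<close> is the leading monomial of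
  \<open>a c + b d\<close> and strictly dominates \<open>a d + b c\<close>.
\<close>

lemma prime_cone_congruence:
  assumes L: "cone L" "is_total L"
  shows "prime_congruence (cone_congruence L)"
proof -
  have "(0, 1) \<notin> cone_congruence L"
  proof -
    have "0 \<in> down L 1"
      using cone_zero[OF L(1)] by (simp add: one_laurent down_monomial flip: zero_prod_def)
    then show ?thesis by (auto simp: cone_congruence_def)
  qed
  then have proper: "- cone_congruence L \<noteq> {}" by blast
  have down_closed: "y \<in> down L f" if x: "x \<in> down L f" "x - y \<in> L" for x y f
  proof -
    obtain t where t: "t \<in> monomials f" "t - x \<in> L" using x(1) by (auto simp: down_def)
    then show ?thesis using cone_add[OF L(1) t(2) x(2)] by (auto simp: down_def)
  qed
  have main: "twisted_prod (a, b) (c, d) \<notin> cone_congruence L"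
    if ab: "\<not> down L a \<subseteq> down L b" and cd: "\<not> down L c \<subseteq> down L d" for a b c d
  proof -
    obtain r u where m: "(r, u) \<in> down L a" "down L a = down L (monomial r u)"
      using leading_monomial[OF L, of a] ab in_down_self[OF L(1)] by (metis down_0 empty_subsetI)
    obtain s v where n: "(s, v) \<in> down L c" "down L c = down L (monomial s v)"
      using leading_monomial[OF L, of c] cd in_down_self[OF L(1)] by (metis down_0 empty_subsetI)
    have m': "(r, u) \<notin> down L b"
      using ab m down_closed by (auto simp: down_monomial)
    have n': "(s, v) \<notin> down L d"
      using cd n down_closed by (auto simp: down_monomial)
    have "(r, u) + (s, v) \<in> down L (a * c + b * d)"
      using m n by (simp add: down_add[OF L(1)] down_mult[OF L(1)]) blast
    moreover have "(r, u) + (s, v) \<notin> down L (a * d)"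
    proof
      assume "(r, u) + (s, v) \<in> down L (a * d)"
      then obtain x y where xy: "(r, u) + (s, v) = x + y" "(r, u) - x \<in> L" "y \<in> down L d"
        by (auto simp: down_mult[OF L(1)] m(2) down_monomial)
      then have "y - (s, v) \<in> L" using diff_swap[of "(r, u)" "(s, v)" x y] by simp
      then show False using n' xy down_closed by blast
    qed
    moreover have "(r, u) + (s, v) \<notin> down L (b * c)"
    proof
      assume "(r, u) + (s, v) \<in> down L (b * c)"
      then obtain x y where xy: "(r, u) + (s, v) = x + y" "(s, v) - y \<in> L" "x \<in> down L b"
        by (auto simp: down_mult[OF L(1)] n(2) down_monomial)
      then have "x - (r, u) \<in> L" using diff_swap[of "(s, v)" "(r, u)" y x] by (simp add: add.commute)
      then show False using m' xy down_closed by blast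
    qed
    ultimately show ?thesis
      by (auto simp: twisted_prod_def cone_congruence_def down_add[OF L(1)])
  qed
  have swap1: "twisted_prod (a, b) (c, d) \<in> cone_congruence L \<longleftrightarrow> twisted_prod (b, a) (c, d) \<in> cone_congruence L" for a b c d
    by (auto simp: twisted_prod_def cone_congruence_def add.commute)
  have swap2: "twisted_prod (a, b) (c, d) \<in> cone_congruence L \<longleftrightarrow> twisted_prod (a, b) (d, c) \<in> cone_congruence L" for a b c d
    by (auto simp: twisted_prod_def cone_congruence_def add.commute)
  have "twisted_prod (a, b) (c, d) \<notin> cone_congruence L" if "(a, b) \<notin> cone_congruence L" "(c, d) \<notin> cone_congruence L" for a b c d
  proof -
    from that have "\<not> down L a \<subseteq> down L b \<or> \<not> down L b \<subseteq> down L a"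
      and "\<not> down L c \<subseteq> down L d \<or> \<not> down L d \<subseteq> down L c"
      by (auto simp: cone_congruence_def)
    then show ?thesis using main swap1 swap2 by meson
  qed
  then show ?thesis
    using proper congruence_cone_congruence[OF L(1)] unfolding prime_congruence_def by (metis ComplD ComplI surj_pair)
qed

lemma L_set_mono: "P \<subseteq> Q \<Longrightarrow> L_set P \<subseteq> L_set Q"
  by (auto simp: L_set_def)

lemma prime_subset_iff:
  assumes "prime_congruence P" "prime_congruence Q"
  shows "P \<subseteq> Q \<longleftrightarrow> L_set P \<subseteq> L_set Q"
  using L_set_mono cone_congruence_subset[of Q "L_set P"] prime_eq_cone_congruence[OF assms(1)] assms cone_L_set
  by (metis prime_congruence_def)

lemma cone_congruence_UNIV: "cone_congruence UNIV = (maximum_congruence :: ('a::ab_group_add laurent \<times> _) set)"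
proof -
  have "down UNIV f = (if f = 0 then {} else UNIV)" for f :: "'a laurent"
    using monomials_eq_empty[of f] by (auto simp: down_def)
  then show ?thesis
    unfolding cone_congruence_def maximum_congruence_def to_boolean_def
    by (intro Collect_cong) (simp split: prod.split if_split)
qed

section \<open>Finite generation\<close>

text \<open>
  If the cone is generated by constants and finitely many \<open>m\<close>, the congruence generated by
  the relations \<open>m + 1 = m\<close> has the whole cone in its \<open>L_set\<close> and hence contains \<open>P\<close>. Conversely,
  take the finitely many differences of monomials from the generating relations of \<open>P\<close> that lie
  in the cone, and let \<open>N\<close> be what they and the constants generate. These differences
  already verify the relations modulo \<open>cone_congruence N\<close>, so \<open>P\<close> is contained in it, and the
  cone of \<open>P\<close> is contained in \<open>N\<close>.
\<close>

theorem fin_gen_iff: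
  assumes P: "prime_congruence P"
  shows "fin_gen_congruence P \<longleftrightarrow>
    (\<exists>F. finite F \<and> L_set P = submonoid hull (F \<union> {0..} \<times> {0}))"
proof
  have C: "congruence P" using P by (simp add: prime_congruence_def)
  let ?L = "L_set P"
  note L = cone_L_set[OF C]
  {
    assume "fin_gen_congruence P"
    then obtain E where E: "finite E" "P = congruence hull E"
      by (auto simp: fin_gen_congruence_def)
    define T where "T = (\<Union>(f, g)\<in>E. monomials f \<union> monomials g)"
    define F where "F = ?L \<inter> (\<lambda>(s, t). s - t) ` (T \<times> T)"
    let ?N = "submonoid hull (F \<union> {0..} \<times> {0})"
    have "finite T"
      using E finite_monomials by (auto simp: T_def)
    then have F: "finite F" by (auto simp: F_def)
    have N: "cone ?N"
      by (simp add: cone_def submonoid_hull) (meson hull_subset le_sup_iff)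
    have FN: "F \<subseteq> ?N" using hull_subset by fastforce
    have le: "down ?N f \<subseteq> down ?N g"
      if "monomials f \<subseteq> T" "monomials g \<subseteq> T" "down ?L f = down ?L g" for f g
    proof
      fix x assume "x \<in> down ?N f"
      then obtain s where s: "s \<in> monomials f" "s - x \<in> ?N" by (auto simp: down_def)
      then have "s \<in> down ?L g" using in_down_self[OF L] that(3) by blast
      then obtain t where t: "t \<in> monomials g" "t - s \<in> ?L" by (auto simp: down_def)
      then have "t - s \<in> ?N" using that s FN by (force simp: F_def)
      then have "(t - s) + (s - x) \<in> ?N" using s cone_add[OF N] by blast
      then show "x \<in> down ?N g" using t by (auto simp: down_def)
    qed
    have "E \<subseteq> cone_congruence ?N"
    proof (clarify)
      fix f g assume fg: "(f, g) \<in> E"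
      then have "(f, g) \<in> P" unfolding E(2) by (rule hull_inc)
      then have "(f, g) \<in> cone_congruence ?L" using prime_eq_cone_congruence[OF P] by simp
      moreover have "monomials f \<subseteq> T" "monomials g \<subseteq> T" using fg by (auto simp: T_def)
      ultimately show "(f, g) \<in> cone_congruence ?N"
        using le[of f g] le[of g f] by (auto simp: cone_congruence_def)
    qed
    then have "P \<subseteq> cone_congruence ?N"
      unfolding E(2) using congruence_cone_congruence[OF N] by (rule hull_minimal)
    then have "?L \<subseteq> ?N" using L_set_mono L_set_cone_congruence[OF N] by blast
    moreover have "?N \<subseteq> ?L"
      using L by (intro hull_minimal) (auto simp: F_def cone_def)
    ultimately show "\<exists>F. finite F \<and> ?L = submonoid hull (F \<union> {0..} \<times> {0})"
      using F by blast
  }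
  {
    assume "\<exists>F. finite F \<and> ?L = submonoid hull (F \<union> {0..} \<times> {0})"
    then obtain F where F: "finite F" "?L = submonoid hull (F \<union> {0..} \<times> {0})" by blast
    let ?E = "(\<lambda>(r, u). (monomial r u + 1, monomial r u)) ` F"
    let ?C = "congruence hull ?E"
    have CC: "congruence ?C" by (rule congruence_hull)
    have "F \<subseteq> L_set ?C"
    proof (clarify)
      fix r u assume "(r, u) \<in> F"
      then have "(monomial r u + 1, monomial r u) \<in> ?E" by force
      then have "(monomial r u + 1, monomial r u) \<in> ?C" by (rule hull_inc)
      then show "(r, u) \<in> L_set ?C" by (simp add: L_set_def)
    qed
    then have "?L \<subseteq> L_set ?C"
      unfolding F(2) using cone_L_set[OF CC] by (intro hull_minimal) (auto simp: cone_def)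
    then have "P \<subseteq> ?C"
      using cone_congruence_subset[OF CC L] prime_eq_cone_congruence[OF P] by simp
    moreover have "?E \<subseteq> P"
    proof (clarify)
      fix r u assume "(r, u) \<in> F"
      then have "(r, u) \<in> ?L" unfolding F(2) by (intro hull_inc) simp
      then show "(monomial r u + 1, monomial r u) \<in> P" by (simp add: L_set_def)
    qed
    then have "?C \<subseteq> P" using C by (rule hull_minimal)
    ultimately have "P = ?C" by blast
    moreover have "finite ?E" using F by blast
    ultimately show "fin_gen_congruence P" unfolding fin_gen_congruence_def by blast
  }
qed

section \<open>Integer multiples\<close>

lemma int_multiple_diff:
  "int_multiple (int a - int b) u = (\<Sum>i<a. u) - (\<Sum>i<b. u)"
proof -
  have add: "(\<Sum>i<a + b. u) = (\<Sum>i<a. u) + (\<Sum>i<b. u)" for a b :: nat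
    by (induction b) (auto simp: add.assoc)
  show ?thesis
  proof (cases "b \<le> a")
    case True
    then show ?thesis
      using add[of "a - b" b] by (simp add: int_multiple_def nat_diff_distrib')
  next
    case False
    then show ?thesis
      using add[of "b - a" a] by (simp add: int_multiple_def nat_diff_distrib')
  qed
qed

interpretation int_mod: module int_multiple
proof -
  have left: "int_multiple (a + b) x = int_multiple a x + int_multiple b x" for a b and x :: 'a
  proof -
    obtain a1 a2 b1 b2 where ab: "a = int a1 - int a2" "b = int b1 - int b2"
      by (metis int_diff_cases)
    have add: "(\<Sum>i<a + b. x) = (\<Sum>i<a. x) + (\<Sum>i<b. x)" for a b :: nat
      by (induction b) (auto simp: add.assoc)
    have "a + b = int (a1 + b1) - int (a2 + b2)" using ab by simp
    then show ?thesis
      unfolding ab(1,2) int_multiple_diff \<open>a + b = _\<close> by (simp only: int_multiple_diff add) simp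
  qed
  show "module (int_multiple :: int \<Rightarrow> 'a \<Rightarrow> 'a)"
  proof
    fix a b :: int and x y :: 'a
    show "int_multiple a (x + y) = int_multiple a x + int_multiple a y"
      by (simp add: int_multiple_def sum.distrib)
    show "int_multiple (a + b) x = int_multiple a x + int_multiple b x"
      by (rule left)
    show "int_multiple 1 x = x"
      by (simp add: int_multiple_def)
    have nat: "int_multiple (int k) (int_multiple b x) = int_multiple (int k * b) x" for k
    proof (induction k)
      case 0
      show ?case by (simp add: int_multiple_def)
    next
      case (Suc k)
      have "int_multiple (int (Suc k)) (int_multiple b x) =
          int_multiple (int k * b) x + int_multiple b x"
        using Suc left[of "int k" 1 "int_multiple b x"]
        by (simp add: int_multiple_def[of 1] add.commute)
      then show ?case by (simp add: left[symmetric] algebra_simps)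
    qed
    have neg: "int_multiple (- a) y = - int_multiple a y" for a and y :: 'a
      by (simp add: int_multiple_def)
    show "int_multiple a (int_multiple b x) = int_multiple (a * b) x"
    proof (cases "a \<ge> 0")
      case True
      then show ?thesis using nat[of "nat a"] by simp
    next
      case False
      then show ?thesis using nat[of "nat (- a)"] neg by simp
    qed
  qed
qed

lemma additive_int_multiple:
  assumes "Modules.additive h"
  shows "h (int_multiple k x) = int_multiple k (h x)"
proof -
  interpret Modules.additive h by (rule assms)
  show ?thesis by (simp add: int_multiple_def diff sum)
qed

lemma int_multiple_real_vector: "int_multiple k (x :: 'v::real_vector) = of_int k *\<^sub>R x"
proof -
  have "(\<Sum>i<k. x) = real k *\<^sub>R x" for k :: nat
    by (simp add: sum_constant_scaleR)
  then show ?thesis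
    by (cases "k \<ge> 0") (auto simp: int_multiple_def)
qed

lemma int_multiple_pair:
  "int_multiple k (r :: real, u :: 'm::ab_group_add) = (of_int k * r, int_multiple k u)"
proof (rule prod_eqI)
  have "Modules.additive (fst :: real \<times> 'm \<Rightarrow> real)" "Modules.additive (snd :: real \<times> 'm \<Rightarrow> 'm)"
    by unfold_locales auto
  from this[THEN additive_int_multiple, of k "(r, u)"]
  show "fst (int_multiple k (r, u)) = fst (of_int k * r, int_multiple k u)"
    "snd (int_multiple k (r, u)) = snd (of_int k * r, int_multiple k u)"
    by (auto simp: int_multiple_real_vector)
qed

lemma additive_real_int_multiple:
  "Modules.additive h \<Longrightarrow> h (int_multiple k x) = of_int k * (h x :: real)"
  by (simp add: additive_int_multiple int_multiple_real_vector)

section \<open>Archimedean cones\<close>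

text \<open>
  The preorder with positive cone \<open>L\<close> is Archimedean in the usual sense: every element is bounded by
  a multiple of any given strictly positive one. Negative multiples may
  be allowed, because they lie below the nonnegative ones.
\<close>

definition archimedean :: "'g::ab_group_add set \<Rightarrow> bool" where
  "archimedean L \<longleftrightarrow> (\<forall>y x. y \<in> L \<longrightarrow> - y \<notin> L \<longrightarrow> (\<exists>k. int_multiple k y - x \<in> L))"

lemma submonoid_int_multiple:
  assumes "submonoid L" "x \<in> L" "k \<ge> 0"
  shows "int_multiple k x \<in> L"
proof -
  have "(\<Sum>i<m. x) \<in> L" for m :: nat
    by (induction m) (use assms submonoid_zero submonoid_add in auto)
  then show ?thesis using assms(3) by (simp add: int_multiple_def)
qed

lemma int_multiple_in_iff:
  assumes "submonoid L" "e \<in> L" "- e \<notin> L"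
  shows "int_multiple q e \<in> L \<longleftrightarrow> q \<ge> 0"
proof
  assume q: "int_multiple q e \<in> L"
  show "q \<ge> 0"
  proof (rule ccontr)
    assume "\<not> q \<ge> 0"
    then have "int_multiple (- q - 1) e \<in> L"
      using assms by (intro submonoid_int_multiple) auto
    then have "int_multiple q e + int_multiple (- q - 1) e \<in> L"
      using q submonoid_add[OF assms(1)] by blast
    then have "int_multiple (q + (- q - 1)) e \<in> L"
      by (simp only: int_mod.scale_left_distrib)
    then show False using assms(3) by simp
  qed
qed (use assms submonoid_int_multiple in auto)

lemma real_eq_0_if_multiples_bounded:
  fixes a b :: real
  assumes "\<And>q::int. q > 0 \<Longrightarrow> of_int q * \<bar>a\<bar> \<le> b"
  shows "a = 0"
proof (rule ccontr)
  assume "a \<noteq> 0"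
  then obtain m :: nat where m: "b < real m * \<bar>a\<bar>"
    using reals_Archimedean3[of "\<bar>a\<bar>"] by auto
  have "of_int (int m + 1) * \<bar>a\<bar> \<le> b" by (rule assms) simp
  then show False using m by (simp add: algebra_simps)
qed

text \<open>
  Hoelder's theorem. For a fixed strictly positive \<open>e\<close>, the value \<open>\<phi> x\<close> is the supremum of
  the fractions \<open>p / q\<close> with \<open>p e \<le> q x\<close>. Measuring \<open>q x\<close> in whole multiples of \<open>e\<close> determines \<open>\<phi> x\<close>
  up to \<open>1 / q\<close>, which gives additivity in the limit.
\<close>

theorem hoelder_embedding:
  fixes L :: "'g::ab_group_add set"
  assumes L: "submonoid L" "is_total L" "archimedean L" "L \<noteq> UNIV"
  obtains \<phi> :: "'g \<Rightarrow> real" where "Modules.additive \<phi>" "L = {x. \<phi> x \<ge> 0}"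
proof -
  obtain e where e: "e \<in> L" "- e \<notin> L"
    using L(2,4) unfolding is_total_def by (metis UNIV_eq_I minus_minus)
  note pos = int_multiple_in_iff[OF L(1) e]
  note add = submonoid_add[OF L(1)]
  have "\<exists>p. x - int_multiple p e \<in> L \<and> int_multiple (p + 1) e - x \<in> L" for x
  proof -
    obtain k where k: "int_multiple k e - x \<in> L"
      using L(3) e unfolding archimedean_def by blast
    obtain m where m: "int_multiple m e - (- x) \<in> L"
      using L(3) e unfolding archimedean_def by blast
    define S where "S = {p. p \<ge> - m \<and> x - int_multiple p e \<in> L}"
    have "p \<le> k" if "p \<in> S" for p
      using add[OF k, of "x - int_multiple p e"] that pos[of "k - p"]
      by (simp add: S_def int_mod.scale_left_diff_distrib)
    then have "S \<subseteq> {- m..k}" by (auto simp: S_def)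
    then have fin: "finite S" by (rule finite_subset) simp
    have mS: "- m \<in> S" using m by (simp add: S_def add.commute)
    have max: "Max S \<in> S" using fin mS by (intro Max_in) auto
    have "Max S + 1 \<notin> S" using Max_ge[OF fin, of "Max S + 1"] by linarith
    then have "x - int_multiple (Max S + 1) e \<notin> L" using max by (auto simp: S_def)
    then have "int_multiple (Max S + 1) e - x \<in> L"
      using L(2) unfolding is_total_def by (metis minus_diff_eq)
    then show ?thesis using max by (auto simp: S_def)
  qed
  then obtain fl where fl: "\<And>x. x - int_multiple (fl x) e \<in> L"
      "\<And>x. int_multiple (fl x + 1) e - x \<in> L"
    by metis
  \<comment> \<open>the Dedekind cut of the ratio of \<open>x\<close> to \<open>e\<close>\<close>
  define A where "A x = {of_int p / of_int q :: real | p q. q > 0 \<and> int_multiple q x - int_multiple p e \<in> L}"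
    for x
  define \<phi> where "\<phi> x = (Sup (A x) :: real)" for x
  have upper: "a \<le> of_int p / of_int q"
    if ax: "a \<in> A x" and "q > 0" "int_multiple p e - int_multiple q x \<in> L" for a x p q
  proof -
    obtain p' q' where a: "a = of_int p' / of_int q'" "q' > 0" "int_multiple q' x - int_multiple p' e \<in> L"
      using ax by (auto simp: A_def)
    have "int_multiple q (int_multiple q' x - int_multiple p' e) +
        int_multiple q' (int_multiple p e - int_multiple q x) \<in> L"
      using that a by (intro add submonoid_int_multiple L(1)) auto
    also have "int_multiple q (int_multiple q' x - int_multiple p' e) +
        int_multiple q' (int_multiple p e - int_multiple q x) = int_multiple (q' * p - q * p') e"
      by (simp add: int_mod.scale_right_diff_distrib int_mod.scale_left_diff_distrib mult.commute)
    finally have "q * p' \<le> q' * p" using pos by simp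
    then have "real_of_int q * of_int p' \<le> of_int q' * of_int p"
      by (metis of_int_le_iff of_int_mult)
    then show ?thesis using a(2) that(2) unfolding a(1) by (simp add: divide_simps mult.commute)
  qed
  have A: "of_int (fl x) \<in> A x" for x
  proof -
    have "of_int (fl x) = (of_int (fl x) :: real) / of_int 1" "int_multiple 1 x - int_multiple (fl x) e \<in> L"
      using fl by auto
    then show ?thesis unfolding A_def by (metis (mono_tags, lifting) mem_Collect_eq zero_less_one)
  qed
  have bdd: "bdd_above (A x)" for x
    using upper[of _ x 1 "fl x + 1"] fl(2)[of x] by (intro bdd_aboveI) auto
  have lo: "of_int p \<le> of_int q * \<phi> x" if "q > 0" "int_multiple q x - int_multiple p e \<in> L" for p q x
  proof -
    have "of_int p / of_int q \<in> A x" using that by (auto simp: A_def)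
    then have "of_int p / of_int q \<le> \<phi> x" unfolding \<phi>_def by (rule cSup_upper[OF _ bdd])
    then show ?thesis using that by (simp add: field_simps)
  qed
  have hi: "of_int q * \<phi> x \<le> of_int p" if "q > 0" "int_multiple p e - int_multiple q x \<in> L" for p q x
  proof -
    have "\<phi> x \<le> of_int p / of_int q"
      unfolding \<phi>_def using A upper that by (intro cSup_least) blast+
    then show ?thesis using that by (simp add: field_simps)
  qed
  have "Modules.additive \<phi>"
  proof
    fix x y
    have "of_int q * \<bar>\<phi> (x + y) - (\<phi> x + \<phi> y)\<bar> \<le> 2" if "q > 0" for q :: int
    proof -
      let ?p = "fl (int_multiple q x)" and ?p' = "fl (int_multiple q y)"
      have "int_multiple q (x + y) - int_multiple (?p + ?p') e \<in> L"
        using add[OF fl(1)[of "int_multiple q x"] fl(1)[of "int_multiple q y"]]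
        by (simp add: int_mod.scale_left_distrib int_mod.scale_right_distrib algebra_simps)
      moreover have "int_multiple (?p + 1 + (?p' + 1)) e - int_multiple q (x + y) \<in> L"
        using add[OF fl(2)[of "int_multiple q x"] fl(2)[of "int_multiple q y"]]
        unfolding int_mod.scale_left_distrib int_mod.scale_right_distrib by (simp add: algebra_simps)
      ultimately have "of_int (?p + ?p') \<le> of_int q * \<phi> (x + y)"
        "of_int q * \<phi> (x + y) \<le> of_int (?p + 1 + (?p' + 1))"
        using lo hi that by blast+
      moreover have "of_int ?p \<le> of_int q * \<phi> x" "of_int q * \<phi> x \<le> of_int (?p + 1)"
        "of_int ?p' \<le> of_int q * \<phi> y" "of_int q * \<phi> y \<le> of_int (?p' + 1)"
        using lo hi that fl by blast+
      ultimately have "\<bar>of_int q * \<phi> (x + y) - (of_int q * \<phi> x + of_int q * \<phi> y)\<bar> \<le> 2"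
        by simp
      moreover have "of_int q * \<phi> (x + y) - (of_int q * \<phi> x + of_int q * \<phi> y)
          = of_int q * (\<phi> (x + y) - (\<phi> x + \<phi> y))"
        by (simp add: algebra_simps)
      ultimately show ?thesis using that by (simp add: abs_mult)
    qed
    from real_eq_0_if_multiples_bounded[OF this] show "\<phi> (x + y) = \<phi> x + \<phi> y" by simp
  qed
  moreover have "L = {x. \<phi> x \<ge> 0}"
  proof (intro equalityI subsetI)
    fix x assume "x \<in> L"
    then show "x \<in> {x. \<phi> x \<ge> 0}" using lo[of 1 x 0] by simp
  next
    fix x assume x: "x \<in> {x. \<phi> x \<ge> 0}"
    show "x \<in> L"
    proof (rule ccontr)
      assume n: "x \<notin> L"
      then have m: "- x \<in> L" using L(2) by (auto simp: is_total_def)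
      then obtain k where k: "int_multiple k (- x) - e \<in> L"
        using L(3) n unfolding archimedean_def by (metis minus_minus)
      have "k > 0"
      proof (rule ccontr)
        assume "\<not> k > 0"
        then have "int_multiple (- k) (- x) \<in> L"
          using m by (intro submonoid_int_multiple L(1)) auto
        from add[OF k this] show False using e by simp
      qed
      moreover have "int_multiple (- 1) e - int_multiple k x \<in> L" using k
        unfolding int_mod.scale_minus_left int_mod.scale_one int_mod.scale_minus_right
        by (metis add.commute uminus_add_conv_diff add_uminus_conv_diff)
      ultimately have "of_int k * \<phi> x \<le> - 1" using hi[of k "-1" x] by simp
      moreover have "of_int k * \<phi> x \<ge> 0" using x \<open>k > 0\<close> by simp
      ultimately show False by linarith
    qed
  qed
  ultimately show thesis by (rule that; assumption)
qed

text \<open>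
  On integers an additive function is linear, and monotonicity bounds its value on a
  fractional part. Hence the error at \<open>q r\<close> is bounded independently of \<open>q\<close>.
\<close>

lemma additive_monotone_linear:
  fixes g :: "real \<Rightarrow> real"
  assumes "Modules.additive g" and nonneg: "\<And>r. r \<ge> 0 \<Longrightarrow> g r \<ge> 0"
  shows "g r = g 1 * r"
proof -
  interpret Modules.additive g by (rule assms)
  have "of_int q * \<bar>g r - g 1 * r\<bar> \<le> g 1" if "q > 0" for q :: int
  proof -
    let ?p = "\<lfloor>of_int q * r\<rfloor>" and ?t = "frac (of_int q * r)"
    have t: "0 \<le> ?t" "?t \<le> 1" using frac_lt_1[of "of_int q * r"] by (auto simp: less_imp_le)
    have gt: "0 \<le> g ?t" "g ?t \<le> g 1"
      using nonneg[of ?t] nonneg[of "1 - ?t"] t by (auto simp: diff)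
    have m: "g (of_int k * x) = of_int k * g x" for k x
      using additive_real_int_multiple[OF assms(1), of k x] by (simp add: int_multiple_real_vector)
    have "of_int q * g r = g (of_int ?p * 1 + ?t)"
      by (simp add: m[symmetric] frac_def)
    also have "\<dots> = of_int ?p * g 1 + g ?t" by (simp only: add m)
    finally have 1: "of_int q * g r = of_int ?p * g 1 + g ?t" .
    have 2: "of_int q * (g 1 * r) = of_int ?p * g 1 + ?t * g 1"
      by (simp add: frac_def algebra_simps)
    have "0 \<le> ?t * g 1" "?t * g 1 \<le> g 1"
      using t nonneg[of 1] by (auto simp: mult_left_le_one_le)
    then have "\<bar>of_int q * (g r - g 1 * r)\<bar> \<le> g 1"
      using gt 1 2 unfolding right_diff_distrib by linarith
    then show ?thesis using that by (simp add: abs_mult)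
  qed
  from real_eq_0_if_multiples_bounded[OF this] show ?thesis by simp
qed

lemma additive_on_product:
  fixes \<phi> :: "real \<times> 'm::ab_group_add \<Rightarrow> real"
  assumes "Modules.additive \<phi>" and nonneg: "\<And>r. r \<ge> 0 \<Longrightarrow> \<phi> (r, 0) \<ge> 0"
  obtains c \<psi> where "c \<ge> 0" "Modules.additive \<psi>" "\<And>r u. \<phi> (r, u) = c * r + \<psi> u"
proof
  interpret Modules.additive \<phi> by (rule assms)
  show "\<phi> (1, 0) \<ge> 0" by (rule nonneg) simp
  show "Modules.additive (\<lambda>u. \<phi> (0, u))"
    by unfold_locales (simp flip: add)
  have "Modules.additive (\<lambda>r. \<phi> (r, 0))"
    by unfold_locales (simp flip: add)
  then have "\<phi> (r, 0) = \<phi> (1, 0) * r" for r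
    using additive_monotone_linear[of "\<lambda>r. \<phi> (r, 0)" r] nonneg by blast
  then have "\<phi> (r, 0) + \<phi> (0, u) = \<phi> (1, 0) * r + \<phi> (0, u)" for r u
    by (rule arg_cong)
  moreover have "\<phi> (r, u) = \<phi> (r, 0) + \<phi> (0, u)" for r u
    using add[of "(r, 0)" "(0, u)"] by simp
  ultimately show "\<phi> (r, u) = \<phi> (1, 0) * r + \<phi> (0, u)" for r u
    by (rule trans[rotated])
qed

section \<open>Finitely generated total cones\<close>

text \<open>
  Let \<open>y\<close> be strictly positive and let \<open>B\<close> be the set of elements bounded by multiples of \<open>y\<close>. If
  \<open>B\<close> is not everything, take a least generator \<open>f\<close> outside \<open>B\<close>. Provided that all constants
  outside \<open>B\<close> are above \<open>f\<close> as well, every positive element outside \<open>B\<close> is at least \<open>f\<close>, which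
  fails for \<open>f - y\<close>. Otherwise there is a constant \<open>\<epsilon>\<close> outside \<open>B\<close> below all generators outside
  \<open>B\<close>. Then an element of the cone is either at least \<open>\<epsilon>\<close> or the sum of a nonnegative constant
  and a nonnegative element of \<open>B\<close>, which fails for \<open>\<epsilon> / 2 - y\<close>.
\<close>

lemma fin_gen_archimedean:
  fixes L :: "(real \<times> 'm::ab_group_add) set"
  assumes L: "cone L" "is_total L" and F: "finite F" "L = submonoid hull (F \<union> {0..} \<times> {0})"
  shows "archimedean L"
proof (rule ccontr)
  assume "\<not> archimedean L"
  then obtain y x where y: "y \<in> L" "- y \<notin> L" and x: "\<And>k. int_multiple k y - x \<notin> L"
    unfolding archimedean_def by blast
  note add = cone_add[OF L(1)]
  have sub: "submonoid L" using L by (simp add: cone_def)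
  have tot: "a - b \<in> L" if "b - a \<notin> L" for a b
    using L(2) that unfolding is_total_def by (metis minus_diff_eq)
  have hull: "L \<subseteq> N" if "F \<subseteq> N" "{0..} \<times> {0} \<subseteq> N" "submonoid N" for N
    unfolding F(2) using that by (intro hull_minimal) auto
  have FL: "F \<subseteq> L" using hull_subset unfolding F(2) by fastforce
  define B where "B = {z. \<exists>k. int_multiple k y - z \<in> L}"
  have B0: "0 \<in> B"
    using cone_zero[OF L(1)] by (auto simp: B_def intro!: exI[of _ 0])
  have Badd: "a + b \<in> B" if ab: "a \<in> B" "b \<in> B" for a b
  proof -
    obtain k m where "int_multiple k y - a \<in> L" "int_multiple m y - b \<in> L"
      using ab by (auto simp: B_def)
    then have "int_multiple (k + m) y - (a + b) \<in> L"
      using add by (fastforce simp: int_mod.scale_left_distrib algebra_simps)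
    then show ?thesis by (auto simp: B_def)
  qed
  have Bdown: "b \<in> B" if ab: "a \<in> B" "a - b \<in> L" for a b
  proof -
    obtain k where "int_multiple k y - a \<in> L" using ab by (auto simp: B_def)
    from add[OF this ab(2)] show ?thesis by (auto simp: B_def)
  qed
  have By: "y \<in> B"
    using cone_zero[OF L(1)] by (auto simp: B_def intro!: exI[of _ 1])
  have xB: "x \<notin> B" using x by (simp add: B_def)
  have "- x \<notin> L" using x[of 0] by simp
  then have xL: "x \<in> L" using L(2) unfolding is_total_def by blast
  have big: "a - b \<in> L" if "a \<notin> B" "b \<in> B" for a b
    using Bdown[OF that(2), of a] that(1) tot by blast
  let ?G = "F - B"
  have finG: "finite ?G" using F by simp
  show False
  proof (cases "\<exists>f\<in>?G. (\<forall>g\<in>?G. g - f \<in> L) \<and> (\<forall>r\<ge>0. (r, 0) \<in> B \<or> (r, 0) - f \<in> L)")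
    case True
    then obtain f where f: "f \<in> ?G" "\<And>g. g \<in> ?G \<Longrightarrow> g - f \<in> L"
      "\<And>r. r \<ge> 0 \<Longrightarrow> (r, 0) \<in> B \<or> (r, 0) - f \<in> L"
      by blast
    let ?N = "{z \<in> L. z \<in> B \<or> z - f \<in> L}"
    have "submonoid ?N"
      unfolding submonoid_def
    proof (intro conjI ballI)
      show "0 \<in> ?N" using B0 cone_zero[OF L(1)] by simp
      fix a b assume a: "a \<in> ?N" and b: "b \<in> ?N"
      consider "a \<in> B" "b \<in> B" | "a - f \<in> L" | "b - f \<in> L" using a b by blast
      then have "a + b \<in> B \<or> a + b - f \<in> L"
      proof cases
        case 1
        then show ?thesis using Badd by blast
      next
        case 2
        then show ?thesis using add[OF 2, of b] b by (simp add: algebra_simps)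
      next
        case 3
        then show ?thesis using add[OF 3, of a] a by (simp add: algebra_simps)
      qed
      then show "a + b \<in> ?N" using add a b by simp
    qed
    moreover have "F \<subseteq> ?N" using FL f(2) by auto
    moreover have "{0..} \<times> {0} \<subseteq> ?N" using f(3) cone_const[OF L(1)] by auto
    ultimately have "L \<subseteq> ?N" by (intro hull)
    moreover have "f - y \<in> L" using big f By by blast
    ultimately consider "f - y \<in> B" | "f - y - f \<in> L" by blast
    then show False
    proof cases
      case 1
      then have "f \<in> B" using Badd[OF 1 By] by simp
      then show False using f by blast
    qed (use y in simp)
  next
    case False
    have "\<exists>\<epsilon>>0. (\<epsilon>, 0) \<notin> B \<and> (\<forall>f\<in>?G. f - (\<epsilon>, 0) \<in> L)"
    proof (cases "?G = {}")
      case True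
      have "\<not> {0..} \<times> {0} \<subseteq> B"
      proof
        assume "{0..} \<times> {0} \<subseteq> B"
        moreover have "submonoid B" using B0 Badd by (simp add: submonoid_def)
        ultimately have "L \<subseteq> B" using True by (intro hull) auto
        then show False using xB xL by blast
      qed
      then obtain r where r: "r \<ge> 0" "(r, 0) \<notin> B" by auto
      then have "r \<noteq> 0" using B0 by (auto simp: zero_prod_def)
      then show ?thesis using r True by (intro exI[of _ r]) auto
    next
      case ne: False
      then obtain f where f: "f \<in> ?G" "\<And>g. g \<in> ?G \<Longrightarrow> g - f \<in> L"
        using total_minimum[OF sub L(2) finG] by blast
      then obtain r where r: "r \<ge> 0" "(r, 0) \<notin> B" "(r, 0) - f \<notin> L"
        using False by blast
      have "r \<noteq> 0" using B0 r by (auto simp: zero_prod_def)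
      moreover have "g - (r, 0) \<in> L" if "g \<in> ?G" for g
        using add[OF f(2)[OF that] tot[OF r(3)]] by (metis add_diff_eq diff_add_cancel)
      ultimately show ?thesis using r by (intro exI[of _ r]) auto
    qed
    then obtain \<epsilon> where \<epsilon>: "\<epsilon> > 0" "(\<epsilon>, 0) \<notin> B" "\<And>f. f \<in> ?G \<Longrightarrow> f - (\<epsilon>, 0) \<in> L"
      by blast
    let ?N = "{z \<in> L. (\<exists>r\<ge>0. z - (r, 0) \<in> L \<inter> B) \<or> z - (\<epsilon>, 0) \<in> L}"
    have B_zero: "0 \<in> L \<inter> B" using B0 cone_zero[OF L(1)] by blast
    have "submonoid ?N"
      unfolding submonoid_def
    proof (intro conjI ballI)
      show "0 \<in> ?N" using B_zero by (auto simp flip: zero_prod_def intro!: exI[of _ 0])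
      fix a b assume a: "a \<in> ?N" and b: "b \<in> ?N"
      consider r s where "r \<ge> 0" "s \<ge> 0" "a - (r, 0) \<in> L \<inter> B" "b - (s, 0) \<in> L \<inter> B"
        | "a - (\<epsilon>, 0) \<in> L" | "b - (\<epsilon>, 0) \<in> L"
        using a b by blast
      then have "(\<exists>r\<ge>0. a + b - (r, 0) \<in> L \<inter> B) \<or> a + b - (\<epsilon>, 0) \<in> L"
      proof cases
        case 1
        have "a + b - (r + s, 0) = (a - (r, 0)) + (b - (s, 0))"
          by (cases a; cases b) simp
        then have "a + b - (r + s, 0) \<in> L \<inter> B"
          using 1 add[of "a - (r, 0)" "b - (s, 0)"] Badd[of "a - (r, 0)" "b - (s, 0)"] by (metis IntD1 IntD2 IntI)
        then show ?thesis using 1 by (meson add_nonneg_nonneg)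
      next
        case 2
        then show ?thesis using add[OF 2, of b] b by (simp add: algebra_simps)
      next
        case 3
        then show ?thesis using add[OF 3, of a] a by (simp add: algebra_simps)
      qed
      then show "a + b \<in> ?N" using add a b by simp
    qed
    moreover have "F \<subseteq> ?N"
    proof
      fix f assume f: "f \<in> F"
      then show "f \<in> ?N"
        using FL \<epsilon>(3)[of f] by (cases "f \<in> B") (auto simp flip: zero_prod_def intro!: exI[of _ 0])
    qed
    moreover have "{0..} \<times> {0} \<subseteq> ?N"
      using cone_const[OF L(1)] B_zero by (auto simp: zero_prod_def)
    ultimately have N: "L \<subseteq> ?N" by (intro hull)
    have half: "(\<epsilon> / 2, 0) \<notin> B"
    proof
      assume "(\<epsilon> / 2, 0) \<in> B"
      from Badd[OF this this] show False using \<epsilon> by simp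
    qed
    have "(\<epsilon> / 2, 0) - y \<in> L" using big[OF half By] .
    then consider r where "r \<ge> 0" "(\<epsilon> / 2, 0) - y - (r, 0) \<in> L \<inter> B"
      | "(\<epsilon> / 2, 0) - y - (\<epsilon>, 0) \<in> L"
      using N by blast
    then show False
    proof cases
      case 1
      have "(\<epsilon> / 2 - r, 0) \<in> B"
        using Badd[of "(\<epsilon> / 2, 0) - y - (r, 0)" y] 1 By by (cases y) simp
      moreover have "(\<epsilon> / 2 - r, 0) \<notin> B" if pos: "\<epsilon> / 2 - r > 0"
      proof
        assume b: "(\<epsilon> / 2 - r, 0) \<in> B"
        obtain m :: nat where m: "\<epsilon> \<le> real m * (\<epsilon> / 2 - r)"
          using reals_Archimedean3[OF pos] by (meson less_imp_le)
        have "int_multiple (int m) (\<epsilon> / 2 - r, 0) \<in> B"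
          by (rule submonoid_int_multiple[OF _ b]) (simp_all add: submonoid_def B0 Badd)
        then have "(real m * (\<epsilon> / 2 - r), 0) \<in> B" by (simp add: int_multiple_pair)
        moreover have "(real m * (\<epsilon> / 2 - r), 0) - (\<epsilon>, 0) \<in> L"
          using m cone_const[OF L(1), of "real m * (\<epsilon> / 2 - r) - \<epsilon>"] by simp
        ultimately have "(\<epsilon>, 0) \<in> B" by (rule Bdown)
        then show False using \<epsilon> by blast
      qed
      ultimately have "r - \<epsilon> / 2 \<ge> 0" by fastforce
      from add[OF _ cone_const[OF L(1) this], of "(\<epsilon> / 2, 0) - y - (r, 0)"] 1 y
      show False by (cases y) auto
    next
      case 2
      from add[OF 2 cone_const[OF L(1), of "\<epsilon> / 2"]] \<epsilon> y
      show False by (cases y) auto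
    qed
  qed
qed

section \<open>The three kinds of cones\<close>

definition evaluation_cone :: "('m::ab_group_add \<Rightarrow> real) \<Rightarrow> (real \<times> 'm) set" where
  "evaluation_cone \<psi> = {(r, u). r + \<psi> u \<ge> 0}"

definition halfspace_cone :: "('m::ab_group_add \<Rightarrow> real) \<Rightarrow> (real \<times> 'm) set" where
  "halfspace_cone \<psi> = {(r, u). \<psi> u \<ge> 0}"

text \<open>
  These are the primitive vectors of the lattice dual to \<open>M\<close>. They are kept real valued so that
  they can be treated like all other additive functions.
\<close>

definition unimodular :: "('m::ab_group_add \<Rightarrow> real) \<Rightarrow> bool" where
  "unimodular \<psi> \<longleftrightarrow> Modules.additive \<psi> \<and> range \<psi> \<subseteq> \<int> \<and> (\<exists>e. \<psi> e = 1)"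

text \<open>
  By Hoelder's theorem a proper \<open>L\<close> is given by \<open>\<phi> \<ge> 0\<close>. Positivity on constants forces \<open>c \<ge> 0\<close> in \<open>\<phi> (r, u) = c * r + \<psi> u\<close>. A positive \<open>c\<close> can be divided out.
\<close>

lemma archimedean_cone_cases:
  fixes L :: "(real \<times> 'm::ab_group_add) set"
  assumes L: "cone L" "is_total L" "archimedean L"
  obtains "L = UNIV" | \<psi> where "Modules.additive \<psi>" "L = evaluation_cone \<psi>"
    | \<psi> u where "Modules.additive \<psi>" "\<psi> u \<noteq> 0" "L = halfspace_cone \<psi>"
proof (cases "L = UNIV")
  case False
  have sub: "submonoid L" using L(1) by (simp add: cone_def)
  obtain \<phi> :: "real \<times> 'm \<Rightarrow> real" where \<phi>: "Modules.additive \<phi>" "L = {x. \<phi> x \<ge> 0}"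
    by (rule hoelder_embedding[OF sub L(2,3) False]) (rule that; assumption)
  have nonneg: "\<phi> (r, 0) \<ge> 0" if "r \<ge> 0" for r
    using cone_const[OF L(1) that] \<phi> by simp
  obtain c \<psi> where c: "c \<ge> 0" "Modules.additive \<psi>" "\<And>r u. \<phi> (r, u) = c * r + \<psi> u"
    by (rule additive_on_product[OF \<phi>(1) nonneg]; (rule that; assumption | assumption))
  show thesis
  proof (cases "c = 0")
    case True
    then have "L = halfspace_cone \<psi>" using c \<phi> by (auto simp: halfspace_cone_def)
    moreover have "\<exists>u. \<psi> u \<noteq> 0"
      using False calculation by (force simp: halfspace_cone_def)
    ultimately show thesis using that c by blast
  next
    case False
    have "Modules.additive (\<lambda>u. \<psi> u / c)"
      using c(2) unfolding Modules.additive_def by (simp add: add_divide_distrib)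
    moreover have "L = evaluation_cone (\<lambda>u. \<psi> u / c)"
      using False c \<phi> by (auto simp: evaluation_cone_def field_simps)
    ultimately show thesis using that by blast
  qed
qed (use that in blast)

text \<open>
  An additive function with a least positive value \<open>d\<close> takes only multiples of \<open>d\<close>, by division with
  remainder.
\<close>

lemma unimodular_scaling:
  fixes \<psi> :: "'m::ab_group_add \<Rightarrow> real"
  assumes \<psi>: "Modules.additive \<psi>" and e: "\<psi> e = d" and d: "d > 0"
    and least: "\<And>v. \<psi> v \<ge> 0 \<Longrightarrow> \<psi> v = 0 \<or> \<psi> v \<ge> d"
  shows "unimodular (\<lambda>v. \<psi> v / d)"
proof -
  interpret Modules.additive \<psi> by (rule \<psi>)
  define \<theta> where "\<theta> v = \<psi> v / d" for v
  have "\<theta> v \<in> \<int>" for v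
  proof -
    let ?k = "\<lfloor>\<theta> v\<rfloor>"
    have "\<psi> (v - int_multiple ?k e) = \<psi> v - of_int ?k * d"
      by (simp add: diff additive_real_int_multiple[OF \<psi>] e)
    moreover have "0 \<le> \<psi> v - of_int ?k * d" "\<psi> v - of_int ?k * d < d"
    proof -
      have "\<psi> v = \<theta> v * d" using d by (simp add: \<theta>_def)
      moreover have "of_int ?k * d \<le> \<theta> v * d" using d by (intro mult_right_mono) auto
      moreover have "\<theta> v * d < (of_int ?k + 1) * d"
        using d by (intro mult_strict_right_mono) linarith+
      ultimately show "0 \<le> \<psi> v - of_int ?k * d" "\<psi> v - of_int ?k * d < d"
        by (auto simp: algebra_simps)
    qed
    ultimately have "\<psi> v - of_int ?k * d = 0" using least[of "v - int_multiple ?k e"] by linarith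
    then have "\<theta> v = of_int ?k" using d by (simp add: \<theta>_def field_simps)
    then show ?thesis by (metis Ints_of_int)
  qed
  moreover have "Modules.additive \<theta>"
    by unfold_locales (simp add: \<theta>_def add add_divide_distrib)
  moreover have "\<theta> e = 1" using d e by (simp add: \<theta>_def)
  ultimately have "unimodular \<theta>" by (auto simp: unimodular_def)
  then show ?thesis unfolding \<theta>_def .
qed

text \<open>
  Generators on which \<open>\<psi>\<close> vanishes contribute nothing to its values, so the least positive value
  on a generator is the least positive value overall.
\<close>

lemma unimodular_if_fin_gen:
  fixes \<psi> :: "'m::ab_group_add \<Rightarrow> real"
  assumes \<psi>: "Modules.additive \<psi>" "\<psi> u \<noteq> 0"
    and F: "finite F" "halfspace_cone \<psi> = submonoid hull (F \<union> {0..} \<times> {0})"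
  obtains \<theta> where "unimodular \<theta>" "halfspace_cone \<psi> = halfspace_cone \<theta>"
proof -
  interpret Modules.additive \<psi> by (rule \<psi>)
  let ?V = "(\<lambda>x. \<psi> (snd x)) ` {x \<in> F. \<psi> (snd x) > 0}"
  have FL: "F \<subseteq> halfspace_cone \<psi>" using hull_subset unfolding F(2) by fastforce
  have hull: "halfspace_cone \<psi> \<subseteq> N" if "F \<subseteq> N" "{0..} \<times> {0} \<subseteq> N" "submonoid N" for N
    unfolding F(2) using that by (intro hull_minimal) auto
  have fin: "finite ?V" using F by auto
  have ne: "?V \<noteq> {}"
  proof
    assume "?V = {}"
    then have "halfspace_cone \<psi> \<subseteq> {x. \<psi> (snd x) \<le> 0}"
      by (intro hull) (force simp: submonoid_def zero add)+
    then have "\<psi> v \<le> 0" if "\<psi> v \<ge> 0" for v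
      using that by (force simp: halfspace_cone_def)
    from this[of u] this[of "- u"] show False using \<psi>(2) by (force simp: minus)
  qed
  define d where "d = Min ?V"
  have "d \<in> ?V" unfolding d_def using fin ne by (rule Min_in)
  then obtain e where e: "\<psi> e = d" and d: "d > 0" by auto
  let ?N = "{x. \<psi> (snd x) = 0 \<or> \<psi> (snd x) \<ge> d}"
  have "halfspace_cone \<psi> \<subseteq> ?N"
  proof (rule hull)
    show "F \<subseteq> ?N"
    proof
      fix x assume "x \<in> F"
      then have "\<psi> (snd x) \<ge> 0" using FL by (auto simp: halfspace_cone_def)
      moreover have "\<psi> (snd x) \<ge> d" if "\<psi> (snd x) > 0"
        unfolding d_def using fin that \<open>x \<in> F\<close> by (intro Min_le) auto
      ultimately show "x \<in> ?N" by force
    qed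
    show "submonoid ?N" using d by (auto simp: submonoid_def zero add)
  qed (auto simp: zero)
  then have least: "\<psi> v = 0 \<or> \<psi> v \<ge> d" if "\<psi> v \<ge> 0" for v
    using that by (force simp: halfspace_cone_def)
  define \<theta> where "\<theta> v = \<psi> v / d" for v
  have "unimodular \<theta>"
    unfolding \<theta>_def using \<psi>(1) e d least by (rule unimodular_scaling)
  moreover have "halfspace_cone \<psi> = halfspace_cone \<theta>"
    using d by (auto simp: halfspace_cone_def \<theta>_def zero_le_divide_iff)
  ultimately show thesis by (rule that; assumption)
qed

lemma cone_evaluation:
  assumes "Modules.additive \<psi>"
  shows "cone (evaluation_cone \<psi>)" "is_total (evaluation_cone \<psi>)"
proof -
  interpret Modules.additive \<psi> by (rule assms)
  show "cone (evaluation_cone \<psi>)"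
    by (auto simp: cone_def submonoid_def evaluation_cone_def zero add zero_prod_def)
  show "is_total (evaluation_cone \<psi>)"
    by (auto simp: is_total_def evaluation_cone_def minus)
qed

lemma cone_halfspace:
  assumes "Modules.additive \<psi>"
  shows "cone (halfspace_cone \<psi>)" "is_total (halfspace_cone \<psi>)"
proof -
  interpret Modules.additive \<psi> by (rule assms)
  show "cone (halfspace_cone \<psi>)"
    by (auto simp: cone_def submonoid_def halfspace_cone_def zero add zero_prod_def)
  show "is_total (halfspace_cone \<psi>)"
    by (auto simp: is_total_def halfspace_cone_def minus)
qed

section \<open>Coordinates on a free abelian group\<close>

locale free_abelian =
  fixes n :: nat and X :: "nat \<Rightarrow> 'm::ab_group_add"
  assumes basis: "free_basis n X"
begin

definition coord :: "'m \<Rightarrow> nat \<Rightarrow> int" where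
  "coord u = (THE c. (\<forall>i. i \<notin> {1..n} \<longrightarrow> c i = 0) \<and> u = (\<Sum>i=1..n. int_multiple (c i) (X i)))"

lemma coord_expand: "u = (\<Sum>i=1..n. int_multiple (coord u i) (X i))"
  and coord_outside: "i \<notin> {1..n} \<Longrightarrow> coord u i = 0"
proof -
  have "\<exists>!c. (\<forall>i. i \<notin> {1..n} \<longrightarrow> c i = 0) \<and> u = (\<Sum>i=1..n. int_multiple (c i) (X i))"
    using basis unfolding free_basis_def by (rule spec)
  from theI'[OF this]
  show "u = (\<Sum>i=1..n. int_multiple (coord u i) (X i))" "i \<notin> {1..n} \<Longrightarrow> coord u i = 0"
    unfolding coord_def by blast+
qed

lemma coord_unique:
  assumes "\<And>i. i \<notin> {1..n} \<Longrightarrow> c i = 0" "u = (\<Sum>i=1..n. int_multiple (c i) (X i))"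
  shows "coord u = c"
proof -
  have "\<exists>!c. (\<forall>i. i \<notin> {1..n} \<longrightarrow> c i = 0) \<and> u = (\<Sum>i=1..n. int_multiple (c i) (X i))"
    using basis unfolding free_basis_def by (rule spec)
  then show ?thesis
    unfolding coord_def using assms by (intro the1_equality) auto
qed

lemma coord_add: "coord (u + v) i = coord u i + coord v i"
proof -
  have "coord (u + v) = (\<lambda>i. coord u i + coord v i)"
  proof (rule coord_unique)
    have "u + v = (\<Sum>i=1..n. int_multiple (coord u i) (X i)) + (\<Sum>i=1..n. int_multiple (coord v i) (X i))"
      by (rule arg_cong2[where f = "(+)", OF coord_expand coord_expand])
    then show "u + v = (\<Sum>i=1..n. int_multiple (coord u i + coord v i) (X i))"
      by (simp add: int_mod.scale_left_distrib sum.distrib)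
  qed (simp add: coord_outside)
  then show ?thesis by simp
qed

lemma coord_basis:
  assumes "j \<in> {1..n}"
  shows "coord (X j) i = (if i = j then 1 else 0)"
proof -
  have "coord (X j) = (\<lambda>i. if i = j then 1 else 0)"
  proof (rule coord_unique)
    have "(\<Sum>i=1..n. int_multiple (if i = j then 1 else 0) (X i)) = (\<Sum>i=1..n. if i = j then X i else 0)"
      by (intro sum.cong) auto
    then show "X j = (\<Sum>i=1..n. int_multiple (if i = j then 1 else 0) (X i))"
      using assms by simp
  qed (use assms in auto)
  then show ?thesis by simp
qed

lemma additive_coord: "Modules.additive (\<lambda>u. real_of_int (coord u i))"
  by unfold_locales (simp add: coord_add)

lemma additive_expand:
  fixes h :: "'m \<Rightarrow> 'g::ab_group_add"
  assumes "Modules.additive h"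
  shows "h u = (\<Sum>i=1..n. int_multiple (coord u i) (h (X i)))"
proof -
  interpret Modules.additive h by (rule assms)
  have "h u = h (\<Sum>i=1..n. int_multiple (coord u i) (X i))"
    by (rule arg_cong[OF coord_expand])
  then show ?thesis by (simp add: sum additive_int_multiple[OF assms])
qed

text \<open>
  Applied to suitable \<open>h\<close>, this produces all the units of a cone from finitely many of them.
\<close>

lemma additive_in_submonoid:
  fixes h :: "'m \<Rightarrow> 'g::ab_group_add"
  assumes "Modules.additive h" "submonoid N" "\<And>i. i \<in> {1..n} \<Longrightarrow> h (X i) \<in> N \<and> - h (X i) \<in> N"
  shows "h u \<in> N"
proof -
  have mult: "int_multiple k x \<in> N" if "x \<in> N" "- x \<in> N" for k x
  proof (cases "k \<ge> 0")
    case True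
    then show ?thesis using assms(2) that submonoid_int_multiple by blast
  next
    case False
    then have "int_multiple (- k) (- x) \<in> N" using assms(2) that by (intro submonoid_int_multiple) auto
    then show ?thesis by simp
  qed
  have "(\<Sum>i\<in>I. int_multiple (coord u i) (h (X i))) \<in> N" if "I \<subseteq> {1..n}" for I
    using finite_subset[OF that finite_atLeastAtMost] that
  proof (induction I rule: finite_induct)
    case empty
    show ?case using submonoid_zero[OF assms(2)] by simp
  next
    case (insert i I)
    then show ?case using submonoid_add[OF assms(2)] mult assms(3) by simp
  qed
  then show ?thesis using additive_expand[OF assms(1), of u] by simp
qed

section \<open>Generators of the three kinds of cones\<close>

lemma const_in_submonoid:
  fixes N :: "(real \<times> 'm) set"
  assumes "submonoid N" "{0..} \<times> {0} \<subseteq> N" "(- 1, 0) \<in> N"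
  shows "(r, 0) \<in> N"
proof -
  let ?k = "\<lceil>\<bar>r\<bar>\<rceil>"
  have "int_multiple ?k (- 1, 0 :: 'm) \<in> N"
    using assms by (intro submonoid_int_multiple) auto
  then have "(- of_int ?k, 0) \<in> N" by (simp add: int_multiple_pair)
  moreover have "(r + of_int ?k, 0) \<in> N"
  proof -
    have "r + of_int ?k \<ge> 0" using le_of_int_ceiling[of "\<bar>r\<bar>"] by linarith
    then show ?thesis by (intro subsetD[OF assms(2)]) simp
  qed
  ultimately have "(- of_int ?k, 0) + (r + of_int ?k, 0) \<in> N" using submonoid_add[OF assms(1)] by blast
  then show ?thesis by simp
qed

lemma fin_gen_UNIV:
  "\<exists>F. finite F \<and> UNIV = submonoid hull (F \<union> {0 :: real..} \<times> {0 :: 'm})"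
proof -
  let ?F = "insert (- 1, 0) ((\<lambda>i. (0 :: real, X i)) ` {1..n} \<union> (\<lambda>i. (0, - X i)) ` {1..n})"
  let ?N = "submonoid hull (?F \<union> {0..} \<times> {0})"
  have sub: "?F \<union> {0..} \<times> {0} \<subseteq> ?N" by (rule hull_subset)
  have "(r, u) \<in> ?N" for r u
  proof -
    have h: "Modules.additive (\<lambda>u. (0 :: real, u :: 'm))" by unfold_locales simp
    have "(0, u) \<in> ?N"
      by (rule additive_in_submonoid[OF h submonoid_hull]) (use sub in auto)
    moreover have "(r, 0) \<in> ?N" by (rule const_in_submonoid[OF submonoid_hull]) (use sub in auto)
    ultimately have "(r, 0) + (0, u) \<in> ?N" using submonoid_add[OF submonoid_hull] by blast
    then show ?thesis by simp
  qed
  then have "UNIV = ?N" by auto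
  moreover have "finite ?F" by simp
  ultimately show ?thesis by (intro exI[of _ ?F] conjI)
qed

lemma fin_gen_evaluation_cone:
  assumes "Modules.additive \<psi>"
  shows "\<exists>F. finite F \<and> evaluation_cone \<psi> = submonoid hull (F \<union> {0..} \<times> {0 :: 'm})"
proof -
  interpret Modules.additive \<psi> by (rule assms)
  let ?F = "(\<lambda>i. (- \<psi> (X i), X i)) ` {1..n} \<union> (\<lambda>i. (\<psi> (X i), - X i)) ` {1..n}"
  let ?N = "submonoid hull (?F \<union> {0..} \<times> {0})"
  have sub: "?F \<union> {0..} \<times> {0} \<subseteq> ?N" by (rule hull_subset)
  have "?N \<subseteq> evaluation_cone \<psi>"
  proof (rule hull_minimal)
    show "?F \<union> {0..} \<times> {0} \<subseteq> evaluation_cone \<psi>"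
      by (auto simp: evaluation_cone_def minus zero)
    show "submonoid (evaluation_cone \<psi>)"
      using cone_evaluation[OF assms] by (simp add: cone_def)
  qed
  moreover have "(r, u) \<in> ?N" if "(r, u) \<in> evaluation_cone \<psi>" for r u
  proof -
    have h: "Modules.additive (\<lambda>u. (- \<psi> u, u))" by unfold_locales (simp add: add)
    have "(- \<psi> u, u) \<in> ?N"
      by (rule additive_in_submonoid[OF h submonoid_hull]) (use sub in auto)
    moreover have "(r + \<psi> u, 0) \<in> ?N" using that sub by (auto simp: evaluation_cone_def)
    ultimately have "(r + \<psi> u, 0) + (- \<psi> u, u) \<in> ?N" using submonoid_add[OF submonoid_hull] by blast
    then show ?thesis by simp
  qed
  ultimately have "evaluation_cone \<psi> = ?N" by auto
  moreover have "finite ?F" by simp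
  ultimately show ?thesis by (intro exI[of _ ?F] conjI)
qed

text \<open>
  The vectors \<open>u - \<psi> u \<cdot> e\<close> lie in the kernel of \<open>\<psi>\<close> and depend additively on \<open>u\<close>. Those of the basis
  vectors, with both signs, therefore generate the kernel, and \<open>e\<close> supplies the positive values.
\<close>

lemma fin_gen_halfspace_cone:
  assumes "unimodular \<psi>"
  shows "\<exists>F. finite F \<and> halfspace_cone \<psi> = submonoid hull (F \<union> {0..} \<times> {0 :: 'm})"
proof -
  obtain e where a: "Modules.additive \<psi>" and ints: "\<And>u. \<psi> u \<in> \<int>" and e: "\<psi> e = 1"
    using assms by (auto simp: unimodular_def)
  interpret Modules.additive \<psi> by (rule a)
  define h where "h u = (0 :: real, u - int_multiple \<lfloor>\<psi> u\<rfloor> e)" for u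
  have h: "Modules.additive h"
  proof
    fix u v
    have "\<lfloor>\<psi> (u + v)\<rfloor> = \<lfloor>\<psi> u\<rfloor> + \<lfloor>\<psi> v\<rfloor>"
      using ints[of v] by (auto simp: add elim!: Ints_cases)
    then show "h (u + v) = h u + h v"
      by (simp add: h_def int_mod.scale_left_distrib)
  qed
  let ?F = "{(- 1, 0), (0, e)} \<union> (\<lambda>i. h (X i)) ` {1..n} \<union> (\<lambda>i. - h (X i)) ` {1..n}"
  let ?N = "submonoid hull (?F \<union> {0..} \<times> {0})"
  have sub: "?F \<union> {0..} \<times> {0} \<subseteq> ?N" by (rule hull_subset)
  have "\<psi> (u - int_multiple \<lfloor>\<psi> u\<rfloor> e) = 0" for u
    using ints[of u] e by (auto simp: diff additive_real_int_multiple[OF a] elim!: Ints_cases)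
  then have hL: "h u \<in> halfspace_cone \<psi>" "- h u \<in> halfspace_cone \<psi>" for u
    by (simp_all add: halfspace_cone_def h_def minus del: minus_diff_eq)
  have "?F \<union> {0..} \<times> {0} \<subseteq> halfspace_cone \<psi>"
  proof -
    have "(- 1, 0) \<in> halfspace_cone \<psi>" "(0, e) \<in> halfspace_cone \<psi>" "{0..} \<times> {0} \<subseteq> halfspace_cone \<psi>"
      using e zero by (auto simp: halfspace_cone_def)
    then show ?thesis using hL by (simp add: image_subset_iff)
  qed
  then have "?N \<subseteq> halfspace_cone \<psi>"
    using cone_halfspace[OF a] unfolding cone_def by (metis hull_minimal)
  moreover have "(r, u) \<in> ?N" if "(r, u) \<in> halfspace_cone \<psi>" for r u
  proof -
    have "h u \<in> ?N"
      by (rule additive_in_submonoid[OF h submonoid_hull]) (use sub in auto)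
    moreover have "int_multiple \<lfloor>\<psi> u\<rfloor> (0, e) \<in> ?N"
      using sub that by (intro submonoid_int_multiple submonoid_hull) (auto simp: halfspace_cone_def)
    moreover have "(r, 0) \<in> ?N" by (rule const_in_submonoid[OF submonoid_hull]) (use sub in auto)
    ultimately have "(r, 0) + (h u + int_multiple \<lfloor>\<psi> u\<rfloor> (0, e)) \<in> ?N"
      using submonoid_add[OF submonoid_hull] by blast
    then show ?thesis by (simp add: h_def int_multiple_pair)
  qed
  ultimately have "halfspace_cone \<psi> = ?N" by auto
  moreover have "finite ?F" by simp
  ultimately show ?thesis by (intro exI[of _ ?F] conjI)
qed

end

section \<open>The cones of finitely generated prime congruences\<close>

definition standard_cone :: "(real \<times> 'm::ab_group_add) set \<Rightarrow> bool" where
  "standard_cone L \<longleftrightarrow> L = UNIV \<or> (\<exists>\<psi>. Modules.additive \<psi> \<and> L = evaluation_cone \<psi>)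
     \<or> (\<exists>\<psi>. unimodular \<psi> \<and> L = halfspace_cone \<psi>)"

lemma (in free_abelian) fin_gen_cone_iff:
  fixes L :: "(real \<times> 'm) set"
  assumes L: "cone L" "is_total L"
  shows "(\<exists>F. finite F \<and> L = submonoid hull (F \<union> {0..} \<times> {0})) \<longleftrightarrow> standard_cone L"
proof
  assume "standard_cone L"
  then show "\<exists>F. finite F \<and> L = submonoid hull (F \<union> {0..} \<times> {0})"
    using fin_gen_UNIV fin_gen_evaluation_cone fin_gen_halfspace_cone
    unfolding standard_cone_def by metis
next
  assume "\<exists>F. finite F \<and> L = submonoid hull (F \<union> {0..} \<times> {0})"
  then obtain F where F: "finite F" "L = submonoid hull (F \<union> {0..} \<times> {0})" by blast
  from archimedean_cone_cases[OF L fin_gen_archimedean[OF L F]]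
  show "standard_cone L"
  proof cases
    case (3 \<psi> u)
    then obtain \<theta> where "unimodular \<theta>" "halfspace_cone \<psi> = halfspace_cone \<theta>"
      using unimodular_if_fin_gen[OF 3(1,2) F(1)] F(2) by metis
    then show ?thesis using 3 by (auto simp: standard_cone_def)
  qed (auto simp: standard_cone_def)
qed

section \<open>Geometric congruences\<close>

lemma in_evaluation_cone: "(r, u) \<in> evaluation_cone \<psi> \<longleftrightarrow> r + \<psi> u \<ge> 0"
  by (simp add: evaluation_cone_def)

lemma const_laurent_add: "const_laurent s + const_laurent t = const_laurent (s + t)"
  and const_laurent_mult: "const_laurent s * const_laurent t = const_laurent (s * t)"
  by (simp_all add: const_laurent_def single_add mult_single)

lemma const_laurent_Fin: "const_laurent (Fin r) = monomial r 0"
  by (simp add: const_laurent_def monomial_def)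

lemma const_laurent_MInf: "const_laurent MInf = 0"
  by (simp add: const_laurent_def flip: zero_tropical_def)

text \<open>
  If the constants represent every class exactly once, \<open>\<psi> u\<close> is the constant representing the
  monomial with exponent \<open>u\<close>. Conversely, modulo an evaluation cone the leading monomial
  \<open>(r, u)\<close> of a polynomial has the same down-set as the constant \<open>r + \<psi> u\<close>.
\<close>

lemma geometric_iff:
  fixes P :: "('m::ab_group_add laurent \<times> 'm laurent) set"
  assumes P: "prime_congruence P"
  shows "geometric P \<longleftrightarrow> (\<exists>\<psi>. Modules.additive \<psi> \<and> L_set P = evaluation_cone \<psi>)"
proof
  have C: "congruence P" and proper: "P \<noteq> UNIV"
    using P by (auto simp: prime_congruence_def)
  note sym = congruence_sym[OF C] and trans = congruence_trans[OF C] and refl = congruence_refl[OF C]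
  have equiv: "equiv UNIV P" using C by (simp add: congruence_def)
  have class_eq: "P `` {f} = P `` {g} \<longleftrightarrow> (f, g) \<in> P" for f g
    using equiv by (simp add: eq_equiv_class_iff)
  {
    assume "geometric P"
    then have bij: "bij_betw (\<lambda>t. P `` {const_laurent t}) UNIV (UNIV // P)"
      by (simp add: geometric_def)
    have inj: "s = t" if "(const_laurent s, const_laurent t) \<in> P" for s t
      using bij that class_eq unfolding bij_betw_def inj_def by blast
    have surj: "\<exists>t. (f, const_laurent t) \<in> P" for f
    proof -
      have "P `` {f} \<in> (\<lambda>t. P `` {const_laurent t}) ` UNIV"
        using bij unfolding bij_betw_def by (metis UNIV_I quotientI)
      then show ?thesis using class_eq by blast
    qed
    have "\<exists>t. (monomial 0 u, const_laurent (Fin t)) \<in> P" for u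
    proof -
      obtain t where t: "(monomial 0 u, const_laurent t) \<in> P" using surj by blast
      then have "t \<noteq> MInf"
        using proper_zero_not_unit[OF C proper] sym by (metis const_laurent_MInf)
      then show ?thesis using t by (cases t) auto
    qed
    then obtain \<psi> where \<psi>: "\<And>u. (monomial 0 u, const_laurent (Fin (\<psi> u))) \<in> P" by metis
    have eval: "(monomial r u, const_laurent (Fin (r + \<psi> u))) \<in> P" for r u
    proof -
      have "(monomial r 0 * monomial 0 u, monomial r 0 * const_laurent (Fin (\<psi> u))) \<in> P"
        by (intro congruence_mult C refl \<psi>)
      then show ?thesis
        by (simp add: monomial_mult const_laurent_Fin)
    qed
    have "Modules.additive \<psi>"
    proof
      fix u v
      have "(monomial 0 u * monomial 0 v, const_laurent (Fin (\<psi> u)) * const_laurent (Fin (\<psi> v))) \<in> P"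
        by (intro congruence_mult C \<psi>)
      then have "(monomial 0 (u + v), const_laurent (Fin (\<psi> u + \<psi> v))) \<in> P"
        by (simp add: monomial_mult const_laurent_mult)
      then have "Fin (\<psi> (u + v)) = Fin (\<psi> u + \<psi> v)"
        by (intro inj) (rule trans[OF sym[OF \<psi>]])
      then show "\<psi> (u + v) = \<psi> u + \<psi> v" by simp
    qed
    moreover have "L_set P = evaluation_cone \<psi>"
    proof -
      have "(r, u) \<in> L_set P \<longleftrightarrow> (r, u) \<in> evaluation_cone \<psi>" for r u
      proof -
        let ?s = "r + \<psi> u"
        have "(monomial r u + 1, const_laurent (Fin ?s) + 1) \<in> P"
          by (intro congruence_add C refl eval)
        then have m: "(monomial r u + 1, const_laurent (Fin (max ?s 0))) \<in> P"
          by (simp add: one_laurent const_laurent_add flip: const_laurent_Fin)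
        have "(r, u) \<in> L_set P \<longleftrightarrow> (const_laurent (Fin (max ?s 0)), const_laurent (Fin ?s)) \<in> P"
          using trans[OF sym[OF m] trans[OF _ eval]] trans[OF m trans[OF _ sym[OF eval]]]
          by (auto simp: L_set_def)
        also have "\<dots> \<longleftrightarrow> max ?s 0 = ?s" using inj refl by (metis tropical.inject)
        finally show ?thesis by (auto simp: in_evaluation_cone)
      qed
      then show ?thesis by auto
    qed
    ultimately show "\<exists>\<psi>. Modules.additive \<psi> \<and> L_set P = evaluation_cone \<psi>" by blast
  }
  {
    assume "\<exists>\<psi>. Modules.additive \<psi> \<and> L_set P = evaluation_cone \<psi>"
    then obtain \<psi> where \<psi>: "Modules.additive \<psi>" and L: "L_set P = evaluation_cone \<psi>" by blast
    interpret Modules.additive \<psi> by (rule \<psi>)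
    have PL: "(f, g) \<in> P \<longleftrightarrow> down (L_set P) f = down (L_set P) g" for f g
      using prime_eq_cone_congruence[OF P] by (auto simp: cone_congruence_def)
    have down: "x \<in> down (L_set P) (monomial r u) \<longleftrightarrow> fst x + \<psi> (snd x) \<le> r + \<psi> u" for x r u
      by (cases x) (auto simp: down_monomial L in_evaluation_cone diff)
    have "s = t" if st: "(const_laurent s, const_laurent t) \<in> P" for s t
    proof (cases "s = MInf \<or> t = MInf")
      case True
      then show ?thesis
        using st sym[OF st] proper_zero_not_unit[OF C proper]
        by (cases s; cases t) (auto simp: const_laurent_MInf const_laurent_Fin)
    next
      case False
      then obtain a b where ab: "s = Fin a" "t = Fin b" by (metis tropical.exhaust)
      have "(a, 0) \<in> down (L_set P) (monomial b 0)" "(b, 0) \<in> down (L_set P) (monomial a 0)"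
        using st down[of "(a, 0)" a 0] down[of "(b, 0)" b 0] by (auto simp: ab const_laurent_Fin PL)
      then show ?thesis by (simp add: down ab zero)
    qed
    then have "inj (\<lambda>t. P `` {const_laurent t})"
      by (intro injI) (simp add: class_eq)
    moreover have "\<exists>t. (f, const_laurent t) \<in> P" for f
    proof (cases "f = 0")
      case True
      then show ?thesis using refl by (metis const_laurent_MInf)
    next
      case False
      obtain r u where "down (L_set P) f = down (L_set P) (monomial r u)"
        using leading_monomial[OF cone_L_set[OF C] prime_total[OF P] False] by metis
      also have "\<dots> = down (L_set P) (const_laurent (Fin (r + \<psi> u)))"
        by (auto simp: const_laurent_Fin down zero simp del: split_paired_All)
      finally show ?thesis using PL by blast
    qed
    then have "range (\<lambda>t. P `` {const_laurent t}) = UNIV // P"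
      using class_eq by (auto simp: quotient_def) blast
    ultimately show "geometric P"
      by (simp add: geometric_def C bij_betw_def)
  }
qed

section \<open>Real vector spaces over the rationals\<close>

text \<open>
  Restriction of scalars. It is applied to the real numbers themselves, for discontinuous additive
  functions, and to the extension of \<open>M\<close>, for the rank of a subgroup.
\<close>

definition rat_scale :: "rat \<Rightarrow> 'v::real_vector \<Rightarrow> 'v" where
  "rat_scale q x = of_rat q *\<^sub>R x"

interpretation rat: vector_space rat_scale
  by unfold_locales
     (simp_all add: rat_scale_def scaleR_add_right scaleR_add_left of_rat_add of_rat_mult)

interpretation rat_pair: vector_space_pair "rat_scale :: rat \<Rightarrow> real \<Rightarrow> real" "rat_scale :: rat \<Rightarrow> real \<Rightarrow> real"
  by unfold_locales

lemma separating_additive_function: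
  fixes a b :: real
  assumes "a \<noteq> 0" "b / a \<notin> \<rat>"
  obtains \<theta> :: "real \<Rightarrow> real" where "Modules.additive \<theta>" "\<theta> a = 0" "\<theta> b = 1"
proof -
  have "b \<notin> rat.span {a}"
  proof
    assume "b \<in> rat.span {a}"
    then obtain q where "b = rat_scale q a" by (auto simp: rat.span_singleton)
    then have "b / a = of_rat q" using assms(1) by (simp add: rat_scale_def)
    then show False using assms(2) by simp
  qed
  moreover have "rat.independent {a}"
    using assms(1) by (simp add: rat.independent_insert)
  ultimately have "rat.independent {b, a}"
    by (simp add: rat.independent_insert)
  from rat_pair.linear_independent_extend[OF this, of "\<lambda>x. if x = b then 1 else 0"]
  obtain g where g: "Vector_Spaces.linear rat_scale rat_scale g" "\<forall>x\<in>{b, a}. g x = (if x = b then 1 else (0 :: real))"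
    by blast
  interpret Vector_Spaces.linear rat_scale rat_scale g by (rule g)
  have "Modules.additive g" by unfold_locales (rule add)
  moreover have "a \<noteq> b" using assms by auto
  ultimately show thesis using g(2) that by auto
qed

lemma rat_denominator:
  fixes x :: real
  assumes "x \<in> \<rat>"
  obtains q :: int where "q > 0" "of_int q * x \<in> \<int>"
proof -
  obtain p q :: int where "q > 0" "x = of_int p / of_int q"
    using assms by (metis Rats_cases')
  then show thesis using that[of q] by simp
qed

lemma common_denominator:
  fixes f :: "'a \<Rightarrow> real"
  assumes "finite I" "\<And>i. i \<in> I \<Longrightarrow> f i \<in> \<rat>"
  obtains q :: int where "q > 0" "\<And>i. i \<in> I \<Longrightarrow> of_int q * f i \<in> \<int>"
proof -
  have "\<exists>q>0 :: int. \<forall>i\<in>I. of_int q * f i \<in> \<int>"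
    using assms
  proof (induction I rule: finite_induct)
    case empty
    show ?case by (intro exI[of _ 1]) simp
  next
    case (insert i I)
    then obtain q :: int where q: "q > 0" "\<forall>i\<in>I. of_int q * f i \<in> \<int>" by auto
    obtain p :: int where p: "p > 0" "of_int p * f i \<in> \<int>"
      using rat_denominator[of "f i"] insert.prems by blast
    have "of_int (p * q) * f j \<in> \<int>" if "j \<in> insert i I" for j
    proof (cases "j = i")
      case True
      have "of_int q * (of_int p * f i) \<in> \<int>" by (rule Ints_mult[OF Ints_of_int p(2)])
      then show ?thesis using True by (simp only: of_int_mult mult_ac)
    next
      case False
      then have "of_int p * (of_int q * f j) \<in> \<int>"
        using q that by (intro Ints_mult[OF Ints_of_int, of "of_int q * f j" p]) simp
      then show ?thesis by (simp add: mult_ac)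
    qed
    then show ?case using p q by (intro exI[of _ "p * q"]) simp
  qed
  then show thesis using that by blast
qed

context free_abelian
begin

text \<open>
  After clearing denominators the values are integers, and the well-ordering of the natural numbers
  provides a least positive one.
\<close>

lemma unimodular_if_rational:
  fixes \<psi> :: "'m \<Rightarrow> real"
  assumes \<psi>: "Modules.additive \<psi>" "\<psi> u \<noteq> 0"
    and rational: "\<And>i. i \<in> {1..n} \<Longrightarrow> \<psi> (X i) / \<psi> u \<in> \<rat>"
  obtains \<theta> where "unimodular \<theta>" "halfspace_cone \<psi> = halfspace_cone \<theta>"
proof -
  obtain q :: int where q: "q > 0" "\<And>i. i \<in> {1..n} \<Longrightarrow> of_int q * (\<psi> (X i) / \<psi> u) \<in> \<int>"
    using common_denominator[of "{1..n}" "\<lambda>i. \<psi> (X i) / \<psi> u"] rational by auto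
  define c where "c = of_int q / \<bar>\<psi> u\<bar>"
  have c: "c > 0" using q \<psi> by (simp add: c_def)
  define \<kappa> where "\<kappa> v = c * \<psi> v" for v
  have \<kappa>: "Modules.additive \<kappa>"
    using \<psi>(1) unfolding Modules.additive_def \<kappa>_def by (simp add: distrib_left)
  have "\<kappa> (X i) \<in> \<int>" if "i \<in> {1..n}" for i
  proof (cases "\<psi> u > 0")
    case True
    then show ?thesis using q(2)[OF that] by (simp add: \<kappa>_def c_def)
  next
    case False
    then have "\<kappa> (X i) = - (of_int q * (\<psi> (X i) / \<psi> u))" using \<psi> by (simp add: \<kappa>_def c_def)
    then show ?thesis using Ints_minus[OF q(2)[OF that]] by simp
  qed
  then have ints: "\<kappa> v \<in> \<int>" for v
    unfolding additive_expand[OF \<kappa>, of v] int_multiple_real_vector by (intro Ints_sum) auto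
  have "\<exists>v. \<kappa> v > 0"
  proof -
    have "\<kappa> (- u) = - \<kappa> u" by (rule additive.minus[OF \<kappa>])
    moreover have "\<kappa> u \<noteq> 0" using \<psi> c by (simp add: \<kappa>_def)
    ultimately show ?thesis by (metis linorder_neqE_linordered_idom neg_0_less_iff_less)
  qed
  then have ex: "\<exists>m::nat. m > 0 \<and> (\<exists>v. \<kappa> v = real m)"
  proof -
    obtain v where v: "\<kappa> v > 0" using \<open>\<exists>v. \<kappa> v > 0\<close> by blast
    obtain k :: int where k: "\<kappa> v = of_int k" using ints[of v] by (auto elim: Ints_cases)
    then have "\<kappa> v = real (nat k)" "nat k > 0" using v by auto
    then show ?thesis by blast
  qed
  define m where "m = (LEAST m. m > 0 \<and> (\<exists>v. \<kappa> v = real m))"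
  have m: "m > 0" "\<exists>v. \<kappa> v = real m"
    using LeastI_ex[OF ex] unfolding m_def by blast+
  have "\<kappa> v = 0 \<or> \<kappa> v \<ge> real m" if pos: "\<kappa> v \<ge> 0" for v
  proof -
    obtain k :: nat where k: "\<kappa> v = real k"
    proof -
      obtain k :: int where k: "\<kappa> v = of_int k" using ints[of v] by (auto elim: Ints_cases)
      then have "\<kappa> v = real (nat k)" using pos by simp
      then show ?thesis by (rule that)
    qed
    then have "k = 0 \<or> m \<le> k" unfolding m_def by (metis (mono_tags, lifting) Least_le neq0_conv)
    then show ?thesis using k by auto
  qed
  then have "unimodular (\<lambda>v. \<kappa> v / real m)"
    using m \<kappa> unimodular_scaling[OF \<kappa>] by (metis of_nat_0_less_iff)
  moreover have "halfspace_cone \<psi> = halfspace_cone (\<lambda>v. \<kappa> v / real m)"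
    using c m by (auto simp: halfspace_cone_def \<kappa>_def zero_le_divide_iff zero_le_mult_iff)
  ultimately show thesis by (rule that)
qed

end

section \<open>Extension of scalars\<close>

lemma real_emb_add: "real_emb (u + v) = real_emb u + real_emb v"
proof (transfer)
  fix u v :: 'a
  have "Poly_Mapping.single (u + v) 1 - Poly_Mapping.single u 1 - Poly_Mapping.single v (1 :: real)
      \<in> span additivity_relations"
    by (rule span_base) (auto simp: additivity_relations_def)
  then show "Poly_Mapping.single (u + v) 1 - (Poly_Mapping.single u 1 + Poly_Mapping.single v (1 :: real))
      \<in> span additivity_relations"
    by (simp add: diff_diff_eq)
qed

lemma additive_real_emb: "Modules.additive real_emb"
  by unfold_locales (rule real_emb_add)

lemma lookup_scaleR:
  "Poly_Mapping.lookup (r *\<^sub>R f) k = r *\<^sub>R Poly_Mapping.lookup (f :: 'a \<Rightarrow>\<^sub>0 'v::real_vector) k"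
proof -
  have "finite {k. r *\<^sub>R Poly_Mapping.lookup f k \<noteq> 0}"
    by (rule finite_subset[OF _ finite_keys[of f]]) (auto simp: in_keys_iff)
  then show ?thesis by (simp add: scaleR_poly_mapping_def)
qed

definition linear_combination :: "('m \<Rightarrow> real) \<Rightarrow> ('m \<Rightarrow>\<^sub>0 real) \<Rightarrow> real" where
  "linear_combination \<psi> f = (\<Sum>u\<in>Poly_Mapping.keys f. Poly_Mapping.lookup f u * \<psi> u)"

lemma linear_combination_superset:
  assumes "finite A" "Poly_Mapping.keys f \<subseteq> A"
  shows "linear_combination \<psi> f = (\<Sum>u\<in>A. Poly_Mapping.lookup f u * \<psi> u)"
  unfolding linear_combination_def
  by (rule sum.mono_neutral_left) (use assms in \<open>auto simp: in_keys_iff\<close>)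

lemma linear_linear_combination: "linear (linear_combination \<psi>)"
proof (rule linearI)
  fix f g :: "'a \<Rightarrow>\<^sub>0 real" and r :: real
  let ?A = "Poly_Mapping.keys f \<union> Poly_Mapping.keys g"
  have "linear_combination \<psi> (f + g) = (\<Sum>u\<in>?A. Poly_Mapping.lookup (f + g) u * \<psi> u)"
    by (rule linear_combination_superset) (auto dest: subsetD[OF keys_add])
  also have "\<dots> = linear_combination \<psi> f + linear_combination \<psi> g"
    by (simp add: linear_combination_superset[of ?A] lookup_add distrib_right sum.distrib)
  finally show "linear_combination \<psi> (f + g) = linear_combination \<psi> f + linear_combination \<psi> g" .
  have "linear_combination \<psi> (r *\<^sub>R f) = (\<Sum>u\<in>Poly_Mapping.keys f. Poly_Mapping.lookup (r *\<^sub>R f) u * \<psi> u)"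
    by (rule linear_combination_superset) (auto simp: in_keys_iff lookup_scaleR)
  then show "linear_combination \<psi> (r *\<^sub>R f) = r *\<^sub>R linear_combination \<psi> f"
    by (simp add: linear_combination_def sum_distrib_left mult.assoc lookup_scaleR)
qed

lemma linear_combination_single: "linear_combination \<psi> (Poly_Mapping.single u r) = r * \<psi> u"
  by (simp add: linear_combination_superset[of "{u}"])

text \<open>
  Functions that are not additive are sent to \<open>0\<close>, since their linear extension to the free vector
  space does not respect the relations.
\<close>

lift_definition extend_linearly :: "('m::ab_group_add \<Rightarrow> real) \<Rightarrow> 'm real_ext \<Rightarrow> real" is
  "\<lambda>\<psi> f. if Modules.additive \<psi> then linear_combination \<psi> f else 0"
proof -
  fix \<psi> :: "'m \<Rightarrow> real" and f g :: "'m \<Rightarrow>\<^sub>0 real"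
  assume fg: "f - g \<in> span additivity_relations"
  show "(if Modules.additive \<psi> then linear_combination \<psi> f else 0) =
      (if Modules.additive \<psi> then linear_combination \<psi> g else 0)"
  proof (cases "Modules.additive \<psi>")
    case True
    interpret lin: linear "linear_combination \<psi>" by (rule linear_linear_combination)
    have "linear_combination \<psi> (f - g) = 0"
    proof (rule linear_eq_0_on_span[OF linear_linear_combination _ fg])
      fix h :: "'m \<Rightarrow>\<^sub>0 real" assume "h \<in> additivity_relations"
      then show "linear_combination \<psi> h = 0"
        using True by (auto simp: additivity_relations_def lin.diff linear_combination_single additive.add)
    qed
    then show ?thesis by (simp add: lin.diff)
  qed simp
qed

lemma linear_extend_linearly: "linear (extend_linearly \<psi>)"
proof (rule linearI)
  fix x y :: "'a real_ext" and r :: real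
  show "extend_linearly \<psi> (x + y) = extend_linearly \<psi> x + extend_linearly \<psi> y"
    by transfer (simp add: linear_add[OF linear_linear_combination])
  show "extend_linearly \<psi> (r *\<^sub>R x) = r *\<^sub>R extend_linearly \<psi> x"
    by transfer (simp add: linear_scale[OF linear_linear_combination])
qed

lemma extend_linearly_real_emb: "Modules.additive \<psi> \<Longrightarrow> extend_linearly \<psi> (real_emb u) = \<psi> u"
  by transfer (simp add: linear_combination_single)

lemma span_real_emb: "span (range real_emb) = UNIV"
proof -
  have "x \<in> span (range real_emb)" for x :: "'a real_ext"
  proof (induction x rule: real_ext.abs_induct)
    case (1 f)
    show ?case
    proof (induction f rule: Poly_Mapping.update_induct)
      case const
      have "abs_real_ext 0 = (0 :: 'a real_ext)" by (simp add: zero_real_ext.abs_eq)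
      then show ?case by (simp add: span_zero)
    next
      case (update f a b)
      have "Poly_Mapping.update a b f = f + b *\<^sub>R Poly_Mapping.single a 1"
        using update(1)
        by (intro poly_mapping_eqI) (auto simp: lookup_update lookup_add lookup_single when_def in_keys_iff lookup_scaleR)
      then have "abs_real_ext (Poly_Mapping.update a b f) = abs_real_ext f + b *\<^sub>R real_emb a"
        by (simp add: plus_real_ext.abs_eq scaleR_real_ext.abs_eq real_emb.abs_eq)
      moreover have "b *\<^sub>R real_emb a \<in> span (range real_emb)" by (intro span_scale span_base) simp
      ultimately show ?case using update.IH by (simp add: span_add)
    qed
  qed
  then show ?thesis by auto
qed

lemma span_lattice_points: "span lattice_points = (UNIV :: (real \<times> 'm::ab_group_add real_ext) set)"
proof -
  have emb0: "real_emb 0 = (0 :: 'm real_ext)"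
    by (rule additive.zero[OF additive_real_emb])
  have "(r, x) \<in> span lattice_points" for r and x :: "'m real_ext"
  proof -
    have lin: "linear (\<lambda>x :: 'm real_ext. (0 :: real, x))"
      by (rule linearI) auto
    have "(0 :: real, x) \<in> (\<lambda>x. (0, x)) ` span (range real_emb)"
      by (simp add: span_real_emb)
    also have "\<dots> = span ((\<lambda>x. (0, x)) ` range real_emb)"
      by (rule linear_span_image[OF lin, symmetric])
    also have "\<dots> \<subseteq> span lattice_points"
      by (rule span_mono) (auto simp: lattice_points_def)
    finally have "(0, x) \<in> span lattice_points" .
    moreover have "(1, 0) \<in> (lattice_points :: (real \<times> 'm real_ext) set)"
      unfolding lattice_points_def using emb0 by (metis (mono_tags, lifting) mem_Collect_eq)
    then have "r *\<^sub>R (1, 0) \<in> span (lattice_points :: (real \<times> 'm real_ext) set)"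
      by (intro span_scale span_base)
    ultimately have "r *\<^sub>R (1, 0) + (0, x) \<in> span lattice_points" using span_add by blast
    then show ?thesis by simp
  qed
  then show ?thesis by auto
qed

lemma dim_kernel:
  fixes l :: "'v::real_vector \<Rightarrow> real"
  assumes S: "finite S" "span S = (UNIV :: 'v set)" and l: "linear l" "l e \<noteq> 0"
  shows "dim (UNIV :: 'v set) = dim {x. l x = 0} + 1"
proof -
  let ?K = "{x. l x = 0}"
  have K: "subspace ?K" using linear_subspace_kernel[OF l(1)] .
  obtain B where B: "B \<subseteq> ?K" "independent B" "?K \<subseteq> span B" "card B = dim ?K"
    using basis_exists[of ?K] by blast
  have fin: "finite B" using independent_span_bound[OF S(1) B(2)] S(2) by simp
  have "span B \<subseteq> ?K" using B(1) K by (rule span_minimal)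
  then have e: "e \<notin> span B" using l by auto
  then have "independent (insert e B)" using B(2) by (simp add: independent_insert)
  moreover have "x \<in> span (insert e B)" for x
  proof -
    have "x - (l x / l e) *\<^sub>R e \<in> ?K"
      using l by (simp add: linear_diff linear_scale)
    then have "x - (l x / l e) *\<^sub>R e \<in> span B" using B(3) by blast
    then show ?thesis unfolding span_insert by blast
  qed
  ultimately have "dim (UNIV :: 'v set) = card (insert e B)"
    by (intro dim_unique) auto
  moreover have "e \<notin> B" using e span_base by blast
  ultimately show ?thesis using B(4) fin by simp
qed

section \<open>Rational hyperplanes and flags of length one\<close>

context free_abelian
begin

lemma span_real_emb_basis: "span ((\<lambda>i. real_emb (X i)) ` {1..n}) = UNIV"
proof -
  have "real_emb u \<in> span ((\<lambda>i. real_emb (X i)) ` {1..n})" for u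
    unfolding additive_expand[OF additive_real_emb, of u] int_multiple_real_vector
    by (intro span_sum span_scale span_base) auto
  then have "span (range real_emb) \<subseteq> span ((\<lambda>i. real_emb (X i)) ` {1..n})"
    by (intro span_minimal subspace_span) auto
  then show ?thesis by (simp add: span_real_emb top_unique)
qed

text \<open>
  The orientation is given by a linear form that vanishes on the constants, hence by a form \<open>\<nu>\<close>
  on the extension of \<open>M\<close> with kernel \<open>K\<close>. Let \<open>\<psi>\<close> be its restriction to \<open>M\<close>. An additive
  \<open>\<theta>: \<real> \<rightarrow> \<real>\<close> with \<open>\<theta> (\<psi> (X j)) = 0\<close> and \<open>\<theta> (\<psi> (X i)) = 1\<close> gives a linear form \<open>\<mu>\<close> extending
  \<open>\<theta> \<circ> \<psi>\<close>. It vanishes on the lattice vectors that span \<open>K\<close>, hence on \<open>K\<close>. But then it vanishes on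
  \<open>X i\<close>, where it should be \<open>1\<close>, because \<open>X i\<close> differs from a multiple of \<open>X j\<close> by an element of \<open>K\<close>.
\<close>

lemma halfspace_if_flag:
  assumes flag: "is_flag 1 H Hp" "H 1 = UNIV \<times> K" "rational_hyperplane K"
  obtains \<psi> where "unimodular \<psi>"
    "{(r, u). (r, real_emb u) \<in> flag_set 1 H Hp} = halfspace_cone (\<psi> :: 'm \<Rightarrow> real)"
proof -
  have "H 0 = UNIV" "H 1 \<subset> H 0" "orientation (span (H 0 \<inter> lattice_points)) (H 1) (Hp 1)"
    using flag(1) by (auto simp: is_flag_def)
  then have "orientation UNIV (H 1) (Hp 1)" by (simp add: span_lattice_points)
  then obtain l :: "real \<times> 'm real_ext \<Rightarrow> real" where l: "linear l" "H 1 = {x. l x = 0}" "Hp 1 = {x. l x > 0}"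
    unfolding orientation_def by auto
  have "H 1 \<noteq> UNIV" using \<open>H 0 = UNIV\<close> \<open>H 1 \<subset> H 0\<close> by blast
  then have nz: "\<exists>x. l x \<noteq> 0" using l(2) by auto
  obtain A where K: "K = span (real_emb ` A)"
    using flag(3) by (auto simp: rational_hyperplane_def)
  define \<nu> where "\<nu> x = l (0, x)" for x
  have \<nu>: "linear \<nu>"
    unfolding \<nu>_def
    by (rule linearI) (simp_all flip: linear_add[OF l(1)] linear_scale[OF l(1), simplified real_scaleR_def])
  have "l (1, 0) = 0"
    using l(2) flag(2) span_zero[of "real_emb ` A"] K by auto
  then have "l (r, 0) = 0" for r
    using linear_scale[OF l(1), of r "(1, 0)"] by simp
  then have l\<nu>: "l (r, x) = \<nu> x" for r x
    using linear_add[OF l(1), of "(r, 0)" "(0, x)"] by (simp add: \<nu>_def)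
  have ker: "x \<in> K \<longleftrightarrow> \<nu> x = 0" for x
  proof -
    have "x \<in> K \<longleftrightarrow> (0, x) \<in> H 1" unfolding flag(2) by simp
    then show ?thesis unfolding l(2) by (simp add: l\<nu>)
  qed
  define \<psi> where "\<psi> u = \<nu> (real_emb u)" for u
  have \<psi>: "Modules.additive \<psi>"
    by unfold_locales (simp add: \<psi>_def real_emb_add linear_add[OF \<nu>])
  have cone: "{(r, u). (r, real_emb u) \<in> flag_set 1 H Hp} = halfspace_cone \<psi>"
    using l l\<nu> by (auto simp: flag_set_def halfspace_cone_def \<psi>_def)
  have "\<exists>j\<in>{1..n}. \<psi> (X j) \<noteq> 0"
  proof (rule ccontr)
    assume "\<not> (\<exists>j\<in>{1..n}. \<psi> (X j) \<noteq> 0)"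
    then have zero: "\<nu> y = 0" if "y \<in> (\<lambda>i. real_emb (X i)) ` {1..n}" for y
      using that unfolding \<psi>_def by blast
    have "\<nu> x = 0" for x
    proof (rule linear_eq_0_on_span[OF \<nu>])
      show "x \<in> span ((\<lambda>i. real_emb (X i)) ` {1..n})"
        unfolding span_real_emb_basis by (rule UNIV_I)
    qed (rule zero)
    then show False using nz l\<nu> by auto
  qed
  then obtain j where j: "j \<in> {1..n}" "\<psi> (X j) \<noteq> 0" by blast
  have "\<psi> (X i) / \<psi> (X j) \<in> \<rat>" if "i \<in> {1..n}" for i
  proof (rule ccontr)
    assume "\<psi> (X i) / \<psi> (X j) \<notin> \<rat>"
    then obtain \<theta> :: "real \<Rightarrow> real" where \<theta>: "Modules.additive \<theta>" "\<theta> (\<psi> (X j)) = 0" "\<theta> (\<psi> (X i)) = 1"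
      using separating_additive_function[OF j(2)] by blast
    define \<mu> where "\<mu> = extend_linearly (\<lambda>u. \<theta> (\<psi> u))"
    have "Modules.additive (\<lambda>u. \<theta> (\<psi> u))"
      by unfold_locales (simp add: additive.add[OF \<psi>] additive.add[OF \<theta>(1)])
    then have \<mu>: "\<mu> (real_emb u) = \<theta> (\<psi> u)" for u
      by (simp add: \<mu>_def extend_linearly_real_emb)
    have lin: "linear \<mu>" unfolding \<mu>_def by (rule linear_extend_linearly)
    have "\<mu> x = 0" if "x \<in> K" for x
    proof (rule linear_eq_0_on_span[OF lin])
      show "x \<in> span (real_emb ` A)" using that K by simp
      fix y assume y: "y \<in> real_emb ` A"
      then have "y \<in> K" unfolding K by (rule span_base)
      then have "\<nu> y = 0" using ker by simp
      then show "\<mu> y = 0" using y \<mu> additive.zero[OF \<theta>(1)] by (auto simp: \<psi>_def)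
    qed
    moreover have "real_emb (X i) - (\<psi> (X i) / \<psi> (X j)) *\<^sub>R real_emb (X j) \<in> K"
      using j(2) by (simp add: ker linear_diff[OF \<nu>] linear_scale[OF \<nu>] flip: \<psi>_def)
    ultimately have "\<mu> (real_emb (X i) - (\<psi> (X i) / \<psi> (X j)) *\<^sub>R real_emb (X j)) = 0" by blast
    then show False by (simp add: linear_diff[OF lin] linear_scale[OF lin] \<mu> \<theta>)
  qed
  then obtain \<theta> where "unimodular \<theta>" "halfspace_cone \<psi> = halfspace_cone \<theta>"
    using unimodular_if_rational[OF \<psi> j(2)] by blast
  then show thesis using that cone by metis
qed

text \<open>
  The projection \<open>y \<mapsto> y - \<nu> y \<cdot> e\<close> onto the kernel of the extended form \<open>\<nu>\<close> sends lattice vectors to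
  lattice vectors, because \<open>\<psi>\<close> is integer valued. Hence the kernel is spanned by lattice
  vectors.
\<close>

lemma flag_if_halfspace:
  fixes \<psi> :: "'m \<Rightarrow> real"
  assumes "unimodular \<psi>"
  obtains H Hp K where "is_flag 1 H Hp" "H 1 = UNIV \<times> K" "rational_hyperplane K"
    "{(r, u). (r, real_emb u) \<in> flag_set 1 H Hp} = halfspace_cone \<psi>"
proof -
  obtain e where \<psi>: "Modules.additive \<psi>" and ints: "\<And>u. \<psi> u \<in> \<int>" and e: "\<psi> e = 1"
    using assms by (auto simp: unimodular_def)
  define \<nu> where "\<nu> = extend_linearly \<psi>"
  have lin: "linear \<nu>" unfolding \<nu>_def by (rule linear_extend_linearly)
  have emb: "\<nu> (real_emb u) = \<psi> u" for u
    using extend_linearly_real_emb[OF \<psi>] by (simp add: \<nu>_def)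
  define K where "K = {x. \<nu> x = 0}"
  define H :: "nat \<Rightarrow> (real \<times> 'm real_ext) set" where "H i = (if i = 0 then UNIV else UNIV \<times> K)" for i
  define Hp :: "nat \<Rightarrow> (real \<times> 'm real_ext) set" where "Hp i = {x. \<nu> (snd x) > 0}" for i
  have subK: "subspace K" unfolding K_def by (rule linear_subspace_kernel[OF lin])
  have lin2: "linear (\<lambda>x :: real \<times> 'm real_ext. \<nu> (snd x))"
    by (rule linearI) (simp_all add: linear_add[OF lin] linear_scale[OF lin])
  have H1: "UNIV \<times> K = {x. \<nu> (snd x) = 0}" by (auto simp: K_def)
  have subH: "subspace (UNIV \<times> K :: (real \<times> 'm real_ext) set)"
    unfolding H1 by (rule linear_subspace_kernel[OF lin2])
  let ?S = "insert (1, 0) ((\<lambda>i. (0, real_emb (X i))) ` {1..n}) :: (real \<times> 'm real_ext) set"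
  have "(r, x) \<in> span ?S" for r x
  proof -
    have lin0: "linear (\<lambda>x :: 'm real_ext. (0 :: real, x))"
      by (rule linearI) auto
    have "(0 :: real, x) \<in> (\<lambda>x. (0, x)) ` span ((\<lambda>i. real_emb (X i)) ` {1..n})"
      unfolding span_real_emb_basis by (rule imageI) (rule UNIV_I)
    also have "\<dots> = span ((\<lambda>x. (0, x)) ` (\<lambda>i. real_emb (X i)) ` {1..n})"
      by (rule linear_span_image[OF lin0, symmetric])
    also have "\<dots> \<subseteq> span ?S"
      by (rule span_mono) auto
    finally have "(0, x) \<in> span ?S" .
    moreover have "r *\<^sub>R (1, 0) \<in> span ?S" by (intro span_scale span_base) simp
    ultimately have "r *\<^sub>R (1, 0) + (0, x) \<in> span ?S" using span_add by blast
    then show ?thesis by simp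
  qed
  then have spanS: "span ?S = UNIV" by auto
  have dim1: "dim (UNIV :: 'm real_ext set) = dim K + 1"
    unfolding K_def using span_real_emb_basis e
    by (intro dim_kernel[of "(\<lambda>i. real_emb (X i)) ` {1..n}" _ "real_emb e"] lin) (auto simp: emb)
  have dim2: "dim (UNIV :: (real \<times> 'm real_ext) set) = dim (UNIV \<times> K :: (real \<times> 'm real_ext) set) + 1"
    unfolding H1 using spanS e
    by (intro dim_kernel[of ?S _ "(0, real_emb e)"] lin2) (auto simp: emb)
  have "K = span (real_emb ` {u. \<psi> u = 0})"
  proof
    show "span (real_emb ` {u. \<psi> u = 0}) \<subseteq> K"
      by (intro span_minimal subK) (auto simp: K_def emb)
    show "K \<subseteq> span (real_emb ` {u. \<psi> u = 0})"
    proof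
      fix x assume x: "x \<in> K"
      define p where "p y = y - \<nu> y *\<^sub>R real_emb e" for y
      have "linear p"
        unfolding p_def
        by (rule linearI) (simp_all add: linear_add[OF lin] linear_scale[OF lin] algebra_simps)
      then have "p x \<in> span (p ` (\<lambda>i. real_emb (X i)) ` {1..n})"
        by (simp only: linear_span_image span_real_emb_basis rangeI)
      moreover have "p (real_emb u) \<in> real_emb ` {u. \<psi> u = 0}" for u
      proof -
        have u: "of_int \<lfloor>\<psi> u\<rfloor> = \<psi> u" using ints[of u] by (auto elim: Ints_cases)
        then have "p (real_emb u) = real_emb (u - int_multiple \<lfloor>\<psi> u\<rfloor> e)"
          by (simp only: p_def emb additive.diff[OF additive_real_emb]
              additive_int_multiple[OF additive_real_emb] int_multiple_real_vector)
        moreover have "\<psi> (u - int_multiple \<lfloor>\<psi> u\<rfloor> e) = 0"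
          by (simp only: additive.diff[OF \<psi>] additive_real_int_multiple[OF \<psi>] u e mult_1_right diff_self)
        ultimately show ?thesis by blast
      qed
      then have "p ` (\<lambda>i. real_emb (X i)) ` {1..n} \<subseteq> real_emb ` {u. \<psi> u = 0}" by blast
      ultimately have "p x \<in> span (real_emb ` {u. \<psi> u = 0})" using span_mono by blast
      then show "x \<in> span (real_emb ` {u. \<psi> u = 0})" using x by (simp add: p_def K_def)
    qed
  qed
  then have rat: "rational_hyperplane K"
    using subK dim1 by (auto simp: rational_hyperplane_def linear_hyperplane_def)
  have cone: "{(r, u). (r, real_emb u) \<in> flag_set 1 H Hp} = halfspace_cone \<psi>"
    by (auto simp: flag_set_def H_def Hp_def K_def emb halfspace_cone_def)
  have "real_emb e \<notin> K" using e by (simp add: K_def emb)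
  then have "UNIV \<times> K \<subset> (UNIV :: (real \<times> 'm real_ext) set)" by auto
  moreover have "orientation UNIV (UNIV \<times> K) {x :: real \<times> 'm real_ext. \<nu> (snd x) > 0}"
    unfolding orientation_def using lin2 H1 by (intro exI[of _ "\<lambda>x. \<nu> (snd x)"]) auto
  moreover have "{0..} \<times> {0} \<subseteq> flag_set 1 H Hp"
    by (auto simp: flag_set_def H_def K_def linear_0[OF lin])
  ultimately have "is_flag 1 H Hp"
    using subH dim2 by (auto simp: is_flag_def H_def Hp_def span_lattice_points linear_hyperplane_def)
  then show thesis using that[of H Hp K] rat cone by (simp add: H_def)
qed

end

section \<open>Chains of prime congruences\<close>

definition prime_chain :: "nat \<Rightarrow> (nat \<Rightarrow> ('a::comm_semiring_1 \<times> 'a) set) \<Rightarrow> bool" where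
  "prime_chain l Q \<longleftrightarrow> (\<forall>i\<le>l. prime_congruence (Q i)) \<and> (\<forall>i<l. Q i \<subset> Q (Suc i))"

lemma height_ge: "prime_chain l Q \<Longrightarrow> Q l = P \<Longrightarrow> enat l \<le> height P"
  unfolding height_def prime_chain_def by (intro Sup_upper) blast

lemma height_le: "(\<And>l Q. prime_chain l Q \<Longrightarrow> Q l = P \<Longrightarrow> l \<le> m) \<Longrightarrow> height P \<le> enat m"
  unfolding height_def prime_chain_def by (intro Sup_least) auto

lemma coheight_ge: "prime_chain l Q \<Longrightarrow> Q 0 = P \<Longrightarrow> enat l \<le> coheight P"
  unfolding coheight_def prime_chain_def by (intro Sup_upper) blast

lemma coheight_le: "(\<And>l Q. prime_chain l Q \<Longrightarrow> Q 0 = P \<Longrightarrow> l \<le> m) \<Longrightarrow> coheight P \<le> enat m"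
  unfolding coheight_def prime_chain_def by (intro Sup_least) auto

lemma cone_UNIV: "cone UNIV" "is_total UNIV"
  by (auto simp: cone_def submonoid_def is_total_def)

lemma prime_maximum: "prime_congruence (maximum_congruence :: ('m::ab_group_add laurent \<times> _) set)"
  using prime_cone_congruence[OF cone_UNIV] by (simp add: cone_congruence_UNIV)

lemma L_set_maximum: "L_set maximum_congruence = UNIV"
  using L_set_cone_congruence[OF cone_UNIV(1)] by (simp add: cone_congruence_UNIV)

lemma maximum_iff:
  assumes "prime_congruence P"
  shows "P = maximum_congruence \<longleftrightarrow> L_set P = UNIV"
  using prime_eq_cone_congruence[OF assms] cone_congruence_UNIV L_set_maximum by metis

lemma prime_subset_maximum: "prime_congruence P \<Longrightarrow> P \<subseteq> maximum_congruence"
  by (simp add: prime_subset_iff prime_maximum L_set_maximum)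

lemma prime_cone: "prime_congruence P \<Longrightarrow> cone (L_set P)"
  by (simp add: prime_congruence_def cone_L_set)

lemma prime_psubset_iff:
  assumes "prime_congruence P" "prime_congruence Q"
  shows "P \<subset> Q \<longleftrightarrow> L_set P \<subset> L_set Q"
  using prime_subset_iff[OF assms] prime_subset_iff[OF assms(2,1)] by blast

section \<open>Coheight\<close>

lemma coheight_maximum: "coheight (maximum_congruence :: ('m::ab_group_add laurent \<times> _) set) = 0"
proof -
  have "coheight (maximum_congruence :: ('m laurent \<times> _) set) \<le> enat 0"
  proof (rule coheight_le, rule ccontr)
    fix l :: nat and Q :: "nat \<Rightarrow> ('m laurent \<times> 'm laurent) set"
    assume Q: "prime_chain l Q" "Q 0 = maximum_congruence" and "\<not> l \<le> 0"
    then have "Q 0 \<subset> Q 1" "prime_congruence (Q 1)" by (auto simp: prime_chain_def)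
    then show False using prime_subset_maximum Q(2) by blast
  qed
  then show ?thesis by (simp flip: zero_enat_def)
qed

lemma coheight_ge_1:
  assumes "prime_congruence P" "P \<noteq> maximum_congruence"
  shows "1 \<le> coheight P"
proof -
  have "P \<subset> maximum_congruence" using prime_subset_maximum[OF assms(1)] assms(2) by blast
  then have "prime_chain 1 (\<lambda>i. if i = 0 then P else maximum_congruence)"
    using assms(1) prime_maximum by (auto simp: prime_chain_def)
  from coheight_ge[OF this] show ?thesis by (simp add: one_enat_def)
qed

text \<open>
  Subtracting multiples of an element with \<open>\<phi> x < 0\<close> moves any element into the half-space.
\<close>

lemma halfspace_maximal:
  fixes \<phi> :: "'g::ab_group_add \<Rightarrow> real"
  assumes \<phi>: "Modules.additive \<phi>" and L: "submonoid L" "{x. \<phi> x \<ge> 0} \<subset> L"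
  shows "L = UNIV"
proof -
  obtain x where x: "x \<in> L" "\<phi> x < 0" using L(2) by force
  have "z \<in> L" for z
  proof -
    have "\<exists>k. - \<phi> z < real k * (- \<phi> x)"
      using reals_Archimedean3[of "- \<phi> x"] x(2) by (metis neg_0_less_iff_less)
    then obtain k :: nat where k: "- \<phi> z < real k * (- \<phi> x)" by blast
    have "\<phi> (z - int_multiple (int k) x) \<ge> 0"
      using k by (simp add: additive.diff[OF \<phi>] additive_real_int_multiple[OF \<phi>])
    then have "z - int_multiple (int k) x \<in> L" using L(2) by blast
    moreover have "int_multiple (int k) x \<in> L" using L(1) x(1) by (rule submonoid_int_multiple) simp
    ultimately have "(z - int_multiple (int k) x) + int_multiple (int k) x \<in> L"
      by (rule submonoid_add[OF L(1)])
    then show ?thesis by simp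
  qed
  then show ?thesis by auto
qed

lemma coheight_halfspace:
  fixes P :: "('m::ab_group_add laurent \<times> 'm laurent) set"
  assumes P: "prime_congruence P" and \<phi>: "Modules.additive \<phi>" "\<phi> x \<noteq> 0"
    and L: "L_set P = {x. \<phi> x \<ge> (0 :: real)}"
  shows "coheight P = 1"
proof (rule antisym)
  show "coheight P \<le> 1"
    unfolding one_enat_def
  proof (rule coheight_le, rule ccontr)
    fix l :: nat and Q :: "nat \<Rightarrow> ('m laurent \<times> 'm laurent) set"
    assume Q: "prime_chain l Q" "Q 0 = P" and "\<not> l \<le> 1"
    then have *: "Q 0 \<subset> Q 1" "Q 1 \<subset> Q 2" and prime: "prime_congruence (Q 1)" "prime_congruence (Q 2)"
      by (auto simp: prime_chain_def numeral_2_eq_2)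
    then have "{x. \<phi> x \<ge> 0} \<subset> L_set (Q 1)" using prime_psubset_iff P Q(2) L by metis
    moreover have "submonoid (L_set (Q 1))"
      using prime cone_L_set by (auto simp: prime_congruence_def cone_def)
    ultimately have "L_set (Q 1) = UNIV" using halfspace_maximal[OF \<phi>(1)] by blast
    then have "Q 1 = maximum_congruence" using maximum_iff prime by blast
    then show False using * prime_subset_maximum prime by blast
  qed
  have "\<not> (\<phi> x \<ge> 0 \<and> \<phi> (- x) \<ge> 0)" using \<phi>(2) additive.minus[OF \<phi>(1), of x] by auto
  then have "L_set P \<noteq> UNIV" unfolding L by blast
  then show "1 \<le> coheight P" using coheight_ge_1[OF P] maximum_iff[OF P] by blast
qed

text \<open>
  Suppose that no multiple of \<open>y\<close> bounds \<open>x\<close>. Making \<open>- y\<close> nonnegative enlarges the cone to \<open>N\<close>, which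
  still does not contain \<open>- x\<close>. So \<open>N\<close> lies strictly between the cone and the whole group.
\<close>

lemma archimedean_if_coheight_1:
  fixes P :: "('m::ab_group_add laurent \<times> 'm laurent) set"
  assumes P: "prime_congruence P" and co: "coheight P = 1"
  shows "archimedean (L_set P)"
proof (rule ccontr)
  let ?L = "L_set P"
  assume "\<not> archimedean ?L"
  then obtain y x where y: "y \<in> ?L" "- y \<notin> ?L" and x: "\<And>k. int_multiple k y - x \<notin> ?L"
    unfolding archimedean_def by blast
  have L: "cone ?L" "is_total ?L"
    using P cone_L_set prime_total by (auto simp: prime_congruence_def)
  define N where "N = {z. \<exists>k\<ge>0. z + int_multiple k y \<in> ?L}"
  have LN: "?L \<subseteq> N" unfolding N_def by (force intro: exI[of _ 0])
  have "z + w \<in> N" if zw: "z \<in> N" "w \<in> N" for z w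
  proof -
    obtain k m where km: "k \<ge> 0" "m \<ge> 0" "z + int_multiple k y \<in> ?L" "w + int_multiple m y \<in> ?L"
      using zw unfolding N_def by blast
    have eq: "(z + int_multiple k y) + (w + int_multiple m y) = (z + w) + int_multiple (k + m) y"
      by (simp only: int_mod.scale_left_distrib add_ac)
    have "(z + w) + int_multiple (k + m) y \<in> ?L" using cone_add[OF L(1) km(3,4)] unfolding eq .
    moreover have "k + m \<ge> 0" using km by simp
    ultimately show ?thesis unfolding N_def by blast
  qed
  then have N: "cone N" "is_total N"
    using L LN cone_zero[OF L(1)] unfolding cone_def submonoid_def is_total_def by blast+
  have "- y \<in> N"
    unfolding N_def using cone_zero[OF L(1)] by (auto intro!: exI[of _ 1])
  then have "?L \<subset> N" using LN y by blast
  moreover have "- x \<notin> N" unfolding N_def using x by (auto simp: add.commute)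
  then have "N \<subset> UNIV" by blast
  ultimately have "P \<subset> cone_congruence N" "cone_congruence N \<subset> maximum_congruence"
    by (simp_all add: prime_psubset_iff P prime_cone_congruence N prime_maximum
        L_set_cone_congruence L_set_maximum)
  then have "prime_chain 2 (\<lambda>i. if i = 0 then P else if i = 1 then cone_congruence N else maximum_congruence)"
    using P prime_cone_congruence[OF N] prime_maximum by (auto simp: prime_chain_def less_2_cases_iff)
  from coheight_ge[OF this] have "enat 2 \<le> coheight P" by simp
  then show False unfolding co one_enat_def by simp
qed

section \<open>Rank\<close>

lemma rat_basis:
  assumes "finite W" "T \<subseteq> rat.span W"
  obtains B where "B \<subseteq> T" "rat.independent B" "T \<subseteq> rat.span B" "card B = rat.dim T" "finite B"
proof -
  obtain B where B: "B \<subseteq> T" "rat.independent B" "T \<subseteq> rat.span B" "card B = rat.dim T"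
    using rat.basis_exists[of T] by blast
  moreover have "finite B" using rat.independent_span_bound[OF assms(1) B(2)] B(1) assms(2) by blast
  ultimately show thesis by (rule that)
qed

lemma rat_dim_mono:
  assumes "finite W" "T \<subseteq> rat.span W" "S \<subseteq> T"
  shows "rat.dim S \<le> rat.dim T"
proof -
  obtain B where "B \<subseteq> T" "rat.independent B" "T \<subseteq> rat.span B" "card B = rat.dim T" "finite B"
    using rat_basis[OF assms(1,2)] by blast
  then show ?thesis using rat.dim_le_card[of S B] assms(3) by simp
qed

lemma rat_dim_strict_mono:
  assumes W: "finite W" "T \<subseteq> rat.span W" and S: "S \<subseteq> T" "x \<in> T" "x \<notin> rat.span S"
  shows "rat.dim S < rat.dim T"
proof -
  obtain B where B: "B \<subseteq> T" "rat.independent B" "T \<subseteq> rat.span B" "card B = rat.dim T" "finite B"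
    using rat_basis[OF W] by blast
  obtain C where C: "C \<subseteq> S" "rat.independent C" "S \<subseteq> rat.span C" "card C = rat.dim S" "finite C"
    using rat_basis[OF W(1) order_trans[OF S(1) W(2)]] by blast
  have "x \<notin> rat.span C" using S(3) rat.span_mono[OF C(1)] by blast
  then have "rat.independent (insert x C)" "x \<notin> C"
    using C(2) rat.span_base by (auto simp: rat.independent_insert)
  moreover have "insert x C \<subseteq> rat.span B" using B(3) C(1) S by blast
  ultimately have "card (insert x C) \<le> card B"
    using rat.independent_span_bound[OF B(5)] by blast
  then show ?thesis using \<open>x \<notin> C\<close> C B by simp
qed

text \<open>
  The group of units of the monoid \<open>L\<close>, that is, the elements equivalent to \<open>0\<close> in the preorder.
\<close>

definition lineality :: "'g::ab_group_add set \<Rightarrow> 'g set" where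
  "lineality L = {x. x \<in> L \<and> - x \<in> L}"

lemma lineality_subspace:
  assumes "submonoid L"
  shows "int_mod.subspace (lineality L)"
proof (rule int_mod.subspaceI)
  show "0 \<in> lineality L" using submonoid_zero[OF assms] by (simp add: lineality_def)
  show "x + y \<in> lineality L" if "x \<in> lineality L" "y \<in> lineality L" for x y
    using that submonoid_add[OF assms] submonoid_add[OF assms, of "- x" "- y"] by (simp add: lineality_def)
  show "int_multiple k x \<in> lineality L" if x: "x \<in> lineality L" for k x
  proof (cases "k \<ge> 0")
    case True
    then show ?thesis
      using x submonoid_int_multiple[OF assms, of x k] submonoid_int_multiple[OF assms, of "- x" k]
      by (simp add: lineality_def)
  next
    case False
    then show ?thesis
      using x submonoid_int_multiple[OF assms, of x "- k"] submonoid_int_multiple[OF assms, of "- x" "- k"]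
      by (simp add: lineality_def)
  qed
qed

lemma lineality_pure:
  assumes L: "submonoid L" "is_total L" and k: "k > 0" "int_multiple k x \<in> lineality L"
  shows "x \<in> lineality L"
proof -
  have *: "x \<in> L" if "int_multiple k x \<in> L" for x
  proof (rule ccontr)
    assume "x \<notin> L"
    then have "- x \<in> L" using L(2) by (auto simp: is_total_def)
    then have "int_multiple (k - 1) (- x) \<in> L" using k by (intro submonoid_int_multiple[OF L(1)]) auto
    from submonoid_add[OF L(1) that this] have "x \<in> L"
      by (simp add: int_mod.scale_left_diff_distrib)
    then show False using \<open>x \<notin> L\<close> by simp
  qed
  show ?thesis using k(2) *[of x] *[of "- x"] by (simp add: lineality_def)
qed

context free_abelian
begin

lemma real_emb_eq_0: "real_emb u = 0 \<longleftrightarrow> u = (0 :: 'm)"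
proof
  assume u: "real_emb u = 0"
  have "real_of_int (coord u i) = 0" for i
    using extend_linearly_real_emb[OF additive_coord, of i u]
    unfolding u linear_0[OF linear_extend_linearly] by simp
  then show "u = 0" using coord_expand[of u] by simp
qed (simp add: additive.zero[OF additive_real_emb])

lemma rat_span_real_emb: "range real_emb \<subseteq> rat.span ((\<lambda>i. real_emb (X i)) ` {1..n})"
proof clarify
  fix u :: 'm
  have "real_emb u = (\<Sum>i=1..n. rat_scale (of_int (coord u i)) (real_emb (X i)))"
    by (simp add: additive_expand[OF additive_real_emb, of u] int_multiple_real_vector rat_scale_def)
  then show "real_emb u \<in> rat.span ((\<lambda>i. real_emb (X i)) ` {1..n})"
    by (simp only:) (intro rat.span_sum rat.span_scale rat.span_base imageI)
qed

text \<open>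
  A rational linear combination of elements of \<open>A\<close> becomes an element of \<open>A\<close> after clearing
  denominators, and \<open>real_emb\<close> is injective on a free group.
\<close>

lemma in_rat_span_subgroup:
  assumes A: "int_mod.subspace A" and u: "real_emb u \<in> rat.span (real_emb ` A)"
  shows "\<exists>k>0. int_multiple k u \<in> (A :: 'm set)"
proof -
  let ?V = "{z. \<exists>k>0 :: int. \<exists>g\<in>A. of_int k *\<^sub>R z = real_emb g}"
  have "rat.subspace ?V"
  proof (rule rat.subspaceI)
    show "0 \<in> ?V"
      using int_mod.subspace_0[OF A]
      by (auto intro!: exI[of _ 1] bexI[of _ 0] simp: additive.zero[OF additive_real_emb])
  next
    fix z w assume "z \<in> ?V" "w \<in> ?V"
    then obtain k g m h where *: "k > 0" "g \<in> A" "of_int k *\<^sub>R z = real_emb g"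
      "m > 0" "h \<in> A" "of_int m *\<^sub>R w = real_emb h" by blast
    have "of_int (k * m) *\<^sub>R (z + w) = of_int m *\<^sub>R (of_int k *\<^sub>R z) + of_int k *\<^sub>R (of_int m *\<^sub>R w)"
      by (simp add: scaleR_add_right mult.commute)
    also have "\<dots> = real_emb (int_multiple m g + int_multiple k h)"
      by (simp add: * real_emb_add additive_int_multiple[OF additive_real_emb] int_multiple_real_vector)
    finally have "of_int (k * m) *\<^sub>R (z + w) = real_emb (int_multiple m g + int_multiple k h)" .
    moreover have "int_multiple m g + int_multiple k h \<in> A"
      using * by (intro int_mod.subspace_add[OF A] int_mod.subspace_scale[OF A])
    moreover have "k * m > 0" using * by simp
    ultimately show "z + w \<in> ?V" by blast
  next
    fix q :: rat and z :: "'m real_ext" assume "z \<in> ?V"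
    then obtain k g where *: "k > 0" "g \<in> A" "of_int k *\<^sub>R z = real_emb g" by blast
    obtain a b :: int where ab: "quotient_of q = (a, b)" by (cases "quotient_of q")
    have q: "q = of_int a / of_int b" "b > 0"
      using quotient_of_div[OF ab] quotient_of_denom_pos[OF ab] by auto
    have "of_int (k * b) *\<^sub>R rat_scale q z = of_int a *\<^sub>R (of_int k *\<^sub>R z)"
      using q(2) by (simp add: rat_scale_def q(1) of_rat_divide)
    also have "\<dots> = real_emb (int_multiple a g)"
      by (simp add: * additive_int_multiple[OF additive_real_emb] int_multiple_real_vector)
    finally have "of_int (k * b) *\<^sub>R rat_scale q z = real_emb (int_multiple a g)" .
    moreover have "int_multiple a g \<in> A" using * by (intro int_mod.subspace_scale[OF A])
    moreover have "k * b > 0" using * q by simp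
    ultimately show "rat_scale q z \<in> ?V" by blast
  qed
  moreover have "real_emb ` A \<subseteq> ?V"
    by (auto intro!: exI[of _ 1])
  ultimately have "rat.span (real_emb ` A) \<subseteq> ?V" by (intro rat.span_minimal)
  then obtain k g where *: "k > 0" "g \<in> A" "of_int k *\<^sub>R real_emb u = real_emb g" using u by blast
  then have "real_emb (int_multiple k u - g) = 0"
    by (simp add: additive.diff[OF additive_real_emb] additive_int_multiple[OF additive_real_emb]
        int_multiple_real_vector)
  then have "int_multiple k u = g" by (simp add: real_emb_eq_0)
  then show ?thesis using * by blast
qed

definition rank :: "'m set \<Rightarrow> nat" where
  "rank A = rat.dim (real_emb ` A)"

lemma rank_le: "rank A \<le> n"
proof -
  have "rank A \<le> card ((\<lambda>i. real_emb (X i)) ` {1..n})"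
    unfolding rank_def by (rule rat.dim_le_card) (use rat_span_real_emb in auto)
  also have "\<dots> \<le> n" using card_image_le[of "{1..n}"] by simp
  finally show ?thesis .
qed

lemma finite_basis: "finite ((\<lambda>i. real_emb (X i)) ` {1..n})"
  by simp

lemma real_emb_subset_span: "real_emb ` A \<subseteq> rat.span ((\<lambda>i. real_emb (X i)) ` {1..n})"
  using rat_span_real_emb by blast

lemma rank_mono: "A \<subseteq> B \<Longrightarrow> rank A \<le> rank B"
  unfolding rank_def by (rule rat_dim_mono[OF finite_basis real_emb_subset_span]) blast

lemma rank_strict_mono:
  assumes "int_mod.subspace A" "A \<subseteq> B" "u \<in> B" "\<And>k. k > 0 \<Longrightarrow> int_multiple k u \<notin> A"
  shows "rank A < rank B"
  unfolding rank_def
  by (rule rat_dim_strict_mono[OF finite_basis real_emb_subset_span, of _ _ "real_emb u"])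
     (use assms in_rat_span_subgroup in blast)+

text \<open>
  The group of units has infinite rational rank when it contains the constants, which are
  real numbers. It is therefore measured by its projection to \<open>M\<close>, with the constants counted once.
\<close>

definition cone_rank :: "(real \<times> 'm) set \<Rightarrow> nat" where
  "cone_rank L = rank (snd ` lineality L) + (if (- 1, 0) \<in> L then 1 else 0)"

lemma snd_lineality_subspace:
  assumes "submonoid (L :: (real \<times> 'm) set)"
  shows "int_mod.subspace (snd ` lineality L)"
proof (rule int_mod.subspaceI)
  note sub = lineality_subspace[OF assms]
  show "0 \<in> snd ` lineality L" using int_mod.subspace_0[OF sub] by force
  show "x + y \<in> snd ` lineality L" if "x \<in> snd ` lineality L" "y \<in> snd ` lineality L" for x y
    using that int_mod.subspace_add[OF sub] by (metis (no_types, lifting) imageE image_eqI snd_add)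
  show "int_multiple k x \<in> snd ` lineality L" if x: "x \<in> snd ` lineality L" for k x
  proof -
    obtain r where "(r, x) \<in> lineality L" using x by force
    then have "int_multiple k (r, x) \<in> lineality L" by (rule int_mod.subspace_scale[OF sub])
    then show ?thesis by (force simp: int_multiple_pair)
  qed
qed

text \<open>
  An element \<open>x\<close> of \<open>N\<close> outside \<open>L\<close> is a unit of \<open>N\<close>, since \<open>L\<close> is total. If the rank of the projection
  did not grow, some multiple \<open>k x\<close> would agree with a unit \<open>g\<close> of \<open>L\<close> up to a constant. When the
  constants have the same status in both cones, this constant is a unit of \<open>L\<close> (possibly \<open>0\<close>), and
  purity puts \<open>x\<close> into \<open>L\<close>. When only \<open>N\<close> has negative constants, the second summand grows.
\<close>

lemma cone_rank_strict_mono: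
  fixes L N :: "(real \<times> 'm) set"
  assumes L: "cone L" "is_total L" and N: "cone N" and LN: "L \<subset> N"
  shows "cone_rank L < cone_rank N"
proof -
  have subL: "submonoid L" and subN: "submonoid N" using L N by (auto simp: cone_def)
  obtain x where x: "x \<in> N" "x \<notin> L" using LN by blast
  then have "- x \<in> L" using L(2) unfolding is_total_def by blast
  then have xN: "x \<in> lineality N" using x(1) LN unfolding lineality_def by blast
  have sub: "snd ` lineality L \<subseteq> snd ` lineality N" using LN by (auto simp: lineality_def)
  have constants: "(s, 0) \<in> K" if "cone K" "(- 1, 0) \<in> K" for s and K :: "(real \<times> 'm) set"
    using that const_in_submonoid[of K s] by (auto simp: cone_def)
  show ?thesis
  proof (cases "(- 1, 0) \<in> L \<longleftrightarrow> (- 1, 0) \<in> N")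
    case True
    have "rank (snd ` lineality L) < rank (snd ` lineality N)"
    proof (rule rank_strict_mono[OF snd_lineality_subspace[OF subL] sub])
      show "snd x \<in> snd ` lineality N" using xN by blast
      fix k :: int assume k: "k > 0"
      show "int_multiple k (snd x) \<notin> snd ` lineality L"
      proof
        assume "int_multiple k (snd x) \<in> snd ` lineality L"
        then obtain g where g: "g \<in> lineality L" "snd g = int_multiple k (snd x)" by force
        define s where "s = of_int k * fst x - fst g"
        have kx: "int_multiple k x = g + (s, 0)"
          using g(2) int_multiple_pair[of k "fst x" "snd x"] by (intro prod_eqI) (auto simp: s_def)
        have "g \<in> lineality N" using g(1) LN by (auto simp: lineality_def)
        then have "int_multiple k x - g \<in> lineality N"
          by (intro int_mod.subspace_diff int_mod.subspace_scale lineality_subspace subN xN)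
        then have s: "(s, 0) \<in> N" "(- s, 0) \<in> N" by (auto simp: kx lineality_def)
        have "(s, 0) \<in> lineality L"
        proof (cases "(- 1, 0) \<in> L")
          case const: True
          show ?thesis using constants[OF L(1) const] by (simp add: lineality_def)
        next
          case False
          then have notN: "(- 1, 0) \<notin> N" using True by blast
          have "s = 0"
          proof (rule ccontr)
            assume "s \<noteq> 0"
            then obtain m :: nat where m: "1 < real m * \<bar>s\<bar>"
              using reals_Archimedean3[of "\<bar>s\<bar>"] by auto
            have "(- \<bar>s\<bar>, 0) \<in> N" using s by (cases "s \<ge> 0") auto
            then have "int_multiple (int m) (- \<bar>s\<bar>, 0) \<in> N"
              by (rule submonoid_int_multiple[OF subN]) simp
            moreover have "(real m * \<bar>s\<bar> - 1, 0) \<in> N" using m by (intro cone_const[OF N]) simp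
            ultimately have "int_multiple (int m) (- \<bar>s\<bar>, 0) + (real m * \<bar>s\<bar> - 1, 0) \<in> N"
              by (rule submonoid_add[OF subN])
            then show False using notN by (simp add: int_multiple_pair)
          qed
          then show ?thesis using cone_zero[OF L(1)] by (simp add: lineality_def flip: zero_prod_def)
        qed
        then have "int_multiple k x \<in> lineality L"
          unfolding kx by (intro int_mod.subspace_add[OF lineality_subspace[OF subL]] g(1))
        then have "x \<in> lineality L" by (rule lineality_pure[OF subL L(2) k])
        then show False using x by (simp add: lineality_def)
      qed
    qed
    then show ?thesis using True by (simp add: cone_rank_def)
  next
    case False
    then have "(- 1, 0) \<notin> L" "(- 1, 0) \<in> N" using LN by blast+
    then show ?thesis using rank_mono[OF sub] by (simp add: cone_rank_def)
  qed
qed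

lemma height_le_cone_rank:
  fixes P :: "('m laurent \<times> 'm laurent) set"
  assumes "prime_congruence P"
  shows "height P \<le> enat (cone_rank (L_set P))"
proof (rule height_le)
  fix l and Q :: "nat \<Rightarrow> ('m laurent \<times> 'm laurent) set"
  assume Q: "prime_chain l Q" "Q l = P"
  have "i \<le> cone_rank (L_set (Q i))" if "i \<le> l" for i
    using that
  proof (induction i)
    case (Suc i)
    have prime: "prime_congruence (Q i)" "prime_congruence (Q (Suc i))" "Q i \<subset> Q (Suc i)"
      using Q(1) Suc.prems by (auto simp: prime_chain_def)
    then have "cone_rank (L_set (Q i)) < cone_rank (L_set (Q (Suc i)))"
      using prime_psubset_iff[OF prime(1,2)]
      by (intro cone_rank_strict_mono prime_cone prime_total) auto
    then show ?case using Suc by simp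
  qed simp
  from this[of l] show "l \<le> cone_rank (L_set P)" using Q(2) by simp
qed

lemma cone_rank_le: "cone_rank L \<le> n + 1"
  using rank_le[of "snd ` lineality L"] by (simp add: cone_rank_def)

lemma cone_rank_evaluation:
  assumes "Modules.additive \<psi>"
  shows "cone_rank (evaluation_cone \<psi>) \<le> n"
  using rank_le additive.zero[OF assms] by (simp add: cone_rank_def evaluation_cone_def)

lemma kernel_subspace:
  assumes "Modules.additive (\<psi> :: 'm \<Rightarrow> real)"
  shows "int_mod.subspace {u. \<psi> u = 0}"
  by (rule int_mod.subspaceI)
     (simp_all add: additive.zero[OF assms] additive.add[OF assms] additive_real_int_multiple[OF assms])

lemma cone_rank_halfspace:
  assumes "Modules.additive \<psi>"
  shows "cone_rank (halfspace_cone \<psi>) = rank {u. \<psi> u = 0} + 1"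
proof -
  have "snd ` lineality (halfspace_cone \<psi>) = {u. \<psi> u = 0}"
    by (force simp: lineality_def halfspace_cone_def additive.minus[OF assms] image_iff)
  then show ?thesis
    using additive.zero[OF assms] by (simp add: cone_rank_def halfspace_cone_def)
qed

lemma rank_kernel_less:
  assumes "Modules.additive \<psi>" "\<psi> u \<noteq> (0 :: real)"
  shows "rank {u. \<psi> u = 0} < rank UNIV"
  by (rule rank_strict_mono[OF kernel_subspace[OF assms(1)], of _ u])
     (use assms in \<open>auto simp: additive_real_int_multiple\<close>)

text \<open>
  If the kernel has corank at most one, then \<open>u\<close> and the kernel together span everything rationally,
  and \<open>\<psi>\<close> takes only rational multiples of \<open>\<psi> u\<close> on this span.
\<close>

lemma rational_if_rank_kernel:
  assumes \<psi>: "Modules.additive \<psi>" "\<psi> u \<noteq> (0 :: real)" and rank: "n \<le> rank {u. \<psi> u = 0} + 1"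
  shows "\<psi> v / \<psi> u \<in> \<rat>"
proof -
  let ?K = "real_emb ` {u. \<psi> u = 0}"
  have "real_emb v \<in> rat.span (insert (real_emb u) ?K)"
  proof (rule ccontr)
    assume v: "real_emb v \<notin> rat.span (insert (real_emb u) ?K)"
    have "real_emb u \<notin> rat.span ?K"
      using in_rat_span_subgroup[OF kernel_subspace[OF \<psi>(1)], of u] \<psi>
      by (auto simp: additive_real_int_multiple)
    then have "rat.dim ?K < rat.dim (insert (real_emb u) ?K)"
      by (intro rat_dim_strict_mono[OF finite_basis, of _ _ "real_emb u"])
         (use rat_span_real_emb in auto)
    moreover have "rat.dim (insert (real_emb u) ?K) < rat.dim (range (real_emb :: 'm \<Rightarrow> _))"
      by (intro rat_dim_strict_mono[OF finite_basis rat_span_real_emb, of _ "real_emb v"])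
         (use v in auto)
    moreover have "rat.dim (range (real_emb :: 'm \<Rightarrow> _)) \<le> n"
      using rank_le[of UNIV] by (simp add: rank_def)
    ultimately show False using rank by (simp add: rank_def)
  qed
  moreover define \<nu> where "\<nu> = extend_linearly \<psi>"
  have lin: "linear \<nu>" unfolding \<nu>_def by (rule linear_extend_linearly)
  have emb: "\<nu> (real_emb w) = \<psi> w" for w
    using extend_linearly_real_emb[OF \<psi>(1)] by (simp add: \<nu>_def)
  let ?V = "{z. \<nu> z / \<psi> u \<in> \<rat>}"
  have "rat.subspace ?V"
    by (rule rat.subspaceI)
       (simp_all add: linear_0[OF lin] linear_add[OF lin] linear_scale[OF lin] rat_scale_def
          add_divide_distrib Rats_add Rats_mult flip: times_divide_eq_right)
  then have "rat.span (insert (real_emb u) ?K) \<subseteq> ?V"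
    using \<psi>(2) by (intro rat.span_minimal) (auto simp: emb)
  ultimately have "real_emb v \<in> ?V" by blast
  then show ?thesis by (simp add: emb)
qed

end

section \<open>Lexicographic cones\<close>

fun lex_cone :: "('g::ab_group_add \<Rightarrow> real) list \<Rightarrow> 'g set" where
  "lex_cone [] = UNIV"
| "lex_cone (f # fs) = {x. f x > 0 \<or> f x = 0 \<and> x \<in> lex_cone fs}"

text \<open>
  Nonnegativity on the constants ensures that lexicographic cones contain them.
\<close>

definition monotone_functional :: "(real \<times> 'm::ab_group_add \<Rightarrow> real) \<Rightarrow> bool" where
  "monotone_functional f \<longleftrightarrow> Modules.additive f \<and> (\<forall>r\<ge>0. f (r, 0) \<ge> 0)"

lemma cone_lex_cone:
  assumes "\<And>f. f \<in> set fs \<Longrightarrow> monotone_functional f"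
  shows "cone (lex_cone fs) \<and> is_total (lex_cone fs)"
  using assms
proof (induction fs)
  case Nil
  show ?case using cone_UNIV by simp
next
  case (Cons f fs)
  then have f: "Modules.additive f" "\<And>r. r \<ge> 0 \<Longrightarrow> f (r, 0) \<ge> 0"
    and IH: "cone (lex_cone fs)" "is_total (lex_cone fs)"
    by (auto simp: monotone_functional_def)
  note f_simps = additive.zero[OF f(1)] additive.add[OF f(1)] additive.minus[OF f(1)]
  have "0 \<in> lex_cone (f # fs)"
    using cone_zero[OF IH(1)] by (simp add: f_simps)
  moreover have "x + y \<in> lex_cone (f # fs)" if "x \<in> lex_cone (f # fs)" "y \<in> lex_cone (f # fs)" for x y
    using that cone_add[OF IH(1), of x y] by (auto simp: f_simps)
  moreover have "{0..} \<times> {0} \<subseteq> lex_cone (f # fs)"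
    using f(2) cone_const[OF IH(1)] by (auto simp: order_less_le)
  moreover have "is_total (lex_cone (f # fs))"
    unfolding is_total_def
  proof
    fix x
    consider "f x > 0" | "f x < 0" | "f x = 0" by linarith
    then show "x \<in> lex_cone (f # fs) \<or> - x \<in> lex_cone (f # fs)"
      using IH(2) unfolding is_total_def by cases (auto simp: f_simps simp del: split_paired_All)
  qed
  ultimately show ?case by (simp add: cone_def submonoid_def)
qed

lemma lex_cone_append_subset: "lex_cone (fs @ gs) \<subseteq> lex_cone fs"
  by (induction fs) auto

lemma lex_cone_append_psubset:
  assumes g: "Modules.additive g" and fs: "\<And>f. f \<in> set fs \<Longrightarrow> Modules.additive f"
    and x: "\<And>f. f \<in> set fs \<Longrightarrow> f x = 0" "g x \<noteq> 0"
  shows "lex_cone (fs @ [g]) \<subset> lex_cone fs"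
proof -
  obtain y where y: "\<And>f. f \<in> set fs \<Longrightarrow> f y = 0" "g y < 0"
  proof (cases "g x < 0")
    case True
    then show ?thesis using that x by blast
  next
    case False
    then have "g (- x) < 0" using x(2) additive.minus[OF g, of x] by simp
    moreover have "f (- x) = 0" if "f \<in> set fs" for f
      using additive.minus[OF fs[OF that], of x] x(1)[OF that] by simp
    ultimately show ?thesis by (rule that[rotated])
  qed
  have "y \<in> lex_cone (fs @ gs) \<longleftrightarrow> y \<in> lex_cone gs" for gs
    using y(1) by (induction fs) force+
  from this[of "[]"] this[of "[g]"] have "y \<in> lex_cone fs \<and> y \<notin> lex_cone (fs @ [g])"
    using y(2) by simp
  then show ?thesis using lex_cone_append_subset by blast
qed

text \<open>
  Dropping the last functional of the list enlarges the lexicographic cone strictly, as long as that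
  functional does not vanish on the common kernel of the preceding ones. This can be repeated
  until \<open>k\<close> functionals are left.
\<close>

lemma lex_cone_chain:
  fixes fs :: "(real \<times> 'm::ab_group_add \<Rightarrow> real) list"
  assumes fs: "\<And>f. f \<in> set fs \<Longrightarrow> monotone_functional f"
    and independent: "\<And>i. i < length fs \<Longrightarrow> \<exists>x. (\<forall>j<i. (fs ! j) x = 0) \<and> (fs ! i) x \<noteq> 0"
    and k: "k \<le> length fs"
  shows "enat (length fs - k) \<le> height (cone_congruence (lex_cone (take k fs)))"
proof (rule height_ge)
  define Q where "Q i = cone_congruence (lex_cone (take (length fs - i) fs))" for i
  have cone: "cone (lex_cone (take m fs))" "is_total (lex_cone (take m fs))" for m
    using cone_lex_cone[of "take m fs"] fs by (meson in_set_takeD)+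
  show "prime_chain (length fs - k) Q"
    unfolding prime_chain_def
  proof (intro conjI allI impI)
    show "prime_congruence (Q i)" for i
      unfolding Q_def by (rule prime_cone_congruence[OF cone])
    fix i assume i: "i < length fs - k"
    define m where "m = length fs - Suc i"
    have m: "m < length fs" "length fs - i = Suc m" using i by (auto simp: m_def)
    obtain x where x: "\<forall>j<m. (fs ! j) x = 0" "(fs ! m) x \<noteq> 0" using independent[OF m(1)] by blast
    have "lex_cone (take m fs @ [fs ! m]) \<subset> lex_cone (take m fs)"
    proof (rule lex_cone_append_psubset)
      show "Modules.additive (fs ! m)" using fs[of "fs ! m"] m by (simp add: monotone_functional_def)
      show "Modules.additive f" if "f \<in> set (take m fs)" for f
        using fs[OF in_set_takeD[OF that]] by (simp add: monotone_functional_def)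
      show "f x = 0" if "f \<in> set (take m fs)" for f
        using that x(1) m(1) by (auto simp: in_set_conv_nth)
      show "(fs ! m) x \<noteq> 0" by (rule x)
    qed
    then have "lex_cone (take (Suc m) fs) \<subset> lex_cone (take m fs)"
      using m by (simp add: take_Suc_conv_app_nth)
    then show "Q i \<subset> Q (Suc i)"
      unfolding Q_def m(2) m_def[symmetric]
      by (simp add: prime_psubset_iff prime_cone_congruence cone L_set_cone_congruence)
  qed
  show "Q (length fs - k) = cone_congruence (lex_cone (take k fs))"
    using k by (simp add: Q_def)
qed

section \<open>Heights of the three kinds of prime congruences\<close>

context free_abelian
begin

definition coordinate_functionals :: "nat list \<Rightarrow> (real \<times> 'm \<Rightarrow> real) list" where
  "coordinate_functionals is = map (\<lambda>i x. real_of_int (coord (snd x) i)) is"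

lemma monotone_coordinate: "f \<in> set (coordinate_functionals is) \<Longrightarrow> monotone_functional f"
proof -
  assume "f \<in> set (coordinate_functionals is)"
  then obtain i where f: "f = (\<lambda>x. real_of_int (coord (snd x) i))"
    by (auto simp: coordinate_functionals_def)
  have "coord 0 i = 0" using additive.zero[OF additive_coord, of i] by simp
  then show ?thesis
    unfolding monotone_functional_def Modules.additive_def f by (simp add: coord_add)
qed

text \<open>
  The evaluation cone is refined by comparing the \<open>n\<close> coordinates one after the other.
  Coarsening it to the whole group adds one more step, which settles the maximum congruence.
\<close>

lemma height_evaluation_ge:
  assumes \<psi>: "Modules.additive (\<psi> :: 'm \<Rightarrow> real)"
  shows "enat n \<le> height (cone_congruence (evaluation_cone \<psi>))"
    and "enat (n + 1) \<le> height (maximum_congruence :: ('m laurent \<times> _) set)"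
proof -
  define fs where "fs = (\<lambda>x. fst x + \<psi> (snd x)) # coordinate_functionals [1..<Suc n]"
  have len: "length fs = n + 1" by (simp add: fs_def coordinate_functionals_def)
  have "monotone_functional (\<lambda>x. fst x + \<psi> (snd x))"
    unfolding monotone_functional_def Modules.additive_def
    by (simp add: additive.add[OF \<psi>] additive.zero[OF \<psi>])
  then have mono: "monotone_functional f" if "f \<in> set fs" for f
    using that monotone_coordinate by (auto simp: fs_def)
  have nth: "(fs ! j) x = real_of_int (coord (snd x) j)" if "0 < j" "j \<le> n" for j x
    using that by (cases j) (simp_all add: fs_def coordinate_functionals_def del: upt_Suc)
  have indep: "\<exists>x. (\<forall>j<i. (fs ! j) x = 0) \<and> (fs ! i) x \<noteq> 0" if "i < length fs" for i
  proof (cases "i = 0")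
    case True
    then show ?thesis by (intro exI[of _ "(1, 0)"]) (simp add: fs_def additive.zero[OF \<psi>])
  next
    case False
    \<comment> \<open>the constant cancels the evaluation, and the other coordinates of \<open>X i\<close> vanish\<close>
    let ?x = "(- \<psi> (X i), X i)"
    have "(fs ! j) ?x = 0" if "j < i" for j
    proof (cases "j = 0")
      case True
      then show ?thesis by (simp add: fs_def)
    next
      case False
      then show ?thesis using that \<open>i < length fs\<close> by (simp add: nth len coord_basis)
    qed
    moreover have "(fs ! i) ?x \<noteq> 0" using False that by (simp add: nth len coord_basis)
    ultimately show ?thesis by blast
  qed
  have "lex_cone (take 1 fs) = evaluation_cone \<psi>"
    by (auto simp: fs_def evaluation_cone_def)
  then show "enat n \<le> height (cone_congruence (evaluation_cone \<psi>))"
    using lex_cone_chain[OF mono indep, of 1] len by simp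
  show "enat (n + 1) \<le> height (maximum_congruence :: ('m laurent \<times> _) set)"
    using lex_cone_chain[OF mono indep, of 0] len by (simp add: cone_congruence_UNIV)
qed

text \<open>
  Here the constants provide one step, but one coordinate \<open>p\<close> is determined by \<open>\<psi>\<close> and the others
  and has to be left out. The choice requires \<open>\<psi> (X p) \<noteq> 0\<close>.
\<close>

lemma height_halfspace_ge:
  assumes "unimodular (\<psi> :: 'm \<Rightarrow> real)"
  shows "enat n \<le> height (cone_congruence (halfspace_cone \<psi>))"
proof -
  obtain e where \<psi>: "Modules.additive \<psi>" and ints: "\<And>u. \<psi> u \<in> \<int>" and e: "\<psi> e = 1"
    using assms by (auto simp: unimodular_def)
  have "\<exists>p\<in>{1..n}. \<psi> (X p) \<noteq> 0"
  proof (rule ccontr)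
    assume "\<not> (\<exists>p\<in>{1..n}. \<psi> (X p) \<noteq> 0)"
    then have "\<psi> e = 0" using additive_expand[OF \<psi>, of e] by simp
    then show False using e by simp
  qed
  then obtain p where p: "p \<in> {1..n}" "\<psi> (X p) \<noteq> 0" by blast
  define ps where "ps = filter (\<lambda>i. i \<noteq> p) [1..<Suc n]"
  have set_ps: "set ps = {1..n} - {p}" by (auto simp: ps_def)
  have dist: "distinct ps" by (simp add: ps_def)
  have len_ps: "Suc (length ps) = n"
  proof -
    have "length ps = n - 1" using distinct_card[OF dist] p by (simp add: set_ps)
    then show ?thesis using p by simp
  qed
  define fs where "fs = (\<lambda>x. \<psi> (snd x)) # fst # coordinate_functionals ps"
  have len: "length fs = n + 1" using len_ps by (simp add: fs_def coordinate_functionals_def)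
  have "monotone_functional (\<lambda>x. \<psi> (snd x))" "monotone_functional (fst :: real \<times> 'm \<Rightarrow> real)"
    unfolding monotone_functional_def Modules.additive_def
    by (simp_all add: additive.add[OF \<psi>] additive.zero[OF \<psi>])
  then have mono: "monotone_functional f" if "f \<in> set fs" for f
    using that monotone_coordinate by (auto simp: fs_def)
  have nth: "(fs ! Suc (Suc j)) x = real_of_int (coord (snd x) (ps ! j))" if "j < length ps" for j x
    using that by (simp add: fs_def coordinate_functionals_def)
  have indep: "\<exists>x. (\<forall>j<i. (fs ! j) x = 0) \<and> (fs ! i) x \<noteq> 0" if i: "i < length fs" for i
  proof -
    consider "i = 0" | "i = 1" | m where "i = Suc (Suc m)" "m < length ps"
      using i len len_ps by (cases i; cases "i - 1") auto
    then show ?thesis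
    proof cases
      case 1
      then show ?thesis using e by (intro exI[of _ "(0, e)"]) (simp add: fs_def)
    next
      case 2
      then show ?thesis by (intro exI[of _ "(1, 0)"]) (simp add: fs_def additive.zero[OF \<psi>])
    next
      case (3 m)
      let ?i = "ps ! m"
      have i_ps: "?i \<in> {1..n}" "?i \<noteq> p" using nth_mem[OF 3(2)] set_ps by auto
      define a b where "a = \<lfloor>\<psi> (X p)\<rfloor>" and "b = \<lfloor>\<psi> (X ?i)\<rfloor>"
      have ab: "of_int a = \<psi> (X p)" "of_int b = \<psi> (X ?i)"
        using ints[of "X p"] ints[of "X ?i"] by (auto simp: a_def b_def elim!: Ints_cases)
      \<comment> \<open>an integral combination in the kernel of \<open>\<psi>\<close> that involves only the coordinates \<open>?i\<close> and \<open>p\<close>\<close>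
      define w where "w = int_multiple a (X ?i) - int_multiple b (X p)"
      have "\<psi> w = 0"
        by (simp add: w_def additive.diff[OF \<psi>] additive_real_int_multiple[OF \<psi>] ab)
      have coord_w: "real_of_int (coord w q) = of_int a * of_int (coord (X ?i) q) - of_int b * of_int (coord (X p) q)" for q
        by (simp add: w_def additive.diff[OF additive_coord] additive_real_int_multiple[OF additive_coord])
      have "(fs ! j) (0, w) = 0" if j: "j < i" for j
      proof -
        consider "j = 0" | "j = 1" | l where "j = Suc (Suc l)" "l < m"
          using j 3 by (cases j; cases "j - 1") auto
        then show ?thesis
        proof cases
          case 1
          then show ?thesis using \<open>\<psi> w = 0\<close> by (simp add: fs_def)
        next
          case 2
          then show ?thesis by (simp add: fs_def)
        next
          case l: (3 l)
          then have "l < length ps" using 3 by simp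
          moreover have "ps ! l \<noteq> ?i" "ps ! l \<noteq> p"
            using l 3 dist nth_mem[OF \<open>l < length ps\<close>] set_ps by (auto simp: nth_eq_iff_index_eq)
          ultimately show ?thesis
            using l p i_ps by (simp add: nth coord_w coord_basis)
        qed
      qed
      moreover have "(fs ! i) (0, w) \<noteq> 0"
        using 3 p i_ps ab by (simp add: nth coord_w coord_basis)
      ultimately show ?thesis by blast
    qed
  qed
  have "lex_cone (take 1 fs) = halfspace_cone \<psi>"
    by (auto simp: fs_def halfspace_cone_def)
  then show ?thesis
    using lex_cone_chain[OF mono indep, of 1] len by simp
qed

text \<open>
  Upper bounds for the heights come from the rank and lower bounds from lexicographic chains. For
  the converse the coheight yields the shape of the cone, and the height is needed only to
  make \<open>\<psi>\<close> rational when the cone is a half-space containing the constants.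
\<close>

lemma height_coheight_standard:
  fixes P :: "('m laurent \<times> 'm laurent) set"
  assumes P: "prime_congruence P"
  shows "(height P, coheight P) = (enat (n + 1), 0) \<or> (height P, coheight P) = (enat n, 1)
    \<longleftrightarrow> standard_cone (L_set P)"
proof
  have C: "congruence P" using P by (simp add: prime_congruence_def)
  have P_eq: "P = cone_congruence L" if "L_set P = L" for L
    using prime_eq_cone_congruence[OF P] that by simp
  {
    assume "standard_cone (L_set P)"
    then consider "L_set P = UNIV"
      | \<psi> where "Modules.additive \<psi>" "L_set P = evaluation_cone \<psi>"
      | \<psi> where "unimodular \<psi>" "L_set P = halfspace_cone \<psi>"
      unfolding standard_cone_def by blast
    then show "(height P, coheight P) = (enat (n + 1), 0) \<or> (height P, coheight P) = (enat n, 1)"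
    proof cases
      case 1
      then have max: "P = maximum_congruence" using maximum_iff[OF P] by simp
      have zero: "Modules.additive (\<lambda>u :: 'm. 0 :: real)" by unfold_locales simp
      have "height P \<le> enat (n + 1)"
        using height_le_cone_rank[OF P] cone_rank_le[of "L_set P"] by (meson enat_ord_simps(1) order_trans)
      then have "height P = enat (n + 1)"
        using height_evaluation_ge(2)[OF zero] unfolding max by (rule antisym)
      then show ?thesis using coheight_maximum by (simp add: max)
    next
      case (2 \<psi>)
      have "height P \<le> enat n"
        using height_le_cone_rank[OF P] cone_rank_evaluation[OF 2(1)] unfolding 2(2)
        by (meson enat_ord_simps(1) order_trans)
      moreover have "enat n \<le> height P"
        using height_evaluation_ge(1)[OF 2(1)] P_eq[OF 2(2)] by simp
      moreover have "coheight P = 1"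
      proof (rule coheight_halfspace[OF P])
        show "Modules.additive (\<lambda>x. fst x + \<psi> (snd x))"
          by unfold_locales (simp add: additive.add[OF 2(1)])
        show "fst (1, 0) + \<psi> (snd (1, 0)) \<noteq> 0" by (simp add: additive.zero[OF 2(1)])
        show "L_set P = {x. 0 \<le> fst x + \<psi> (snd x)}" using 2(2) by (auto simp: evaluation_cone_def)
      qed
      ultimately show ?thesis by simp
    next
      case (3 \<psi>)
      then obtain e where \<psi>: "Modules.additive \<psi>" and e: "\<psi> e = 1" by (auto simp: unimodular_def)
      have "rank {u. \<psi> u = 0} + 1 \<le> n"
        using rank_kernel_less[OF \<psi>, of e] rank_le[of UNIV] e by simp
      then have "height P \<le> enat n"
        using height_le_cone_rank[OF P] cone_rank_halfspace[OF \<psi>] unfolding 3(2)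
        by (metis enat_ord_simps(1) order_trans)
      moreover have "enat n \<le> height P"
        using height_halfspace_ge[OF 3(1)] P_eq[OF 3(2)] by simp
      moreover have "coheight P = 1"
      proof (rule coheight_halfspace[OF P])
        show "Modules.additive (\<lambda>x. \<psi> (snd x))"
          by unfold_locales (simp add: additive.add[OF \<psi>])
        show "\<psi> (snd (0, e)) \<noteq> 0" by (simp add: e)
        show "L_set P = {x. 0 \<le> \<psi> (snd x)}" using 3(2) by (auto simp: halfspace_cone_def)
      qed
      ultimately show ?thesis by simp
    qed
  }
  {
    assume "(height P, coheight P) = (enat (n + 1), 0) \<or> (height P, coheight P) = (enat n, 1)"
    then consider "coheight P = 0" | "height P = enat n" "coheight P = 1" by auto
    then show "standard_cone (L_set P)"
    proof cases
      case 1
      then have "P = maximum_congruence" using coheight_ge_1[OF P] by fastforce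
      then show ?thesis by (simp add: standard_cone_def L_set_maximum)
    next
      case 2
      from archimedean_cone_cases[OF cone_L_set[OF C] prime_total[OF P] archimedean_if_coheight_1[OF P 2(2)]]
      show ?thesis
      proof cases
        case (3 \<psi> u)
        have "n \<le> rank {u. \<psi> u = 0} + 1"
          using height_le_cone_rank[OF P] unfolding 3(3) cone_rank_halfspace[OF 3(1)] 2(1) by simp
        then have "\<psi> v / \<psi> u \<in> \<rat>" for v using rational_if_rank_kernel[OF 3(1,2)] by blast
        then obtain \<theta> where "unimodular \<theta>" "halfspace_cone \<psi> = halfspace_cone \<theta>"
          using unimodular_if_rational[OF 3(1,2)] by blast
        then show ?thesis using 3(3) by (auto simp: standard_cone_def)
      qed (auto simp: standard_cone_def)
    qed
  }
qed

end

section \<open>The characterization\<close>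

theorem theorem3:
  fixes n :: nat
    and X :: "nat \<Rightarrow> 'm::ab_group_add"
    and P :: "('m laurent \<times> 'm laurent) set"
  assumes "free_basis n X"
    and "prime_congruence P"
  shows "(fin_gen_congruence P \<longleftrightarrow>
            (\<exists>F :: (real \<times> 'm) set. finite F \<and> L_set P = submonoid hull (F \<union> {0..} \<times> {0})))
       \<and> (fin_gen_congruence P \<longleftrightarrow>
            (height P, coheight P) = (enat (n + 1), 0) \<or> (height P, coheight P) = (enat n, 1))
       \<and> (fin_gen_congruence P \<longleftrightarrow>
            P = maximum_congruence \<or>
            geometric P \<or>
            (\<exists>(H :: nat \<Rightarrow> (real \<times> 'm real_ext) set) Hp K.
               is_flag 1 H Hp \<and> rational_hyperplane K \<and> H 1 = UNIV \<times> K \<and> corresponds P 1 H Hp))"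
proof -
  note P = assms(2)
  interpret free_abelian n X by unfold_locales (rule assms(1))
  have L: "cone (L_set P)" "is_total (L_set P)"
    using P cone_L_set prime_total by (auto simp: prime_congruence_def)
  have standard: "fin_gen_congruence P \<longleftrightarrow> standard_cone (L_set P)"
    using fin_gen_iff[OF P] fin_gen_cone_iff[OF L] by simp
  have flag: "(\<exists>(H :: nat \<Rightarrow> (real \<times> 'm real_ext) set) Hp K.
      is_flag 1 H Hp \<and> rational_hyperplane K \<and> H 1 = UNIV \<times> K \<and> corresponds P 1 H Hp)
      \<longleftrightarrow> (\<exists>\<psi>. unimodular \<psi> \<and> L_set P = halfspace_cone \<psi>)"
  proof (intro iffI; elim exE conjE)
    fix H :: "nat \<Rightarrow> (real \<times> 'm real_ext) set" and Hp K
    assume H: "is_flag 1 H Hp" "rational_hyperplane K" "H 1 = UNIV \<times> K" "corresponds P 1 H Hp"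
    obtain \<psi> :: "'m \<Rightarrow> real" where "unimodular \<psi>"
        "{(r, u). (r, real_emb u) \<in> flag_set 1 H Hp} = halfspace_cone \<psi>"
      by (rule halfspace_if_flag[OF H(1,3,2)])
    then show "\<exists>\<psi>. unimodular \<psi> \<and> L_set P = halfspace_cone \<psi>"
      using H(4) by (auto simp: corresponds_def)
  next
    fix \<psi> assume \<psi>: "unimodular \<psi>" "L_set P = halfspace_cone \<psi>"
    obtain H Hp K where "is_flag 1 H Hp" "H 1 = UNIV \<times> K" "rational_hyperplane K"
        "{(r, u). (r, real_emb u) \<in> flag_set 1 H Hp} = halfspace_cone \<psi>"
      by (rule flag_if_halfspace[OF \<psi>(1)])
    then show "\<exists>(H :: nat \<Rightarrow> (real \<times> 'm real_ext) set) Hp K.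
        is_flag 1 H Hp \<and> rational_hyperplane K \<and> H 1 = UNIV \<times> K \<and> corresponds P 1 H Hp"
      using \<psi>(2) unfolding corresponds_def by metis
  qed
  show ?thesis
    using fin_gen_iff[OF P] standard height_coheight_standard[OF P]
    unfolding flag geometric_iff[OF P] maximum_iff[OF P] by (simp only: standard_cone_def)
qed

end
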